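(* Let $n\ge 1$. The Foulkes characters $\phi_0,\phi_1,\ldots,\phi_{n-1}$ of $S_n$ result from applying the Gram--Schmidt process (with normalization), with respect to the inner product $[\,\cdot\,,\,\cdot\,]$ on $\mathrm{CF}_\ell(S_n)$, to the characters $1^{\ell},2^{\ell},\ldots,n^{\ell}$ taken in this order, where $k^{\ell}$ denotes the character $\pi\mapsto k^{\ell(\pi)}$ of $S_n$.
   Context: For $\pi\in S_n$, $\ell(\pi)$ is the number of cycles of $\pi$ (fixed points included), and $C_i=\{\pi\in S_n\mid \ell(\pi)=i\}$ for $1\le i\le n$; in particular $C_1$ is the set of $n$-cycles. $\mathrm{CF}_\ell(S_n)$ is the complex vector space of all functions $\vartheta:S_n\to\mathbb{C}$ that depend only on $\ell$; for such $\vartheta$, $\vartheta(C_i)$ is the common value of $\vartheta$ on $C_i$. The inner product on $\mathrm{CF}_\ell(S_n)$ is $$[\vartheta,\psi]=\frac{1}{|S_n|}\sum_{i,j=1}^{n}\vartheta(C_i)\,\overline{\psi(C_j)}\;\mathbf{E}\,|\sigma C_i\cap\tau C_j|,$$ where $\sigma,\tau$ are independent and uniformly random elements of $C_1$, $\sigma C_i=\{\sigma x\mid x\in C_i\}$, and $\mathbf{E}$ is expectation. For $0\le i\le n-1$, the Foulkes character $\phi_i$ of $S_n$ is the character afforded by the direct sum of the (skew) Specht modules $V_\beta$, one for each border shape $\beta$ (connected skew shape containing no $2\times 2$ square) with $n$ boxes and $i+1$ rows. Equivalently, $\phi_i(\pi)=\sum_{j=0}^{n-1}(-1)^{i-j}\binom{n+1}{i-j}(j+1)^{\ell(\pi)}$,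 with $\binom{a}{b}=0$ for $b<0$. *)

theory Defs
  imports "HOL-Probability.Probability" "HOL-Combinatorics.Orbits"
    "HOL-Library.Function_Algebras"
begin

section \<open>Functions on the symmetric group depending only on the number of cycles\<close>

text \<open>The symmetric group \<open>S_n\<close> is \<open>{p. p permutes {1..n}}\<close>, with product \<open>\<sigma> \<circ> \<tau>\<close>.\<close>

definition num_cycles :: "nat \<Rightarrow> (nat \<Rightarrow> nat) \<Rightarrow> nat" where
  "num_cycles n p = card (orbit p ` {1..n})"

definition cycle_class :: "nat \<Rightarrow> nat \<Rightarrow> (nat \<Rightarrow> nat) set" where
  "cycle_class n i = {p. p permutes {1..n} \<and> num_cycles n p = i}"

text \<open>
  A function on \<open>S_n\<close> is represented by any function on \<open>nat \<Rightarrow> nat\<close>; only its values at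
  permutations of \<open>{1..n}\<close> are relevant.
\<close>

definition CF_cyc :: "nat \<Rightarrow> ((nat \<Rightarrow> nat) \<Rightarrow> complex) set" where
  "CF_cyc n = {\<theta>. \<forall>p q. p permutes {1..n} \<longrightarrow> q permutes {1..n} \<longrightarrow>
                 num_cycles n p = num_cycles n q \<longrightarrow> \<theta> p = \<theta> q}"

definition class_value :: "nat \<Rightarrow> ((nat \<Rightarrow> nat) \<Rightarrow> complex) \<Rightarrow> nat \<Rightarrow> complex" where
  "class_value n \<theta> i = the_elem (\<theta> ` cycle_class n i)"

lemma class_value_eq:
  assumes "\<theta> \<in> CF_cyc n" and "p \<in> cycle_class n i"
  shows "class_value n \<theta> i = \<theta> p"
proof -
  have "\<theta> q = \<theta> p" if "q \<in> cycle_class n i" for q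
  proof -
    have "p permutes {1..n}" "q permutes {1..n}" "num_cycles n q = num_cycles n p"
      using assms(2) that unfolding cycle_class_def by simp_all
    then show ?thesis
      using assms(1) unfolding CF_cyc_def mem_Collect_eq by metis
  qed
  then have "\<theta> ` cycle_class n i = {\<theta> p}"
    using assms(2) by blast
  then show ?thesis
    by (simp add: class_value_def)
qed

definition cyc_inner ::
  "nat \<Rightarrow> ((nat \<Rightarrow> nat) \<Rightarrow> complex) \<Rightarrow> ((nat \<Rightarrow> nat) \<Rightarrow> complex) \<Rightarrow> complex" where
  "cyc_inner n \<theta> \<psi> = 1 / of_nat (card {p. p permutes {1..n}}) *
     (\<Sum>i=1..n. \<Sum>j=1..n. class_value n \<theta> i * cnj (class_value n \<psi> j) *
        of_real (measure_pmf.expectation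
          (pair_pmf (pmf_of_set (cycle_class n 1)) (pmf_of_set (cycle_class n 1)))
          (\<lambda>(\<sigma>, \<tau>). real (card ((\<lambda>x. \<sigma> \<circ> x) ` cycle_class n i \<inter> (\<lambda>x. \<tau> \<circ> x) ` cycle_class n j)))))"

definition cyc_power :: "nat \<Rightarrow> nat \<Rightarrow> (nat \<Rightarrow> nat) \<Rightarrow> complex" where
  "cyc_power n k p = of_nat k ^ num_cycles n p"

lemma cyc_power_in_CF_cyc: "cyc_power n k \<in> CF_cyc n"
  by (simp add: CF_cyc_def cyc_power_def)

section \<open>Gram--Schmidt process with normalization\<close>

text \<open>
  The form \<open>ip\<close> is linear in its first argument. The normalizing factor \<open>csqrt (ip u u)\<close> is the
  norm of \<open>u\<close>, since \<open>ip u u\<close> is a nonnegative real number for an inner product.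
\<close>

fun gram_schmidt ::
  "(('a \<Rightarrow> complex) \<Rightarrow> ('a \<Rightarrow> complex) \<Rightarrow> complex) \<Rightarrow> (nat \<Rightarrow> 'a \<Rightarrow> complex) \<Rightarrow> nat \<Rightarrow> 'a \<Rightarrow> complex"
where
  "gram_schmidt ip v k =
     (let u = (\<lambda>x. v k x - (\<Sum>j<k. ip (v k) (gram_schmidt ip v j) * gram_schmidt ip v j x))
      in (\<lambda>x. u x / csqrt (ip u u)))"

declare gram_schmidt.simps [simp del]

section \<open>Trace of a linear operator on a space of complex-valued functions\<close>

global_interpretation cfun: vector_space "\<lambda>(c::complex) (f :: 'a \<Rightarrow> complex) x. c * f x"
  by unfold_locales (simp_all add: fun_eq_iff distrib_left distrib_right mult.assoc)

text \<open>The trace of \<open>f\<close> on a finite-dimensional \<open>f\<close>-invariant subspace \<open>V\<close>.\<close>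

definition trace_on ::
  "('a \<Rightarrow> complex) set \<Rightarrow> (('a \<Rightarrow> complex) \<Rightarrow> ('a \<Rightarrow> complex)) \<Rightarrow> complex" where
  "trace_on V f =
     (let B = (SOME B. cfun.independent B \<and> cfun.span B = V)
      in \<Sum>b\<in>B. cfun.representation B (f b) b)"

section \<open>Border shapes\<close>

text \<open>
  Cells are pairs (row, column), with rows numbered downwards from 0 and columns numbered
  from 0 to the right.
\<close>

definition young_diagram :: "(nat \<times> nat) set \<Rightarrow> bool" where
  "young_diagram L \<longleftrightarrow> finite L \<and> (\<forall>(r, c)\<in>L. \<forall>r'\<le>r. \<forall>c'\<le>c. (r', c') \<in> L)"

definition skew_shape :: "(nat \<times> nat) set \<Rightarrow> bool" where
  "skew_shape B \<longleftrightarrow> (\<exists>L M. young_diagram L \<and> young_diagram M \<and> M \<subseteq> L \<and> B = L - M)"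

definition adjacent :: "nat \<times> nat \<Rightarrow> nat \<times> nat \<Rightarrow> bool" where
  "adjacent x y \<longleftrightarrow>
     (fst x = fst y \<and> (snd y = Suc (snd x) \<or> snd x = Suc (snd y))) \<or>
     (snd x = snd y \<and> (fst y = Suc (fst x) \<or> fst x = Suc (fst y)))"

definition connected_shape :: "(nat \<times> nat) set \<Rightarrow> bool" where
  "connected_shape B \<longleftrightarrow>
     (\<forall>x\<in>B. \<forall>y\<in>B. (x, y) \<in> {(a, b). a \<in> B \<and> b \<in> B \<and> adjacent a b}\<^sup>*)"

text \<open>
  Shapes are considered up to translation: the representative chosen is the one that meets
  row 0 and column 0.
\<close>

definition border_shapes :: "nat \<Rightarrow> nat \<Rightarrow> (nat \<times> nat) set set" where
  "border_shapes n m = {B. skew_shape B \<and> connected_shape B \<and>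
     (\<nexists>r c. {(r, c), (r, Suc c), (Suc r, c), (Suc r, Suc c)} \<subseteq> B) \<and>
     0 \<in> fst ` B \<and> 0 \<in> snd ` B \<and> card B = n \<and> card (fst ` B) = m}"

section \<open>Skew Specht modules and Foulkes characters\<close>

text \<open>
  A tabloid is the map taking each row index to the set of entries in that row. The permutation
  module spanned by tabloids is realized inside the complex-valued functions on such maps,
  a tabloid corresponding to its indicator function.
\<close>

type_synonym tabloid = "nat \<Rightarrow> nat set"

definition tableaux :: "nat \<Rightarrow> (nat \<times> nat) set \<Rightarrow> (nat \<times> nat \<Rightarrow> nat) set" where
  "tableaux n B = {t. bij_betw t B {1..n}}"

definition tabloid_of :: "(nat \<times> nat) set \<Rightarrow> (nat \<times> nat \<Rightarrow> nat) \<Rightarrow> tabloid" where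
  "tabloid_of B t = (\<lambda>r. t ` {b \<in> B. fst b = r})"

definition column_stabilizer ::
  "nat \<Rightarrow> (nat \<times> nat) set \<Rightarrow> (nat \<times> nat \<Rightarrow> nat) \<Rightarrow> (nat \<Rightarrow> nat) set" where
  "column_stabilizer n B t = {q. q permutes {1..n} \<and>
     (\<forall>c. q ` t ` {b \<in> B. snd b = c} = t ` {b \<in> B. snd b = c})}"

definition polytabloid ::
  "nat \<Rightarrow> (nat \<times> nat) set \<Rightarrow> (nat \<times> nat \<Rightarrow> nat) \<Rightarrow> tabloid \<Rightarrow> complex" where
  "polytabloid n B t = (\<lambda>T. \<Sum>q\<in>column_stabilizer n B t.
     of_int (sign q) * (if T = tabloid_of B (q \<circ> t) then 1 else 0))"

definition specht_module :: "nat \<Rightarrow> (nat \<times> nat) set \<Rightarrow> (tabloid \<Rightarrow> complex) set" where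
  "specht_module n B = cfun.span (polytabloid n B ` tableaux n B)"

text \<open>
  The external direct sum of the Specht modules of the border shapes with \<open>n\<close> boxes and
  \<open>i + 1\<close> rows; the component of \<open>F\<close> at \<open>B\<close> is \<open>\<lambda>T. F (B, T)\<close>.
\<close>

definition foulkes_module ::
  "nat \<Rightarrow> nat \<Rightarrow> ((nat \<times> nat) set \<times> tabloid \<Rightarrow> complex) set" where
  "foulkes_module n i = {F. \<forall>B.
     (B \<in> border_shapes n (i + 1) \<longrightarrow> (\<lambda>T. F (B, T)) \<in> specht_module n B) \<and>
     (B \<notin> border_shapes n (i + 1) \<longrightarrow> (\<lambda>T. F (B, T)) = (\<lambda>T. 0))}"

text \<open>
  The linear extension of the action of \<open>p\<close> on entries, which takes the tabloid \<open>T\<close> to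
  \<open>\<lambda>r. p ` T r\<close>, in every component.
\<close>

definition foulkes_action ::
  "(nat \<Rightarrow> nat) \<Rightarrow> ((nat \<times> nat) set \<times> tabloid \<Rightarrow> complex) \<Rightarrow>
   ((nat \<times> nat) set \<times> tabloid \<Rightarrow> complex)" where
  "foulkes_action p F = (\<lambda>(B, T). F (B, \<lambda>r. inv p ` T r))"

definition foulkes_char :: "nat \<Rightarrow> nat \<Rightarrow> (nat \<Rightarrow> nat) \<Rightarrow> complex" where
  "foulkes_char n i p = trace_on (foulkes_module n i) (foulkes_action p)"

end

theory Submission
  imports Defs
begin

text \<open>
  Two facts about the \<open>\<phi>\<^sub>i\<close> suffice: \<open>(k + 1)\<^sup>\<ell> = \<Sum>\<^sub>i binomial (n + k - i) n * \<phi>\<^sub>i\<close>, a unitriangular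
  relation for \<open>i \<le> k < n\<close>, and orthonormality.

  For the first, label the cells of a ribbon by \<open>1, \<dots>, n\<close> from the bottom left to the top right and
  let \<open>D\<close> be the set of upward steps. Pulling tabloids back to words identifies the Specht module of
  the ribbon with the left ideal \<open>A \<kappa>\<^sub>D \<rho>\<^sub>D\<close> of the group algebra \<open>A\<close>, where \<open>\<kappa>\<^sub>D\<close> is the signed sum over
  the Young subgroup generated by the adjacent transpositions in \<open>D\<close>, and \<open>\<rho>\<^sub>D\<close> the plain sum over
  the one generated by the others. By Solomon, \<open>A\<close> is the direct sum of these ideals, and the
  functions invariant under the Young subgroup of \<open>J\<close> are the sum of those with \<open>D\<close> disjoint from \<open>J\<close>:
  the sums are direct because \<open>\<kappa>\<close> and \<open>\<rho>\<close> are self-adjoint, and they exhaust because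
  \<open>w \<kappa>\<^sub>D \<rho>\<^sub>D\<close> with \<open>D\<close> the descent set of \<open>w\<close> has leading word \<open>w\<close> in the lexicographic order.
  Colourings fixed by a permutation are then counted by sorting them.

  For the second, the form \<open>[\<theta>, \<psi>]\<close> is the usual inner product of the averages of \<open>\<theta>\<close> and \<open>\<psi>\<close> over
  translates by full cycles. With \<open>\<Delta>(x) = \<Prod>\<^sub>c (1 - t^c)\<close>, the product taken over the cycle lengths
  of \<open>x\<close>, the average of \<open>k\<^sup>\<ell>\<close> at \<open>x\<close> is the coefficient of \<open>t^k\<close> in \<open>t \<Delta>(x) / (1 - t)^(n + 2)\<close>;
  hence the average of \<open>\<phi>\<^sub>i\<close> is the coefficient of \<open>t^i\<close> in \<open>\<Delta>(x) / (1 - t)\<close>, a hook character up to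
  sign, and these are orthonormal.
\<close>

text \<open>The two facts fit together because one matrix occurs twice. The series
  \<open>1 / (1 - t)^(n + 1)\<close> has the coefficients \<open>binomial (n + i) n\<close>, so the
  averages of \<open>(k + 1)\<^sup>\<ell>\<close> expand in the coefficients of
  \<open>\<Delta>(x) / (1 - t)\<close> with the very numbers by which
  \<open>(k + 1)\<^sup>\<ell>\<close> expands in the \<open>\<phi>\<^sub>i\<close>. A recursive
  comparison of the two triangular systems identifies the averages of the
  \<open>\<phi>\<^sub>i\<close>, without an explicit inverse matrix. The generating function of the
  averages is proved by induction on \<open>n\<close>, deleting the largest point: multiplying a
  coefficient by its index is \<open>t d/dt\<close>, so the recursion becomes a differential
  identity for \<Delta>. On the module side the trace is defined through an arbitrarily chosen
  basis, and no closed formula for a single ribbon is at hand. Traces are therefore computed from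
  spanning families with coefficient functionals, and the space of Young-invariant functions has its
  trace read off twice: from words with prescribed descents and from cosets. The second count is
  what colourings can see.\<close>

abbreviation transp :: "'a \<Rightarrow> 'a \<Rightarrow> 'a \<Rightarrow> 'a" where
  "transp \<equiv> Transposition.transpose"

abbreviation perms :: "nat \<Rightarrow> (nat \<Rightarrow> nat) set" where
  "perms n \<equiv> {p. p permutes {1..n}}"

lemma finite_perms: "finite (perms n)"
  by (rule finite_permutations) simp

section \<open>Orbits and transpositions\<close>

lemma permutation_comp_transpose:
  "permutation x \<Longrightarrow> permutation (x \<circ> transp a b)"
  by (simp add: permutation_compose permutation_swap_id)

lemma orbit_eq_of_mem:
  assumes "permutation x" "c \<in> orbit x a"
  shows "orbit x c = orbit x a"
  using orbit_cyclic_eq3[OF cyclic_on_orbit'[OF assms(1)] assms(2)] .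

text \<open>Only the images of \<open>a\<close> and \<open>b\<close> are exchanged. Starting from
  \<open>a\<close>, the new permutation runs through the old orbit of \<open>b\<close>, and on
  leaving \<open>b\<close> it continues through the old orbit of \<open>a\<close>.\<close>

lemma orbit_comp_transpose_merge:
  assumes x: "permutation x" and b: "b \<notin> orbit x a"
  shows "orbit (x \<circ> transp a b) c =
    (if c \<in> orbit x a \<union> orbit x b then orbit x a \<union> orbit x b else orbit x c)"
proof -
  define y where "y = x \<circ> transp a b"
  have y: "permutation y" unfolding y_def by (rule permutation_comp_transpose[OF x])
  have ya: "y a = x b" and yb: "y b = x a" and yo: "\<And>z. z \<noteq> a \<Longrightarrow> z \<noteq> b \<Longrightarrow> y z = x z"
    by (auto simp: y_def)
  have ax: "a \<in> orbit x a" and bx: "b \<in> orbit x b" and ay: "a \<in> orbit y a" 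
    using x y by (auto intro: permutation_self_in_orbit)
  have a_notin: "a \<notin> orbit x b"
    using b bx orbit_swap by metis
  \<comment> \<open>As long as \<open>b\<close> is not met, \<open>y\<close> follows
    \<open>x\<close> along the orbit of \<open>b\<close>; that orbit contains
    \<open>b\<close>.\<close>
  have b_in: "b \<in> orbit y a"
  proof (rule ccontr)
    assume nb: "b \<notin> orbit y a"
    have "z \<in> orbit y a \<and> z \<in> orbit x b" if "z \<in> orbit x b" for z
      using that
    proof induction
      case base
      then show ?case using orbit.base[of y a] orbit.base[of x b] ya by simp
    next
      case (step z)
      then have "z \<noteq> a" "z \<noteq> b" using a_notin nb by auto
      then show ?case using step yo orbit.step[of z y a] orbit.step[of z x b] by simp
    qed
    then show False using bx nb by blast
  qed
  let ?U = "orbit x a \<union> orbit x b"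
  have Uclosed: "y z \<in> ?U" if "z \<in> ?U" for z
    using that ya yb yo orbit.base[of x a] orbit.base[of x b] orbit.step[of z x]
    by (cases "z = a"; cases "z = b") auto
  have "orbit y a \<subseteq> ?U"
  proof
    fix z assume "z \<in> orbit y a"
    then show "z \<in> ?U"
      using Uclosed ax by induction auto
  qed
  moreover have closed: "x z \<in> orbit y a" if "z \<in> orbit y a" for z
    using that ya yb yo orbit.step[of z y a] orbit.step[of a y a] orbit.step[of b y a] ay b_in
    by (cases "z = a"; cases "z = b") auto
  have "z \<in> orbit y a" if "z \<in> orbit x a" for z
    using that closed ay by induction auto
  moreover have "z \<in> orbit y a" if "z \<in> orbit x b" for z
    using that closed b_in by induction auto
  ultimately have U: "orbit y a = ?U" by blast
  show ?thesis
  proof (cases "c \<in> ?U")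
    case True
    then show ?thesis using orbit_eq_of_mem[OF y, of c a] U y_def by simp
  next
    case False
    have "orbit y c = orbit x c"
    proof (rule orbit_cong)
      show "c \<in> orbit x c" using x by (rule permutation_self_in_orbit)
      fix s assume s: "s \<in> orbit x c"
      then have "orbit x s = orbit x c" using orbit_eq_of_mem[OF x] by simp
      then have "s \<noteq> a" "s \<noteq> b"
        using False permutation_self_in_orbit[OF x, of c] by auto
      then show "y s = x s" by (rule yo)
    qed
    then show ?thesis using False y_def by simp
  qed
qed

lemma orbit_eq_funpow_image:
  assumes "permutation x"
  shows "orbit x b = (\<lambda>i. (x ^^ i) b) ` {..<card (orbit x b)}"
    and "inj_on (\<lambda>i. (x ^^ i) b) {..<card (orbit x b)}"
proof -
  have b: "b \<in> orbit x b" using assms by (rule permutation_self_in_orbit)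
  have 1: "orbit x b = (\<lambda>i. (x ^^ i) b) ` {0..<funpow_dist1 x b b}"
    using orbit_conv_funpow_dist1[OF b] .
  have 2: "inj_on (\<lambda>i. (x ^^ i) b) {0..<funpow_dist1 x b b}"
    using inj_on_funpow_dist1[OF b] .
  have "card (orbit x b) = funpow_dist1 x b b"
    using 1 card_image[OF 2] by simp
  then show "orbit x b = (\<lambda>i. (x ^^ i) b) ` {..<card (orbit x b)}"
    and "inj_on (\<lambda>i. (x ^^ i) b) {..<card (orbit x b)}"
    using 1 2 by (simp_all add: lessThan_atLeast0)
qed

text \<open>Since \<open>y a = x b\<close>, the cycle closes up after
  \<open>x b, ..., (x ^^ j) b = a\<close>, which are \<open>j\<close> points. The remaining claims
  are the merging lemma applied to \<open>y\<close>, because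
  \<open>x = y \<circ> transp a b\<close>.\<close>

lemma orbit_comp_transpose_split:
  assumes x: "permutation x" and j: "0 < j" "j < card (orbit x b)"
  defines "a \<equiv> (x ^^ j) b"
  defines "y \<equiv> x \<circ> transp a b"
  shows "orbit y a \<union> orbit y b = orbit x b" "orbit y a \<inter> orbit y b = {}"
    "card (orbit y a) = j" "\<And>c. c \<notin> orbit x b \<Longrightarrow> orbit y c = orbit x c"
proof -
  let ?m = "card (orbit x b)"
  have y: "permutation y" unfolding y_def by (rule permutation_comp_transpose[OF x])
  note inj = orbit_eq_funpow_image(2)[OF x, of b]
  have bne: "(x ^^ i) b \<noteq> b" if "0 < i" "i < ?m" for i
    using inj_onD[OF inj, of i 0] that by auto
  have ya: "y a = x b" and yo: "\<And>z. z \<noteq> a \<Longrightarrow> z \<noteq> b \<Longrightarrow> y z = x z"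
    by (auto simp: y_def)
  have y_pow: "y ((x ^^ i) b) = (x ^^ Suc i) b" if "0 < i" "i < j" for i
  proof -
    have "(x ^^ i) b \<noteq> a" using inj_onD[OF inj, of i j] that j by (auto simp: a_def)
    then show ?thesis using yo bne[of i] that j by simp
  qed
  have eq: "orbit y a = (\<lambda>i. (x ^^ i) b) ` {1..j}"
  proof
    show "orbit y a \<subseteq> (\<lambda>i. (x ^^ i) b) ` {1..j}"
    proof
      fix z assume "z \<in> orbit y a"
      then show "z \<in> (\<lambda>i. (x ^^ i) b) ` {1..j}"
      proof induction
        case base
        then show ?case using ya j by (auto intro!: image_eqI[of _ _ 1])
      next
        case (step z)
        then obtain i where i: "z = (x ^^ i) b" "i \<in> {1..j}" by auto
        show ?case
        proof (cases "i = j")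
          case True
          then show ?thesis using i ya j by (auto simp: a_def intro!: image_eqI[of _ _ 1])
        next
          case False
          then show ?thesis using i y_pow
            by (intro image_eqI[of _ _ "Suc i"]) auto
        qed
      qed
    qed
    have "(x ^^ i) b \<in> orbit y a" if "1 \<le> i" "i \<le> j" for i
      using that
    proof (induction i rule: dec_induct)
      case base
      then show ?case using orbit.base[of y a] ya by simp
    next
      case (step i)
      then show ?case using orbit.step[of "(x ^^ i) b" y a] y_pow[of i] by auto
    qed
    then show "(\<lambda>i. (x ^^ i) b) ` {1..j} \<subseteq> orbit y a" by auto
  qed
  have "inj_on (\<lambda>i. (x ^^ i) b) {1..j}"
    using inj by (rule inj_on_subset) (use j in auto)
  then show "card (orbit y a) = j" using eq by (simp add: card_image)
  have bn: "b \<notin> orbit y a" 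
  proof
    assume "b \<in> orbit y a"
    then obtain i where "1 \<le> i" "i \<le> j" "(x ^^ i) b = b" unfolding eq by force
    then show False using bne[of i] j by simp
  qed
  have xy: "x = y \<circ> transp a b" by (auto simp: y_def comp_assoc)
  note m = orbit_comp_transpose_merge[OF y bn, folded xy]
  have by': "b \<in> orbit y b" using y by (rule permutation_self_in_orbit)
  then show U: "orbit y a \<union> orbit y b = orbit x b" using m[of b] by simp
  show "orbit y a \<inter> orbit y b = {}"
    using bn by' orbit_eq_of_mem[OF y, of _ a] orbit_eq_of_mem[OF y, of _ b] by (metis disjoint_iff)
  show "orbit y c = orbit x c" if "c \<notin> orbit x b" for c
    using m[of c] that unfolding U by (simp del: Un_iff)
qed

lemma orbit_subset_invariant:
  assumes "x ` A \<subseteq> A" "a \<in> A"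
  shows "orbit x a \<subseteq> A"
proof
  fix z assume "z \<in> orbit x a"
  then show "z \<in> A" using assms by induction auto
qed

lemma orbits_comp_transpose_merge:
  assumes x: "permutation x" and A: "x ` A \<subseteq> A" "a \<in> A" "b \<in> A" and b: "b \<notin> orbit x a"
  shows "orbit (x \<circ> transp a b) ` A =
    insert (orbit x a \<union> orbit x b) (orbit x ` A - {orbit x a, orbit x b})"
proof -
  let ?U = "orbit x a \<union> orbit x b"
  have 1: "orbit (x \<circ> transp a b) c = ?U" if "c \<in> ?U" for c
    using orbit_comp_transpose_merge[OF x b, of c] that by simp
  have 2: "orbit (x \<circ> transp a b) c = orbit x c" if "c \<notin> ?U" for c
    using orbit_comp_transpose_merge[OF x b, of c] that by simp
  have a: "a \<in> ?U" using permutation_self_in_orbit[OF x] by simp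
  have "orbit (x \<circ> transp a b) ` A = orbit (x \<circ> transp a b) ` (A \<inter> ?U) \<union> orbit (x \<circ> transp a b) ` (A - ?U)"
    by blast
  also have "orbit (x \<circ> transp a b) ` (A \<inter> ?U) = {?U}"
  proof -
    have "A \<inter> ?U \<noteq> {}" using a A by blast
    then show ?thesis using 1 by fastforce
  qed
  also have "orbit (x \<circ> transp a b) ` (A - ?U) = orbit x ` (A - ?U)"
    by (rule image_cong) (simp_all add: 2)
  also have "orbit x ` (A - ?U) = orbit x ` A - {orbit x a, orbit x b}"
  proof -
    have "c \<in> ?U \<longleftrightarrow> orbit x c \<in> {orbit x a, orbit x b}" for c
      using orbit_eq_of_mem[OF x, of c] permutation_self_in_orbit[OF x, of c]
      by (metis UnE UnI1 UnI2 insert_iff singletonD)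
    then show ?thesis by (auto simp: image_iff)
  qed
  also have "{?U} \<union> (orbit x ` A - {orbit x a, orbit x b}) = insert ?U (orbit x ` A - {orbit x a, orbit x b})"
    by simp
  finally show ?thesis .
qed

lemma card_orbits_comp_transpose_merge:
  assumes x: "permutation x" and A: "x ` A \<subseteq> A" "a \<in> A" "b \<in> A" "finite A" and b: "b \<notin> orbit x a"
  shows "Suc (card (orbit (x \<circ> transp a b) ` A)) = card (orbit x ` A)"
proof -
  let ?U = "orbit x a \<union> orbit x b" and ?R = "orbit x ` A - {orbit x a, orbit x b}"
  have ne: "orbit x a \<noteq> orbit x b" using b permutation_self_in_orbit[OF x] by metis
  have "?U \<notin> orbit x ` A"
  proof
    assume "?U \<in> orbit x ` A"
    then obtain c where "?U = orbit x c" by auto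
    then have "orbit x a = orbit x c" "orbit x b = orbit x c"
      using orbit_eq_of_mem[OF x] permutation_self_in_orbit[OF x] by (metis UnI1, metis UnI2)
    then show False using ne by simp
  qed
  then have "card (insert ?U ?R) = Suc (card ?R)" using A by simp
  moreover have "card ?R = card (orbit x ` A) - 2"
    using A ne by (subst card_Diff_subset) auto
  moreover have "card {orbit x a, orbit x b} \<le> card (orbit x ` A)"
    using A by (intro card_mono) auto
  ultimately show ?thesis
    using orbits_comp_transpose_merge[OF x A(1-3) b] ne by simp
qed

text \<open>A transposition inside an invariant set either merges two orbits or splits one, and
  splitting is merging read backwards; the number of orbits changes by one in both cases.\<close>

lemma parity_orbits_comp_transpose:
  assumes x: "permutation x" and A: "x ` A = A" "a \<in> A" "b \<in> A" "finite A" and ab: "a \<noteq> b"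
  shows "(-1::int) ^ card (orbit (x \<circ> transp a b) ` A) = - ((-1) ^ card (orbit x ` A))"
proof (cases "b \<in> orbit x a")
  case False
  then show ?thesis
    using card_orbits_comp_transpose_merge[OF x _ A(2-4)] A(1) by (metis order_refl power_Suc mult_minus1 minus_minus)
next
  case True
  let ?y = "x \<circ> transp a b"
  have y: "permutation ?y" by (rule permutation_comp_transpose[OF x])
  have xy: "x = ?y \<circ> transp a b" by (simp add: comp_assoc)
  have "a \<in> orbit x b" using True orbit_eq_of_mem[OF x] permutation_self_in_orbit[OF x] by metis
  then obtain j where j: "j < card (orbit x b)" "a = (x ^^ j) b"
    using orbit_eq_funpow_image(1)[OF x, of b] by auto
  then have "0 < j" using ab by (cases j) auto
  then have "b \<notin> orbit ?y a"
    using orbit_comp_transpose_split(2)[OF x _ j(1)] permutation_self_in_orbit[OF y, of b] j(2) by blast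
  moreover have "?y ` A \<subseteq> A" using A by (auto simp: Transposition.transpose_def)
  ultimately have "Suc (card (orbit x ` A)) = card (orbit ?y ` A)"
    using card_orbits_comp_transpose_merge[OF y _ A(2-4)] xy by simp
  then show ?thesis by (metis power_Suc mult_minus1)
qed

section \<open>The cycle polynomial of a permutation\<close>

text \<open>This is \<open>det (1 - t P)\<close> for the permutation matrix \<open>P\<close> of
  \<open>x\<close>. It is taken as a power series because it is compared with generating
  functions.\<close>

definition cyc_poly :: "nat \<Rightarrow> (nat \<Rightarrow> nat) \<Rightarrow> int fps" where
  "cyc_poly n x = (\<Prod>Q\<in>orbit x ` {1..n}. 1 - fps_X ^ card Q)"

lemma permutes_interval_permutation: "x permutes {1..n::nat} \<Longrightarrow> permutation x"
  using permutation_permutes finite_atLeastAtMost by blast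

lemma permutes_interval_Suc: "x permutes {1..n::nat} \<Longrightarrow> x permutes {1..Suc n}"
  by (erule permutes_subset) auto

lemma permutes_Suc_fixed:
  assumes "x permutes {1..Suc n}" "x (Suc n) = Suc n"
  shows "x permutes {1..n}"
  by (rule permutes_superset[OF assms(1)]) (use assms(2) in \<open>auto simp: le_Suc_eq\<close>)

lemma permutes_comp_transp:
  "x permutes S \<Longrightarrow> a \<in> S \<Longrightarrow> b \<in> S \<Longrightarrow> x \<circ> transp a b permutes S"
  by (intro permutes_compose permutes_swap_id)

lemma orbit_fixed: "x a = a \<Longrightarrow> orbit x a = {a}"
  by (simp add: orbit_eq_singleton_iff)

lemma orbits_Suc_fixed:
  assumes "x permutes {1..n}"
  shows "orbit x ` {1..Suc n} = insert {Suc n} (orbit x ` {1..n})"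
    and "{Suc n} \<notin> orbit x ` {1..n}"
proof -
  have "x (Suc n) = Suc n" using assms by (auto simp: permutes_def)
  then show "orbit x ` {1..Suc n} = insert {Suc n} (orbit x ` {1..n})"
    by (simp add: atLeastAtMostSuc_conv orbit_fixed)
  show "{Suc n} \<notin> orbit x ` {1..n}"
    using permutes_orbit_subset[OF assms] by force
qed

lemma num_cycles_Suc_fixed:
  "x permutes {1..n} \<Longrightarrow> num_cycles (Suc n) x = Suc (num_cycles n x)"
  unfolding num_cycles_def orbits_Suc_fixed(1) using orbits_Suc_fixed(2) by simp

lemma cyc_poly_Suc_fixed:
  "x permutes {1..n} \<Longrightarrow> cyc_poly (Suc n) x = (1 - fps_X) * cyc_poly n x"
  unfolding cyc_poly_def orbits_Suc_fixed(1) using orbits_Suc_fixed(2) by simp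

text \<open>The point \<open>Suc n\<close> is fixed by \<open>x\<close>, so the transposition
  inserts it into the cycle of \<open>b\<close>, directly after \<open>b\<close>: a merge with a
  one-point orbit.\<close>

lemma
  assumes x: "x permutes {1..n}" and b: "b \<in> {1..n}"
  shows num_cycles_insert: "num_cycles (Suc n) (x \<circ> transp b (Suc n)) = num_cycles n x"
    and orbits_insert: "orbit (x \<circ> transp b (Suc n)) ` {1..Suc n} =
      insert (insert (Suc n) (orbit x b)) (orbit x ` {1..n} - {orbit x b})"
proof -
  note p = permutes_interval_permutation[OF x]
  have x': "x permutes {1..Suc n}" by (rule permutes_interval_Suc[OF x])
  have fx: "x (Suc n) = Suc n" using x by (auto simp: permutes_def)
  have sub: "orbit x b \<subseteq> {1..n}" using permutes_orbit_subset[OF x b] .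
  have nin: "Suc n \<notin> orbit x b" using sub by auto
  have im: "x ` {1..Suc n} \<subseteq> {1..Suc n}" using permutes_image[OF x'] by simp
  have mem: "b \<in> {1..Suc n}" "Suc n \<in> {1..Suc n}" using b by auto
  show "num_cycles (Suc n) (x \<circ> transp b (Suc n)) = num_cycles n x"
    using card_orbits_comp_transpose_merge[OF p im mem _ nin] num_cycles_Suc_fixed[OF x]
    by (simp add: num_cycles_def)
  have "insert {Suc n} (orbit x ` {1..n}) - {orbit x b, {Suc n}} = orbit x ` {1..n} - {orbit x b}"
    using orbits_Suc_fixed(2)[OF x] by blast
  then show "orbit (x \<circ> transp b (Suc n)) ` {1..Suc n} =
      insert (insert (Suc n) (orbit x b)) (orbit x ` {1..n} - {orbit x b})"
    unfolding orbits_comp_transpose_merge[OF p im mem nin] orbits_Suc_fixed(1)[OF x] orbit_fixed[of x "Suc n", OF fx]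
    by simp
qed

text \<open>The factor of \<open>cyc_poly\<close> left over when the orbits in \<open>R\<close> are removed; writing everything in
  terms of it keeps the identities below free of division.\<close>

definition cyc_poly_rest :: "nat \<Rightarrow> (nat \<Rightarrow> nat) \<Rightarrow> nat set set \<Rightarrow> int fps" where
  "cyc_poly_rest n x R = (\<Prod>Q\<in>orbit x ` {1..n} - R. 1 - fps_X ^ card Q)"

lemma cyc_poly_split_off:
  assumes "Q \<in> orbit x ` {1..n} - R"
  shows "cyc_poly_rest n x R = (1 - fps_X ^ card Q) * cyc_poly_rest n x (insert Q R)"
proof -
  have *: "orbit x ` {1..n} - R = insert Q (orbit x ` {1..n} - insert Q R)" using assms by auto
  show ?thesis unfolding cyc_poly_rest_def by (subst *) simp
qed

lemma cyc_poly_eq_rest: "cyc_poly n x = cyc_poly_rest n x {}"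
  by (simp add: cyc_poly_def cyc_poly_rest_def)

lemma finite_orbit_permutation: "permutation x \<Longrightarrow> finite (orbit x a)"
  by (simp add: finite_orbit permutation_self_in_orbit)

lemma cyc_poly_insert:
  assumes x: "x permutes {1..n}" and b: "b \<in> {1..n}"
  shows "cyc_poly (Suc n) (x \<circ> transp b (Suc n)) =
    (1 - fps_X ^ Suc (card (orbit x b))) * cyc_poly_rest n x {orbit x b}"
proof -
  have sub: "orbit x c \<subseteq> {1..n}" if "c \<in> {1..n}" for c using permutes_orbit_subset[OF x that] .
  have nin: "Suc n \<notin> orbit x b" using sub[OF b] by auto
  have nin': "insert (Suc n) (orbit x b) \<notin> orbit x ` {1..n} - {orbit x b}"
  proof
    assume "insert (Suc n) (orbit x b) \<in> orbit x ` {1..n} - {orbit x b}"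
    then obtain c where "c \<in> {1..n}" "insert (Suc n) (orbit x b) = orbit x c" by blast
    then show False using sub[of c] by auto
  qed
  have "card (insert (Suc n) (orbit x b)) = Suc (card (orbit x b))"
    using nin finite_orbit_permutation[OF permutes_interval_permutation[OF x]] by simp
  then show ?thesis
    unfolding cyc_poly_def orbits_insert[OF x b] cyc_poly_rest_def using nin' by simp
qed

lemma cyc_poly_merge:
  assumes x: "x permutes {1..n}" and a: "a \<in> {1..n}" and b: "b \<in> {1..n}" and ab: "b \<notin> orbit x a"
  shows "cyc_poly n (x \<circ> transp a b) =
    (1 - fps_X ^ (card (orbit x a) + card (orbit x b))) * cyc_poly_rest n x {orbit x a, orbit x b}"
proof -
  note p = permutes_interval_permutation[OF x]
  have disj: "orbit x a \<inter> orbit x b = {}"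
    using ab orbit_eq_of_mem[OF p, of _ a] orbit_eq_of_mem[OF p, of _ b] permutation_self_in_orbit[OF p, of b]
    by (metis disjoint_iff)
  have im: "x ` {1..n} \<subseteq> {1..n}" using permutes_image[OF x] by simp
  have nin: "orbit x a \<union> orbit x b \<notin> orbit x ` {1..n} - {orbit x a, orbit x b}"
  proof
    assume "orbit x a \<union> orbit x b \<in> orbit x ` {1..n} - {orbit x a, orbit x b}"
    then obtain c where c: "orbit x a \<union> orbit x b = orbit x c" "orbit x c \<noteq> orbit x a" by auto
    then show False using orbit_eq_of_mem[OF p, of a c] permutation_self_in_orbit[OF p, of a] by auto
  qed
  have "card (orbit x a \<union> orbit x b) = card (orbit x a) + card (orbit x b)"
    using disj by (simp add: card_Un_disjoint finite_orbit_permutation[OF p])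
  then show ?thesis
    unfolding cyc_poly_def orbits_comp_transpose_merge[OF p im a b ab] cyc_poly_rest_def
    using nin by simp
qed

lemma cyc_poly_split:
  assumes x: "x permutes {1..n}" and b: "b \<in> {1..n}" and j: "0 < j" "j < card (orbit x b)"
  shows "cyc_poly n (x \<circ> transp ((x ^^ j) b) b) =
    (1 - fps_X ^ j) * (1 - fps_X ^ (card (orbit x b) - j)) * cyc_poly_rest n x {orbit x b}"
proof -
  note p = permutes_interval_permutation[OF x]
  define a where "a = (x ^^ j) b"
  define y where "y = x \<circ> transp a b"
  note s = orbit_comp_transpose_split[OF p j, folded a_def, folded y_def]
  have a_in: "a \<in> orbit x b"
    unfolding a_def using orbit_eq_funpow_image(1)[OF p, of b] j by auto
  then have a: "a \<in> {1..n}" using permutes_orbit_subset[OF x b] by auto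
  have y: "y permutes {1..n}" unfolding y_def by (rule permutes_comp_transp[OF x a b])
  note py = permutes_interval_permutation[OF y]
  have ne: "orbit y a \<noteq> orbit y b" using s(2) permutation_self_in_orbit[OF py] by blast
  have eq: "orbit y ` {1..n} - {orbit y a, orbit y b} = orbit x ` {1..n} - {orbit x b}"
  proof -
    have 1: "orbit y c \<in> {orbit y a, orbit y b} \<longleftrightarrow> c \<in> orbit x b" for c
      using s(1) orbit_eq_of_mem[OF py, of c] permutation_self_in_orbit[OF py, of c]
      by (metis Un_iff insert_iff singletonD)
    have 2: "orbit x c = orbit x b \<longleftrightarrow> c \<in> orbit x b" for c
      using orbit_eq_of_mem[OF p, of c b] permutation_self_in_orbit[OF p, of c] by auto
    have "orbit y ` {1..n} - {orbit y a, orbit y b} = orbit y ` ({1..n} - orbit x b)"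
      using 1 by (auto simp: image_iff)
    also have "\<dots> = orbit x ` ({1..n} - orbit x b)"
      by (rule image_cong) (auto simp: s(4))
    also have "\<dots> = orbit x ` {1..n} - {orbit x b}"
      using 2 by (auto simp: image_iff)
    finally show ?thesis .
  qed
  have "card (orbit y a) + card (orbit y b) = card (orbit x b)"
    using s(1,2) by (metis card_Un_disjoint finite_orbit_permutation[OF py])
  then have cb: "card (orbit y b) = card (orbit x b) - j" using s(3) by simp
  have "cyc_poly n y = (1 - fps_X ^ card (orbit y a)) * cyc_poly_rest n y {orbit y a}"
    unfolding cyc_poly_eq_rest using a by (intro cyc_poly_split_off) auto
  also have "cyc_poly_rest n y {orbit y a} = (1 - fps_X ^ card (orbit y b)) * cyc_poly_rest n y {orbit y b, orbit y a}"
    using b ne by (intro cyc_poly_split_off) auto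
  also have "cyc_poly_rest n y {orbit y b, orbit y a} = cyc_poly_rest n x {orbit x b}"
    unfolding cyc_poly_rest_def using eq by (simp add: insert_commute)
  finally show ?thesis
    unfolding a_def[symmetric] y_def[symmetric] using s(3) cb by (simp add: mult.assoc)
qed

section \<open>The operator \<open>t d/dt\<close> on \<Delta>, and the geometric sums arising from
  splittings\<close>

lemma fps_X_mult_deriv_power: "fps_X * fps_deriv (fps_X ^ c :: int fps) = of_nat c * fps_X ^ c"
proof (induction c)
  case (Suc c)
  have "fps_X * fps_deriv (fps_X ^ Suc c :: int fps) = fps_X ^ Suc c + fps_X * (fps_X * fps_deriv (fps_X ^ c))"
    by (simp del: fps_deriv_power add: algebra_simps)
  then show ?case unfolding Suc.IH by (simp add: algebra_simps)
qed simp

text \<open>The Leibniz rule, left as a sum over the omitted factor; a logarithmic derivative would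
  divide by \<open>1 - t^c\<close>.\<close>

lemma fps_X_mult_deriv_prod:
  assumes "finite F"
  shows "fps_X * fps_deriv (\<Prod>Q\<in>F. 1 - fps_X ^ card Q :: int fps) =
    (\<Sum>Q\<in>F. - of_nat (card Q) * fps_X ^ card Q * (\<Prod>P\<in>F - {Q}. 1 - fps_X ^ card P))"
  using assms
proof induction
  case empty
  then show ?case by simp
next
  case (insert R F)
  let ?g = "\<lambda>Q. 1 - fps_X ^ card Q :: int fps"
  have 1: "(\<Prod>P\<in>insert R F - {Q}. ?g P) = ?g R * (\<Prod>P\<in>F - {Q}. ?g P)" if "Q \<in> F" for Q
  proof -
    have "insert R F - {Q} = insert R (F - {Q})" using that insert by auto
    then show ?thesis using insert by simp
  qed
  have 2: "(\<Prod>P\<in>insert R F - {R}. ?g P) = (\<Prod>P\<in>F. ?g P)" using insert by simp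
  have "fps_X * fps_deriv (\<Prod>Q\<in>insert R F. ?g Q) =
     - (fps_X * fps_deriv (fps_X ^ card R)) * (\<Prod>Q\<in>F. ?g Q) + ?g R * (fps_X * fps_deriv (\<Prod>Q\<in>F. ?g Q))"
    using insert by (simp add: algebra_simps)
  also have "\<dots> = - of_nat (card R) * fps_X ^ card R * (\<Prod>Q\<in>F. ?g Q) +
     ?g R * (\<Sum>Q\<in>F. - of_nat (card Q) * fps_X ^ card Q * (\<Prod>P\<in>F - {Q}. ?g P))"
    unfolding insert.IH fps_X_mult_deriv_power by simp
  also have "\<dots> = (\<Sum>Q\<in>insert R F. - of_nat (card Q) * fps_X ^ card Q * (\<Prod>P\<in>insert R F - {Q}. ?g P))"
    using insert 2 by (simp add: 1 sum_distrib_left mult_ac)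
  finally show ?case .
qed

lemma geometric_fps: "1 \<le> m \<Longrightarrow> (1 - fps_X) * (\<Sum>j\<in>{1..<m}. fps_X ^ j :: int fps) = fps_X - fps_X ^ m"
proof (induction m rule: nat_induct_at_least)
  case (Suc m)
  have "(1 - fps_X) * (\<Sum>j\<in>{1..<Suc m}. fps_X ^ j :: int fps) =
    (1 - fps_X) * (\<Sum>j\<in>{1..<m}. fps_X ^ j) + (1 - fps_X) * fps_X ^ m"
    using Suc.hyps by (simp add: distrib_left)
  then show ?case unfolding Suc.IH by (simp add: algebra_simps)
qed simp

text \<open>Multiplying out leaves the geometric sums of \<open>t^j\<close> and
  \<open>t^(m - j)\<close>, which agree by reversal; the factor \<open>1 - t\<close> puts them in
  closed form. The summands are the factors created by cutting an orbit of length \<open>m\<close>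
  into lengths \<open>j\<close> and \<open>m - j\<close>.\<close>

lemma split_sum_fps:
  assumes "1 \<le> m"
  shows "(1 - fps_X) * (\<Sum>j\<in>{1..<m}. (1 - fps_X ^ j) * (1 - fps_X ^ (m - j)) :: int fps) =
    (1 - fps_X) * ((of_nat m - 1) * (1 + fps_X ^ m)) - 2 * (fps_X - fps_X ^ m)"
proof -
  let ?S = "\<Sum>j\<in>{1..<m}. fps_X ^ j :: int fps"
  have rev: "(\<Sum>j\<in>{1..<m}. fps_X ^ (m - j) :: int fps) = ?S"
    by (rule sum.reindex_bij_witness[of _ "\<lambda>j. m - j" "\<lambda>j. m - j"]) auto
  have "(\<Sum>j\<in>{1..<m}. (1 - fps_X ^ j) * (1 - fps_X ^ (m - j)) :: int fps) =
    (\<Sum>j\<in>{1..<m}. (1 + fps_X ^ m) - fps_X ^ j - fps_X ^ (m - j))"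
    by (intro sum.cong) (auto simp: algebra_simps simp flip: power_add)
  also have "\<dots> = of_nat (m - 1) * (1 + fps_X ^ m) - 2 * ?S"
    unfolding sum_subtractf rev by simp
  also have "(1 - fps_X) * \<dots> = (1 - fps_X) * (of_nat (m - 1) * (1 + fps_X ^ m)) - 2 * ((1 - fps_X) * ?S)"
    by (simp only: right_diff_distrib mult.left_commute)
  finally show ?thesis
    unfolding geometric_fps[OF assms] using assms by (simp add: of_nat_diff)
qed

lemma sum_over_orbits:
  fixes x :: "nat \<Rightarrow> nat"
  assumes "x permutes {1..n}"
  shows "(\<Sum>Q\<in>orbit x ` {1..n}. \<Sum>a\<in>Q. f a) = (\<Sum>a\<in>{1..n}. f a)"
proof -
  note p = permutes_interval_permutation[OF assms]
  have U: "\<Union> (orbit x ` {1..n}) = {1..n}"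
    using permutes_orbit_subset[OF assms] permutation_self_in_orbit[OF p] by blast
  have "sum f (\<Union> (orbit x ` {1..n})) = (sum \<circ> sum) f (orbit x ` {1..n})"
  proof (rule sum.Union_disjoint)
    show "\<forall>A\<in>orbit x ` {1..n}. finite A" using finite_orbit_permutation[OF p] by blast
    show "\<forall>A\<in>orbit x ` {1..n}. \<forall>B\<in>orbit x ` {1..n}. A \<noteq> B \<longrightarrow> A \<inter> B = {}"
    proof (intro ballI impI)
      fix A B assume "A \<in> orbit x ` {1..n}" "B \<in> orbit x ` {1..n}" "A \<noteq> B"
      then show "A \<inter> B = {}" using orbit_eq_of_mem[OF p] by (metis disjoint_iff imageE)
    qed
  qed
  then show ?thesis using U by simp
qed

text \<open>Sums over all \<open>a\<close>: points outside the orbit of \<open>b\<close> merge two orbits, and their contribution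
  cancels against the derivative; points of the orbit of \<open>b\<close> split it.\<close>

lemma cyc_poly_key_identity:
  assumes x: "x permutes {1..n}" and b: "b \<in> {1..n}"
  shows "(1 - fps_X) * (fps_X * fps_deriv (cyc_poly n x) + (\<Sum>a\<in>{1..n}. cyc_poly n (x \<circ> transp a b))) =
    of_nat n * cyc_poly (Suc n) (x \<circ> transp b (Suc n)) - of_nat (n + 2) * fps_X * cyc_poly n x"
proof -
  note p = permutes_interval_permutation[OF x]
  define B where "B = orbit x b"
  define m where "m = card B"
  define F where "F = orbit x ` {1..n} - {B}"
  define R where "R = cyc_poly_rest n x {B}"
  define P where "P Q = (\<Prod>T\<in>F - {Q}. 1 - fps_X ^ card T :: int fps)" for Q
  have Bin: "B \<in> orbit x ` {1..n}" using b by (auto simp: B_def)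
  have Bsub: "B \<subseteq> {1..n}" using permutes_orbit_subset[OF x b] by (simp add: B_def)
  have bB: "b \<in> B" using permutation_self_in_orbit[OF p] by (simp add: B_def)
  have m: "1 \<le> m" using bB Bsub finite_subset by (fastforce simp: m_def Suc_le_eq card_gt_0_iff)
  have F: "finite F" by (simp add: F_def)
  have RP: "R = (1 - fps_X ^ card Q) * P Q" if "Q \<in> F" for Q
    using F that unfolding R_def cyc_poly_rest_def P_def F_def[symmetric] by (simp add: prod.remove)
  have D: "cyc_poly n x = (1 - fps_X ^ m) * R"
    unfolding R_def m_def cyc_poly_eq_rest using Bin by (intro cyc_poly_split_off) auto
  have D': "fps_X * fps_deriv (cyc_poly n x) = - of_nat m * fps_X ^ m * R +
     (1 - fps_X ^ m) * (\<Sum>Q\<in>F. - of_nat (card Q) * fps_X ^ card Q * P Q)"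
  proof -
    have "fps_X * fps_deriv (cyc_poly n x) =
      - (fps_X * fps_deriv (fps_X ^ m)) * R + (1 - fps_X ^ m) * (fps_X * fps_deriv R)"
      unfolding D by (simp del: fps_deriv_power add: algebra_simps)
    then show ?thesis
      unfolding fps_X_mult_deriv_power R_def cyc_poly_rest_def F_def[symmetric] fps_X_mult_deriv_prod[OF F] P_def
      by simp
  qed
  have others: "(\<Sum>a\<in>{1..n} - B. cyc_poly n (x \<circ> transp a b)) =
      (\<Sum>Q\<in>F. of_nat (card Q) * (1 - fps_X ^ (card Q + m)) * P Q)"
  proof -
    \<comment> \<open>Extension by 0 on \<open>B\<close> lets the sum run over all orbits; the orbit
      of \<open>b\<close> then drops out.\<close>
    let ?f = "\<lambda>a. if a \<in> B then 0 else cyc_poly n (x \<circ> transp a b)"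
    have "(\<Sum>a\<in>{1..n} - B. cyc_poly n (x \<circ> transp a b)) = (\<Sum>a\<in>{1..n}. ?f a)"
      by (rule sum.mono_neutral_cong_left) auto
    also have "\<dots> = (\<Sum>Q\<in>orbit x ` {1..n}. \<Sum>a\<in>Q. ?f a)"
      by (rule sum_over_orbits[OF x, symmetric])
    also have "\<dots> = (\<Sum>Q\<in>F. \<Sum>a\<in>Q. ?f a)"
      by (rule sum.mono_neutral_right) (auto simp: F_def intro!: sum.neutral)
    also have "\<dots> = (\<Sum>Q\<in>F. of_nat (card Q) * (1 - fps_X ^ (card Q + m)) * P Q)"
    proof (rule sum.cong[OF refl])
      fix Q assume Q: "Q \<in> F"
      then obtain c where c: "c \<in> {1..n}" "Q = orbit x c" "orbit x c \<noteq> B" unfolding F_def by blast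
      have "?f a = (1 - fps_X ^ (card Q + m)) * P Q" if a: "a \<in> Q" for a
      proof -
        have oa: "orbit x a = Q" using a c orbit_eq_of_mem[OF p] by simp
        have a': "a \<in> {1..n}" using a c permutes_orbit_subset[OF x] by blast
        have "a \<notin> B" using oa c orbit_eq_of_mem[OF p, of a b] by (auto simp: B_def)
        have "b \<notin> orbit x a" using oa c orbit_eq_of_mem[OF p, of b a] by (auto simp: B_def)
        note mg = cyc_poly_merge[OF x a' b this, unfolded oa, folded B_def, folded m_def]
        have "cyc_poly_rest n x {Q, B} = P Q"
          unfolding cyc_poly_rest_def P_def F_def by (rule prod.cong) auto
        then show ?thesis using mg \<open>a \<notin> B\<close> by simp
      qed
      then show "(\<Sum>a\<in>Q. ?f a) = of_nat (card Q) * (1 - fps_X ^ (card Q + m)) * P Q"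
        by (simp add: mult.assoc)
    qed
    finally show ?thesis .
  qed
  have same: "(\<Sum>a\<in>B. cyc_poly n (x \<circ> transp a b)) =
      (1 - fps_X ^ m) * R + (\<Sum>j\<in>{1..<m}. (1 - fps_X ^ j) * (1 - fps_X ^ (m - j))) * R"
  proof -
    have "(\<Sum>a\<in>B. cyc_poly n (x \<circ> transp a b)) = (\<Sum>j\<in>{..<m}. cyc_poly n (x \<circ> transp ((x ^^ j) b) b))"
    proof -
      note im = orbit_eq_funpow_image[OF p, of b, folded B_def, folded m_def]
      show ?thesis by (subst im(1)) (simp add: sum.reindex[OF im(2)])
    qed
    \<comment> \<open>The index 0 is the case \<open>a = b\<close>, where the transposition is the
      identity and nothing is split.\<close>
    also have "{..<m} = insert 0 {1..<m}" using m by auto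
    also have "(\<Sum>j\<in>insert 0 {1..<m}. cyc_poly n (x \<circ> transp ((x ^^ j) b) b)) =
      cyc_poly n x + (\<Sum>j\<in>{1..<m}. cyc_poly n (x \<circ> transp ((x ^^ j) b) b))" by simp
    also have "(\<Sum>j\<in>{1..<m}. cyc_poly n (x \<circ> transp ((x ^^ j) b) b)) =
       (\<Sum>j\<in>{1..<m}. (1 - fps_X ^ j) * (1 - fps_X ^ (m - j)) * R)"
      by (rule sum.cong[OF refl]) (use cyc_poly_split[OF x b] in \<open>auto simp: m_def B_def R_def\<close>)
    finally show ?thesis unfolding D sum_distrib_right .
  qed
  have total: "(\<Sum>Q\<in>F. of_nat (card Q) * R) = (of_nat n - of_nat m) * R"
  proof -
    have "(\<Sum>Q\<in>orbit x ` {1..n}. card Q) = n"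
      using sum_over_orbits[OF x, of "\<lambda>_. 1::nat"] by simp
    moreover have "(\<Sum>Q\<in>orbit x ` {1..n}. card Q) = m + (\<Sum>Q\<in>F. card Q)"
      using Bin by (simp add: F_def m_def sum.remove)
    ultimately have "(of_nat n :: int fps) = of_nat m + (\<Sum>Q\<in>F. of_nat (card Q))"
      by (metis of_nat_add of_nat_sum)
    then show ?thesis by (simp add: sum_distrib_right[symmetric])
  qed
  \<comment> \<open>For one orbit of length \<open>c\<close> the two terms add up to
    \<open>c (1 - t^c) P Q\<close>, since the \<open>t^(c + m)\<close> cancel; this is
    \<open>c R\<close>, and the lengths of the orbits in \<open>F\<close> sum to
    \<open>n - m\<close>.\<close>
  have canc: "(1 - fps_X ^ m) * (\<Sum>Q\<in>F. - of_nat (card Q) * fps_X ^ card Q * P Q) +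
      (\<Sum>Q\<in>F. of_nat (card Q) * (1 - fps_X ^ (card Q + m)) * P Q) = (of_nat n - of_nat m) * R"
    unfolding total[symmetric] sum_distrib_left sum.distrib[symmetric]
    by (intro sum.cong refl) (simp add: RP algebra_simps power_add)
  have "(\<Sum>a\<in>{1..n}. cyc_poly n (x \<circ> transp a b)) =
     (\<Sum>a\<in>B. cyc_poly n (x \<circ> transp a b)) + (\<Sum>a\<in>{1..n} - B. cyc_poly n (x \<circ> transp a b))"
    using Bsub by (subst sum.subset_diff[of B]) (auto simp: add.commute)
  then have "fps_X * fps_deriv (cyc_poly n x) + (\<Sum>a\<in>{1..n}. cyc_poly n (x \<circ> transp a b)) =
     - of_nat m * fps_X ^ m * R + (of_nat n - of_nat m) * R + (1 - fps_X ^ m) * R +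
     (\<Sum>j\<in>{1..<m}. (1 - fps_X ^ j) * (1 - fps_X ^ (m - j))) * R"
    unfolding D' same others canc[symmetric] by (simp add: algebra_simps)
  then have "(1 - fps_X) * (fps_X * fps_deriv (cyc_poly n x) + (\<Sum>a\<in>{1..n}. cyc_poly n (x \<circ> transp a b))) =
     ((1 - fps_X) * (- of_nat m * fps_X ^ m + (of_nat n - of_nat m) + (1 - fps_X ^ m)) +
     (1 - fps_X) * (\<Sum>j\<in>{1..<m}. (1 - fps_X ^ j) * (1 - fps_X ^ (m - j)))) * R"
    by (simp only: distrib_left distrib_right mult.assoc)
  also have "\<dots> = (of_nat n * (1 - fps_X ^ Suc m) - of_nat (n + 2) * fps_X * (1 - fps_X ^ m)) * R"
    unfolding split_sum_fps[OF m] by (simp add: algebra_simps)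
  also have "\<dots> = of_nat n * cyc_poly (Suc n) (x \<circ> transp b (Suc n)) - of_nat (n + 2) * fps_X * cyc_poly n x"
    unfolding cyc_poly_insert[OF x b] D R_def m_def B_def by (simp add: algebra_simps)
  finally show ?thesis .
qed

section \<open>Averages over full cycles\<close>

lemma finite_cycle_class: "finite (cycle_class n i)"
  by (rule finite_subset[OF _ finite_permutations[of "{1..n}"]]) (auto simp: cycle_class_def)

lemma num_cycles_pos:
  assumes "n \<ge> 1"
  shows "num_cycles n x \<ge> 1"
  using assms by (auto simp: num_cycles_def Suc_le_eq card_gt_0_iff)

lemma num_cycles_le: "num_cycles n x \<le> n"
  unfolding num_cycles_def using card_image_le[of "{1..n}" "orbit x"] by simp

lemma permutes_Suc_decompose:
  assumes s: "s permutes {1..Suc n}" and ne: "s (Suc n) \<noteq> Suc n"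
  obtains y a where "y permutes {1..n}" "a \<in> {1..n}" "s = y \<circ> transp a (Suc n)"
proof -
  define a where "a = inv s (Suc n)"
  have sa: "s a = Suc n" using s by (simp add: a_def permutes_inverses)
  have "a \<in> {1..Suc n}" unfolding a_def using permutes_in_image[OF permutes_inv[OF s], of "Suc n"] by simp
  moreover have "a \<noteq> Suc n" using sa ne by metis
  ultimately have a: "a \<in> {1..n}" by (simp add: le_Suc_eq)
  define y where "y = s \<circ> transp a (Suc n)"
  have "y permutes {1..Suc n}" unfolding y_def using s a by (intro permutes_comp_transp) auto
  moreover have "y (Suc n) = Suc n" using sa by (simp add: y_def)
  ultimately have "y permutes {1..n}" by (rule permutes_Suc_fixed)
  moreover have "s = y \<circ> transp a (Suc n)" by (simp add: y_def comp_assoc)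
  ultimately show ?thesis using that a by blast
qed

lemma full_cycle_moves_last:
  assumes n: "n \<ge> 1" and s: "s permutes {1..Suc n}" and c: "num_cycles (Suc n) s = 1"
  shows "s (Suc n) \<noteq> Suc n"
proof
  assume "s (Suc n) = Suc n"
  with s have "s permutes {1..n}" by (rule permutes_Suc_fixed)
  from num_cycles_Suc_fixed[OF this] c have "num_cycles n s = 0" by simp
  then show False using num_cycles_pos[OF n, of s] by simp
qed

text \<open>Deleting \<open>Suc n\<close> from a full cycle leaves a full cycle of \<open>n\<close>
  points, and the preimage \<open>a\<close> of \<open>Suc n\<close> records where it has to be
  inserted again.\<close>

lemma bij_betw_full_cycles:
  assumes n: "n \<ge> 1"
  shows "bij_betw (\<lambda>(y, a). y \<circ> transp a (Suc n)) (cycle_class n 1 \<times> {1..n}) (cycle_class (Suc n) 1)"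
  unfolding bij_betw_def
proof
  let ?f = "\<lambda>(y :: nat \<Rightarrow> nat, a). y \<circ> transp a (Suc n)"
  show "inj_on ?f (cycle_class n 1 \<times> {1..n})"
  proof (rule inj_onI, clarify)
    fix y a z b assume y: "y \<in> cycle_class n 1" and z: "z \<in> cycle_class n 1"
      and a: "a \<in> {1..n}" and b: "b \<in> {1..n}" and eq: "y \<circ> transp a (Suc n) = z \<circ> transp b (Suc n)"
    have fy: "y (Suc n) = Suc n" and fz: "z (Suc n) = Suc n"
      using y z by (auto simp: cycle_class_def permutes_def)
    have zp: "z permutes {1..n}" using z by (simp add: cycle_class_def)
    have "(z \<circ> transp b (Suc n)) a = Suc n" using eq fy by (metis comp_apply transpose_apply_first)
    then have "z (transp b (Suc n) a) = z (Suc n)" using fz by simp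
    then have "transp b (Suc n) a = Suc n" using permutes_inj[OF zp] by (simp add: inj_eq)
    then have ab: "a = b" using a by (auto simp: Transposition.transpose_def split: if_splits)
    have "y = y \<circ> transp a (Suc n) \<circ> transp a (Suc n)" by (simp add: comp_assoc)
    also have "\<dots> = z" unfolding eq by (simp add: ab comp_assoc)
    finally show "y = z \<and> a = b" using ab by simp
  qed
  show "?f ` (cycle_class n 1 \<times> {1..n}) = cycle_class (Suc n) 1"
  proof
    show "?f ` (cycle_class n 1 \<times> {1..n}) \<subseteq> cycle_class (Suc n) 1"
    proof (clarify)
      fix y a assume y: "y \<in> cycle_class n 1" and a: "a \<in> {1..n}"
      then have y': "y permutes {1..n}" "num_cycles n y = 1" by (simp_all add: cycle_class_def)
      have "y \<circ> transp a (Suc n) permutes {1..Suc n}"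
        using permutes_interval_Suc[OF y'(1)] a by (intro permutes_comp_transp) auto
      then show "y \<circ> transp a (Suc n) \<in> cycle_class (Suc n) 1"
        using num_cycles_insert[OF y'(1) a] y'(2) by (simp add: cycle_class_def)
    qed
    show "cycle_class (Suc n) 1 \<subseteq> ?f ` (cycle_class n 1 \<times> {1..n})"
    proof
      fix s assume "s \<in> cycle_class (Suc n) 1"
      then have s: "s permutes {1..Suc n}" "num_cycles (Suc n) s = 1" by (simp_all add: cycle_class_def)
      obtain y a where ya: "y permutes {1..n}" "a \<in> {1..n}" "s = y \<circ> transp a (Suc n)"
        using permutes_Suc_decompose[OF s(1) full_cycle_moves_last[OF n s]] .
      then have "y \<in> cycle_class n 1"
        using s(2) num_cycles_insert[OF ya(1,2)] by (simp add: cycle_class_def)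
      then show "s \<in> ?f ` (cycle_class n 1 \<times> {1..n})" using ya by auto
    qed
  qed
qed

lemma cycle_class_1: "cycle_class 1 1 = {id}"
  by (auto simp: cycle_class_def num_cycles_def)

lemma card_full_cycles: "n \<ge> 1 \<Longrightarrow> card (cycle_class n 1) = fact (n - 1)"
proof (induction n rule: nat_induct_at_least)
  case base
  then show ?case by (simp only: cycle_class_1) simp
next
  case (Suc n)
  then show ?case
    using bij_betw_same_card[OF bij_betw_full_cycles[OF Suc.hyps]]
    by (cases n) (simp_all add: card_cartesian_product algebra_simps)
qed

text \<open>The average of \<open>k^\<ell>\<close> at \<open>x\<close> before division. The form
  involves \<open>inv s\<close>, but inversion permutes the full cycles.\<close>

definition cyc_sum :: "nat \<Rightarrow> nat \<Rightarrow> (nat \<Rightarrow> nat) \<Rightarrow> int" where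
  "cyc_sum n k x = (\<Sum>s\<in>cycle_class n 1. int k ^ num_cycles n (s \<circ> x))"

lemma cyc_sum_Suc:
  assumes "n \<ge> 1"
  shows "cyc_sum (Suc n) k x =
    (\<Sum>y\<in>cycle_class n 1. \<Sum>a\<in>{1..n}. int k ^ num_cycles (Suc n) (y \<circ> transp a (Suc n) \<circ> x))"
  unfolding cyc_sum_def sum.cartesian_product
  by (subst sum.reindex_bij_betw[OF bij_betw_full_cycles[OF assms], symmetric])
    (simp add: case_prod_unfold)

lemma transp_comp_permutes:
  assumes "x permutes {1..n}"
  shows "transp a (Suc n) \<circ> x = x \<circ> transp (inv x a) (Suc n)"
proof -
  have "inv x (Suc n) = Suc n" using permutes_inv[OF assms] by (auto simp: permutes_def)
  then show ?thesis using transpose_comp_eq[OF permutes_bij[OF assms], of a "Suc n"] by simp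
qed

text \<open>Moved past \<open>x\<close>, the transposition inserts \<open>Suc n\<close> into a cycle
  of \<open>y \<circ> x\<close>, which keeps the number of cycles; there are \<open>n\<close> places
  for it.\<close>

lemma cyc_sum_Suc_fixed:
  assumes n: "n \<ge> 1" and x: "x permutes {1..n}"
  shows "cyc_sum (Suc n) k x = int n * cyc_sum n k x"
proof -
  have "num_cycles (Suc n) (y \<circ> transp a (Suc n) \<circ> x) = num_cycles n (y \<circ> x)"
    if "y \<in> cycle_class n 1" "a \<in> {1..n}" for y a
  proof -
    have "y permutes {1..n}" using that by (simp add: cycle_class_def)
    then have yx: "y \<circ> x permutes {1..n}" using x by (rule permutes_compose[rotated])
    have "inv x a \<in> {1..n}" using permutes_inv[OF x] that(2) by (metis permutes_in_image)
    then show ?thesis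
      using num_cycles_insert[OF yx] by (simp add: comp_assoc transp_comp_permutes[OF x])
  qed
  then show ?thesis
    unfolding cyc_sum_Suc[OF n] by (simp add: cyc_sum_def sum_distrib_left)
qed

text \<open>After moving the transposition past \<open>x\<close> and reindexing, two transpositions
  involving \<open>Suc n\<close> meet. For \<open>a = b\<close> they cancel, \<open>Suc n\<close> is
  a fixed point, and its cycle gives the factor \<open>k\<close>. Otherwise their product is
  \<open>transp a b \<circ> transp a (Suc n)\<close>, and the right factor merely inserts
  \<open>Suc n\<close> after \<open>a\<close>.\<close>

lemma cyc_sum_Suc_moved:
  assumes n: "n \<ge> 1" and x: "x permutes {1..n}" and b: "b \<in> {1..n}"
  shows "cyc_sum (Suc n) k (x \<circ> transp b (Suc n)) =
    int k * cyc_sum n k x + (\<Sum>a\<in>{1..n} - {b}. cyc_sum n k (x \<circ> transp a b))"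
proof -
  have key: "(\<Sum>a\<in>{1..n}. int k ^ num_cycles (Suc n) (y \<circ> transp a (Suc n) \<circ> (x \<circ> transp b (Suc n)))) =
    int k * int k ^ num_cycles n (y \<circ> x) + (\<Sum>a\<in>{1..n} - {b}. int k ^ num_cycles n (y \<circ> (x \<circ> transp a b)))"
    if "y \<in> cycle_class n 1" for y
  proof -
    have "y permutes {1..n}" using that by (simp add: cycle_class_def)
    then have yx: "y \<circ> x permutes {1..n}" using x by (rule permutes_compose[rotated])
    have "y \<circ> transp a (Suc n) \<circ> (x \<circ> transp b (Suc n)) =
        y \<circ> x \<circ> (transp (inv x a) (Suc n) \<circ> transp b (Suc n))" for a
      using transp_comp_permutes[OF x, of a] by (metis comp_assoc)
    then have "(\<Sum>a\<in>{1..n}. int k ^ num_cycles (Suc n) (y \<circ> transp a (Suc n) \<circ> (x \<circ> transp b (Suc n)))) =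
       (\<Sum>a\<in>{1..n}. int k ^ num_cycles (Suc n) (y \<circ> x \<circ> (transp (inv x a) (Suc n) \<circ> transp b (Suc n))))"
      by simp
    also have "\<dots> = (\<Sum>a\<in>{1..n}. int k ^ num_cycles (Suc n) (y \<circ> x \<circ> (transp a (Suc n) \<circ> transp b (Suc n))))"
      by (rule sum.reindex_bij_betw[OF permutes_imp_bij[OF permutes_inv[OF x]]])
    also have "\<dots> = int k ^ num_cycles (Suc n) (y \<circ> x) +
       (\<Sum>a\<in>{1..n} - {b}. int k ^ num_cycles (Suc n) (y \<circ> x \<circ> (transp a (Suc n) \<circ> transp b (Suc n))))"
      using b by (simp add: sum.remove comp_assoc)
    also have "int k ^ num_cycles (Suc n) (y \<circ> x) = int k * int k ^ num_cycles n (y \<circ> x)"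
      using num_cycles_Suc_fixed[OF yx] by simp
    also have "(\<Sum>a\<in>{1..n} - {b}. int k ^ num_cycles (Suc n) (y \<circ> x \<circ> (transp a (Suc n) \<circ> transp b (Suc n)))) =
      (\<Sum>a\<in>{1..n} - {b}. int k ^ num_cycles n (y \<circ> (x \<circ> transp a b)))"
    proof (rule sum.cong[OF refl])
      fix a assume a: "a \<in> {1..n} - {b}"
      have "transp a (Suc n) \<circ> transp b (Suc n) = transp a b \<circ> transp a (Suc n)"
        using a b by (auto simp: fun_eq_iff Transposition.transpose_def)
      then have "y \<circ> x \<circ> (transp a (Suc n) \<circ> transp b (Suc n)) = (y \<circ> x \<circ> transp a b) \<circ> transp a (Suc n)"
        by (simp add: comp_assoc)
      moreover have "y \<circ> x \<circ> transp a b permutes {1..n}"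
        using yx a b by (intro permutes_comp_transp) auto
      from num_cycles_insert[OF this, of a] a
      have "num_cycles (Suc n) (y \<circ> x \<circ> transp a b \<circ> transp a (Suc n)) = num_cycles n (y \<circ> x \<circ> transp a b)"
        by blast
      ultimately show "int k ^ num_cycles (Suc n) (y \<circ> x \<circ> (transp a (Suc n) \<circ> transp b (Suc n))) =
         int k ^ num_cycles n (y \<circ> (x \<circ> transp a b))"
        by (simp only: comp_assoc)
    qed
    finally show ?thesis .
  qed
  have "cyc_sum (Suc n) k (x \<circ> transp b (Suc n)) =
    (\<Sum>y\<in>cycle_class n 1. int k * int k ^ num_cycles n (y \<circ> x) +
       (\<Sum>a\<in>{1..n} - {b}. int k ^ num_cycles n (y \<circ> (x \<circ> transp a b))))"
    unfolding cyc_sum_Suc[OF n] by (rule sum.cong[OF refl]) (rule key)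
  also have "\<dots> = int k * cyc_sum n k x + (\<Sum>a\<in>{1..n} - {b}. cyc_sum n k (x \<circ> transp a b))"
    unfolding cyc_sum_def sum.distrib sum_distrib_left by (subst sum.swap) simp
  finally show ?thesis .
qed

text \<open>If \<open>x\<close> moves the last point, the factor \<open>k\<close> in the recursion
  acts on the generating function as \<open>t d/dt\<close>; differentiating the induction hypothesis
  turns the claim into \<open>cyc_poly_key_identity\<close>. If \<open>x\<close> fixes it, both
  sides acquire the factor \<open>n (1 - t)\<close>. The exponent starts at 3 because the sum of
  \<open>k t^k\<close> is \<open>t / (1 - t)^2\<close> while \<Delta> is \<open>1 - t\<close> for
  one point.\<close>

lemma cyc_sum_generating_function:
  assumes "n \<ge> 1" "x permutes {1..n}"
  shows "(1 - fps_X) ^ (n + 2) * Abs_fps (\<lambda>k. cyc_sum n k x) = fact (n - 1) * fps_X * cyc_poly n x"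
  using assms
proof (induction n arbitrary: x rule: nat_induct_at_least)
  case base
  then have x: "x = id" by simp
  have c: "cyc_sum 1 k x = int k" for k
    unfolding cyc_sum_def cycle_class_1 x by (simp add: num_cycles_def)
  have o: "orbit (\<lambda>a. a) (Suc 0) = {Suc 0}" by (rule orbit_fixed) simp
  have "(1 - fps_X) ^ 2 * Abs_fps int = (fps_X :: int fps)"
  proof -
    have 1: "(1 - fps_X) * Abs_fps int = fps_X * Abs_fps (\<lambda>_. 1 :: int)"
      by (rule fps_ext) (auto simp: left_diff_distrib fps_X_mult_nth of_nat_diff)
    have 2: "(1 - fps_X) * Abs_fps (\<lambda>_. 1 :: int) = 1"
      by (rule fps_ext) (auto simp: left_diff_distrib fps_X_mult_nth)
    have "(1 - fps_X) ^ 2 * Abs_fps int = fps_X * ((1 - fps_X) * Abs_fps (\<lambda>_. 1 :: int))"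
      unfolding power2_eq_square mult.assoc 1 by (rule mult.left_commute)
    then show ?thesis unfolding 2 by simp
  qed
  then have "(1 - fps_X) ^ (1 + 2) * Abs_fps int = (1 - fps_X) * (fps_X :: int fps)"
    by (simp add: power_Suc mult.assoc numeral_eq_Suc)
  then show ?case unfolding c by (simp add: cyc_poly_def x o id_def mult.commute)
next
  case (Suc n)
  have step: "(1 - fps_X) ^ (n + 3) * Abs_fps (\<lambda>k. cyc_sum (Suc n) k (y \<circ> transp b (Suc n))) =
    fact n * fps_X * cyc_poly (Suc n) (y \<circ> transp b (Suc n))"
    if y: "y permutes {1..n}" and b: "b \<in> {1..n}" for y b
  proof -
    define G where "G z = Abs_fps (\<lambda>k. cyc_sum n k z)" for z
    define D where "D z = cyc_poly n z" for z
    define f where "f = (fact (n - 1) :: int fps)"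
    have IH: "(1 - fps_X) ^ (n + 2) * G z = f * fps_X * D z" if "z permutes {1..n}" for z
      using Suc.IH[OF that] by (simp add: G_def D_def f_def)
    have G: "Abs_fps (\<lambda>k. cyc_sum (Suc n) k (y \<circ> transp b (Suc n))) =
       fps_X * fps_deriv (G y) + (\<Sum>a\<in>{1..n} - {b}. G (y \<circ> transp a b))"
    proof (rule fps_ext)
      fix k
      show "fps_nth (Abs_fps (\<lambda>k. cyc_sum (Suc n) k (y \<circ> transp b (Suc n)))) k =
        fps_nth (fps_X * fps_deriv (G y) + (\<Sum>a\<in>{1..n} - {b}. G (y \<circ> transp a b))) k"
        by (cases k) (simp_all add: cyc_sum_Suc_moved[OF Suc.hyps y b] G_def fps_sum_nth fps_X_mult_nth)
    qed
    have df: "fps_deriv f = 0" unfolding f_def by (metis fps_deriv_of_nat of_nat_fact)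
    have "fps_deriv ((1 - fps_X) ^ (n + 2) * G y) = fps_deriv (f * fps_X * D y)"
      using IH[OF y] by simp
    moreover have "fps_deriv ((1 - fps_X) ^ (n + 2) * G y) =
       (1 - fps_X) ^ (n + 2) * fps_deriv (G y) - of_nat (n + 2) * (1 - fps_X) ^ (n + 1) * G y"
    proof -
      have "fps_deriv ((1 - fps_X) ^ (n + 2) :: int fps) = - of_nat (n + 2) * (1 - fps_X) ^ (n + 1)"
        by (subst fps_deriv_power) (simp only: fps_of_nat fps_deriv_sub fps_deriv_1 fps_deriv_fps_X; simp)
      then show ?thesis unfolding fps_deriv_mult
        by (simp only: minus_mult_left[symmetric] diff_conv_add_uminus)
    qed
    moreover have "fps_deriv (f * fps_X * D y) = f * (D y + fps_X * fps_deriv (D y))"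
      using df by (simp add: algebra_simps)
    ultimately have d: "(1 - fps_X) ^ (n + 2) * fps_deriv (G y) =
       of_nat (n + 2) * (1 - fps_X) ^ (n + 1) * G y + f * (D y + fps_X * fps_deriv (D y))"
      by (metis diff_eq_eq add.commute)
    \<comment> \<open>One more factor \<open>1 - t\<close> completes the power in front of
      \<open>G y\<close>, so the induction hypothesis removes \<open>G y\<close>.\<close>
    have d': "(1 - fps_X) ^ (n + 3) * fps_deriv (G y) =
       of_nat (n + 2) * (f * fps_X * D y) + (1 - fps_X) * (f * (D y + fps_X * fps_deriv (D y)))"
    proof -
      have "(1 - fps_X) ^ (n + 3) * fps_deriv (G y) = (1 - fps_X) * ((1 - fps_X) ^ (n + 2) * fps_deriv (G y))"
        by (simp add: numeral_eq_Suc mult.assoc)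
      also have "\<dots> = of_nat (n + 2) * ((1 - fps_X) ^ (n + 2) * G y) + (1 - fps_X) * (f * (D y + fps_X * fps_deriv (D y)))"
        unfolding d distrib_left by (simp add: mult_ac)
      finally show ?thesis unfolding IH[OF y] .
    qed
    have sm: "(1 - fps_X) ^ (n + 3) * (\<Sum>a\<in>{1..n} - {b}. G (y \<circ> transp a b)) =
       (1 - fps_X) * (f * fps_X * (\<Sum>a\<in>{1..n} - {b}. D (y \<circ> transp a b)))"
    proof -
      have "(1 - fps_X) ^ (n + 3) * G (y \<circ> transp a b) = (1 - fps_X) * (f * fps_X * D (y \<circ> transp a b))"
        if "a \<in> {1..n} - {b}" for a
      proof -
        have "y \<circ> transp a b permutes {1..n}" using y that b by (intro permutes_comp_transp) auto
        from IH[OF this] show ?thesis by (simp add: numeral_eq_Suc mult.assoc)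
      qed
      then show ?thesis by (simp add: sum_distrib_left)
    qed
    \<comment> \<open>The key identity with its term \<open>a = b\<close> set apart; that term is
      the summand \<open>D y\<close> produced by differentiating \<open>t D\<close>.\<close>
    have K: "(1 - fps_X) * (fps_X * fps_deriv (D y) + (D y + (\<Sum>a\<in>{1..n} - {b}. D (y \<circ> transp a b)))) =
       of_nat n * cyc_poly (Suc n) (y \<circ> transp b (Suc n)) - of_nat (n + 2) * fps_X * D y"
    proof -
      have "(\<Sum>a\<in>{1..n}. D (y \<circ> transp a b)) = D y + (\<Sum>a\<in>{1..n} - {b}. D (y \<circ> transp a b))"
        using b by (simp add: sum.remove)
      then show ?thesis using cyc_poly_key_identity[OF y b] by (simp add: D_def)
    qed
    have "(1 - fps_X) ^ (n + 3) * Abs_fps (\<lambda>k. cyc_sum (Suc n) k (y \<circ> transp b (Suc n))) =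
      fps_X * ((1 - fps_X) ^ (n + 3) * fps_deriv (G y)) +
      (1 - fps_X) ^ (n + 3) * (\<Sum>a\<in>{1..n} - {b}. G (y \<circ> transp a b))"
      unfolding G by (simp only: distrib_left mult_ac)
    also have "\<dots> = f * fps_X * (of_nat (n + 2) * fps_X * D y +
       (1 - fps_X) * (fps_X * fps_deriv (D y) + (D y + (\<Sum>a\<in>{1..n} - {b}. D (y \<circ> transp a b)))))"
      unfolding d' sm by (simp only: distrib_left mult_ac add_ac)
    also have "\<dots> = f * of_nat n * fps_X * cyc_poly (Suc n) (y \<circ> transp b (Suc n))"
      unfolding K by (simp add: mult_ac)
    also have "f * of_nat n = fact n"
      unfolding f_def by (subst mult.commute, rule fact_reduce[symmetric]) (use Suc.hyps in simp)
    finally show ?thesis .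
  qed
  show ?case
  proof (cases "x (Suc n) = Suc n")
    case True
    with Suc.prems have x: "x permutes {1..n}" by (rule permutes_Suc_fixed)
    have "Abs_fps (\<lambda>k. cyc_sum (Suc n) k x) = of_nat n * Abs_fps (\<lambda>k. cyc_sum n k x)"
      by (rule fps_ext) (simp add: cyc_sum_Suc_fixed[OF Suc.hyps x] fps_of_nat[symmetric])
    then have "(1 - fps_X) ^ (Suc n + 2) * Abs_fps (\<lambda>k. cyc_sum (Suc n) k x) =
      (1 - fps_X) * of_nat n * ((1 - fps_X) ^ (n + 2) * Abs_fps (\<lambda>k. cyc_sum n k x))"
      by (simp add: mult_ac)
    also have "\<dots> = of_nat n * fact (n - 1) * fps_X * ((1 - fps_X) * cyc_poly n x)"
      unfolding Suc.IH[OF x] by (simp add: mult_ac)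
    also have "of_nat n * fact (n - 1) = (fact n :: int fps)"
      by (rule fact_reduce[symmetric]) (use Suc.hyps in simp)
    finally show ?thesis unfolding cyc_poly_Suc_fixed[OF x] by simp
  next
    case False
    obtain y b where yb: "y permutes {1..n}" "b \<in> {1..n}" "x = y \<circ> transp b (Suc n)"
      using permutes_Suc_decompose[OF Suc.prems False] .
    have "Suc n + 2 = n + 3" by simp
    then show ?thesis unfolding yb(3) using step[OF yb(1,2)] by (simp only: diff_Suc_1)
  qed
qed

section \<open>Orthogonality of the averaged characters\<close>

text \<open>The coefficients of \<open>\<Delta>(x) / (1 - t)\<close>, that is, \<open>(-1)^i\<close> times the character of the hook shape
  \<open>(n - i, 1^i)\<close>.\<close>

definition signed_hook_char :: "nat \<Rightarrow> nat \<Rightarrow> (nat \<Rightarrow> nat) \<Rightarrow> int" where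
  "signed_hook_char n i x = (\<Sum>j\<le>i. fps_nth (cyc_poly n x) j)"

text \<open>Multiplication by \<open>1 - t\<close> takes differences of coefficients, so the
  induction step is Pascal's rule.\<close>

lemma one_minus_X_power_mult_binomial_series:
  "(1 - fps_X) ^ Suc n * Abs_fps (\<lambda>i. int ((n + i) choose n)) = 1"
proof (induction n)
  case 0
  show ?case by (rule fps_ext) (auto simp: left_diff_distrib fps_X_mult_nth)
next
  case (Suc n)
  have "(1 - fps_X) * Abs_fps (\<lambda>i. int ((Suc n + i) choose Suc n)) = Abs_fps (\<lambda>i. int ((n + i) choose n))"
  proof (rule fps_ext)
    fix i
    show "fps_nth ((1 - fps_X) * Abs_fps (\<lambda>i. int ((Suc n + i) choose Suc n))) i =
      fps_nth (Abs_fps (\<lambda>i. int ((n + i) choose n))) i"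
      by (cases i) (simp_all add: left_diff_distrib fps_X_mult_nth)
  qed
  note eq = this
  have "(1 - fps_X) ^ Suc (Suc n) * Abs_fps (\<lambda>i. int ((Suc n + i) choose Suc n)) =
    (1 - fps_X) ^ Suc n * ((1 - fps_X) * Abs_fps (\<lambda>i. int ((Suc n + i) choose Suc n)))"
    by (simp only: power_Suc mult_ac)
  then show ?case unfolding eq Suc.IH .
qed

text \<open>One of the \<open>n + 2\<close> factors \<open>1 - t\<close> turns \<Delta> into its
  partial sums, and the other \<open>n + 1\<close> expand into binomial coefficients. The extra
  factor \<open>t\<close> accounts for \<open>Suc k\<close>.\<close>

lemma cyc_sum_eq:
  assumes n: "n \<ge> 1" and x: "x permutes {1..n}"
  shows "cyc_sum n (Suc k) x = fact (n - 1) * (\<Sum>i\<le>k. int ((n + (k - i)) choose n) * signed_hook_char n i x)"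
proof -
  define H where "H = Abs_fps (\<lambda>i. signed_hook_char n i x)"
  define G where "G = Abs_fps (\<lambda>k. cyc_sum n k x)"
  define B where "B = Abs_fps (\<lambda>i. int ((n + i) choose n))"
  have H: "(1 - fps_X) * H = cyc_poly n x"
  proof (rule fps_ext)
    fix i
    show "fps_nth ((1 - fps_X) * H) i = fps_nth (cyc_poly n x) i"
      by (cases i) (simp_all add: H_def signed_hook_char_def left_diff_distrib fps_X_mult_nth)
  qed
  have "(1 - fps_X) * ((1 - fps_X) ^ Suc n * G) = (1 - fps_X) * (fact (n - 1) * fps_X * H)"
    using cyc_sum_generating_function[OF n x] by (simp add: G_def H[symmetric] mult_ac)
  moreover have "(1 - fps_X :: int fps) \<noteq> 0"
  proof
    assume "(1 - fps_X :: int fps) = 0"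
    then have "fps_nth (1 - fps_X :: int fps) 0 = 0" by simp
    then show False by simp
  qed
  ultimately have "(1 - fps_X) ^ Suc n * G = fact (n - 1) * fps_X * H" by simp
  then have "B * ((1 - fps_X) ^ Suc n * G) = B * (fact (n - 1) * fps_X * H)" by simp
  then have "((1 - fps_X) ^ Suc n * B) * G = fact (n - 1) * (fps_X * (H * B))" by (simp only: mult_ac)
  then have "G = of_nat (fact (n - 1)) * (fps_X * (H * B))"
    unfolding B_def one_minus_X_power_mult_binomial_series by simp
  then have "fps_nth G (Suc k) = fact (n - 1) * fps_nth (H * B) k"
    by (simp only: fps_of_nat[symmetric] fps_mult_left_const_nth fps_X_mult_nth) simp
  also have "fps_nth (H * B) k = (\<Sum>i\<le>k. int ((n + (k - i)) choose n) * signed_hook_char n i x)"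
    by (simp add: fps_mult_nth H_def B_def atLeast0AtMost mult.commute)
  finally show ?thesis by (simp add: G_def)
qed

text \<open>For invariant \<open>A\<close> this is \<open>(-1)^|A|\<close> times the sign of
  \<open>x\<close> restricted to \<open>A\<close>. Thus, up to \<open>(-1)^|A|\<close>, it is a
  diagonal entry of \<open>x\<close> on an exterior power of the permutation module.\<close>

definition invariant_sign :: "(nat \<Rightarrow> nat) \<Rightarrow> nat set \<Rightarrow> int" where
  "invariant_sign x A = (if x ` A = A then (-1) ^ card (orbit x ` A) else 0)"

lemma Union_orbits_invariant:
  assumes "permutation x" "x ` A = A"
  shows "\<Union> (orbit x ` A) = A"
  using orbit_subset_invariant[of x A] assms permutation_self_in_orbit by fastforce

text \<open>Expanding the product selects a set of orbits. Such a selection amounts to an invariant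
  set, namely the union, from which the orbits are recovered.\<close>

lemma cyc_poly_nth:
  assumes x: "x permutes {1..n}"
  shows "fps_nth (cyc_poly n x) j = (\<Sum>A | A \<subseteq> {1..n} \<and> card A = j. invariant_sign x A)"
proof -
  note p = permutes_interval_permutation[OF x]
  let ?O = "orbit x ` {1..n}"
  have fin: "finite ?O" by simp
  have "cyc_poly n x = (\<Prod>Q\<in>?O. - (fps_X ^ card Q) + 1)"
    by (simp add: cyc_poly_def)
  also have "\<dots> = (\<Sum>T\<in>Pow ?O. \<Prod>Q\<in>T. - (fps_X ^ card Q))"
    by (subst prod_add[OF fin]) simp
  also have "\<dots> = (\<Sum>T\<in>Pow ?O. (-1) ^ card T * fps_X ^ (\<Sum>Q\<in>T. card Q))"
    by (intro sum.cong refl) (simp add: prod_uminus power_sum)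
  finally have "fps_nth (cyc_poly n x) j = (\<Sum>T\<in>Pow ?O. fps_nth ((-1) ^ card T * fps_X ^ (\<Sum>Q\<in>T. card Q)) j)"
    by (simp add: fps_sum_nth)
  also have "\<dots> = (\<Sum>T\<in>Pow ?O. if (\<Sum>Q\<in>T. card Q) = j then (-1) ^ card T else 0)"
  proof (intro sum.cong refl)
    fix T :: "nat set set"
    have "(-1 :: int fps) ^ card T = fps_const ((-1) ^ card T)"
      by (cases "even (card T)") simp_all
    note eq = this
    show "fps_nth ((-1) ^ card T * fps_X ^ (\<Sum>Q\<in>T. card Q)) j =
       (if (\<Sum>Q\<in>T. card Q) = j then (-1) ^ card T else (0::int))"
      unfolding eq fps_mult_left_const_nth by (simp add: fps_X_power_nth)
  qed
  also have "\<dots> = (\<Sum>A\<in>{A. A \<subseteq> {1..n} \<and> x ` A = A}. if card A = j then (-1) ^ card (orbit x ` A) else 0)"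
  proof (rule sum.reindex_bij_witness[of _ "\<lambda>A. orbit x ` A" "\<lambda>T. \<Union> T"])
    fix T assume T: "T \<in> Pow ?O"
    have U: "\<Union> T \<subseteq> {1..n}" using T permutes_orbit_subset[OF x] by fastforce
    have step: "x ` Q \<subseteq> Q" if "Q \<in> T" for Q
      using that T by (auto intro: orbit.step)
    then have "x ` \<Union> T \<subseteq> \<Union> T" by blast
    moreover have "card (x ` \<Union> T) = card (\<Union> T)"
      using permutes_inj_on[OF x] by (rule card_image)
    ultimately have inv: "x ` \<Union> T = \<Union> T"
      using U by (intro card_subset_eq) (auto intro: finite_subset)
    show "\<Union> T \<in> {A. A \<subseteq> {1..n} \<and> x ` A = A}" using U inv by simp
    show oT: "orbit x ` \<Union> T = T"
    proof
      show "orbit x ` \<Union> T \<subseteq> T" using T orbit_eq_of_mem[OF p] by fastforce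
      show "T \<subseteq> orbit x ` \<Union> T"
      proof
        fix Q assume Q: "Q \<in> T"
        then obtain a where "Q = orbit x a" using T by blast
        then show "Q \<in> orbit x ` \<Union> T" using Q permutation_self_in_orbit[OF p, of a] by blast
      qed
    qed
    have "(\<Sum>Q\<in>T. card Q) = card (\<Union> T)"
    proof (rule card_Union_disjoint[symmetric])
      show "pairwise disjnt T"
        unfolding pairwise_def disjnt_def
      proof (intro ballI impI)
        fix P Q assume PQ: "P \<in> T" "Q \<in> T" "P \<noteq> Q"
        then obtain c d where "P = orbit x c" "Q = orbit x d" using T by blast
        then show "P \<inter> Q = {}" using PQ orbit_eq_of_mem[OF p, of _ c] orbit_eq_of_mem[OF p, of _ d] by blast
      qed
      show "finite Q" if "Q \<in> T" for Q
        using that T finite_orbit_permutation[OF p] by blast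
    qed
    then show "(if card (\<Union> T) = j then (-1) ^ card (orbit x ` \<Union> T) else 0) =
      (if (\<Sum>Q\<in>T. card Q) = j then (-1) ^ card T else (0::int))"
      unfolding oT by simp
  next
    fix A assume "A \<in> {A. A \<subseteq> {1..n} \<and> x ` A = A}"
    then show "\<Union> (orbit x ` A) = A" "orbit x ` A \<in> Pow ?O"
      using Union_orbits_invariant[OF p] by auto
  qed
  also have "\<dots> = (\<Sum>A | A \<subseteq> {1..n} \<and> card A = j. invariant_sign x A)"
    unfolding invariant_sign_def
    by (rule sum.mono_neutral_cong) auto
  finally show ?thesis .
qed

lemma transp_image_eq: "(a \<in> A \<longleftrightarrow> b \<in> A) \<Longrightarrow> transp a b ` A = A"
  by (cases "a \<in> A") (auto simp: Transposition.transpose_def image_iff)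

lemma invariant_sign_flip:
  assumes x: "permutation x" and A: "finite A" "u \<in> A" "v \<in> A" "u \<noteq> v"
  shows "invariant_sign (x \<circ> transp u v) A = - invariant_sign x A"
proof -
  have im: "(x \<circ> transp u v) ` A = x ` A"
    unfolding image_comp[symmetric] using transp_image_eq[of u A v] A by simp
  show ?thesis
    unfolding invariant_sign_def im
    using parity_orbits_comp_transpose[OF x _ A(2,3,1,4)] by simp
qed

lemma invariant_sign_same:
  assumes x: "permutation x" and A: "u \<notin> A" "v \<notin> A"
  shows "invariant_sign (x \<circ> transp u v) A = invariant_sign x A"
proof -
  have im: "(x \<circ> transp u v) ` A = x ` A"
    unfolding image_comp[symmetric] using transp_image_eq[of u A v] A by simp
  have "orbit (x \<circ> transp u v) ` A = orbit x ` A" if "x ` A = A"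
  proof (rule image_cong[OF refl])
    fix c assume c: "c \<in> A"
    show "orbit (x \<circ> transp u v) c = orbit x c"
    proof (rule orbit_cong[OF permutation_self_in_orbit[OF x]])
      fix s assume "s \<in> orbit x c"
      then have "s \<in> A" using orbit_subset_invariant[of x A c] that c by blast
      then have "s \<noteq> u" "s \<noteq> v" using A by auto
      then show "(x \<circ> transp u v) s = x s" by simp
    qed
  qed
  then show ?thesis unfolding invariant_sign_def im by simp
qed

lemma invariant_sign_mult_vanish:
  assumes A: "A \<subseteq> {1..n}" and uv: "u \<in> A - B" "v \<in> A - B" "u \<noteq> v"
  shows "(\<Sum>x | x permutes {1..n}. invariant_sign x A * invariant_sign x B) = 0"
proof -
  have t: "transp u v permutes {1..n}" using A uv by (intro permutes_swap_id) auto
  have "(\<Sum>x | x permutes {1..n}. invariant_sign x A * invariant_sign x B) =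
    (\<Sum>x | x permutes {1..n}. invariant_sign (x \<circ> transp u v) A * invariant_sign (x \<circ> transp u v) B)"
    by (rule sum_permutations_compose_right[OF t])
  also have "\<dots> = (\<Sum>x | x permutes {1..n}. - (invariant_sign x A * invariant_sign x B))"
  proof (rule sum.cong[OF refl], clarify)
    fix x assume "x permutes {1..n}"
    note p = permutes_interval_permutation[OF this]
    have "finite A" using A finite_subset by blast
    then show "invariant_sign (x \<circ> transp u v) A * invariant_sign (x \<circ> transp u v) B =
       - (invariant_sign x A * invariant_sign x B)"
      using invariant_sign_flip[OF p, of A u v] invariant_sign_same[OF p, of u B v] uv by simp
  qed
  finally show ?thesis by (simp add: sum_negf)
qed

lemma invariant_sign_insert:
  assumes x: "permutation x" and C: "finite C" "u \<notin> C" and fx: "x u = u"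
  shows "invariant_sign x (insert u C) = - invariant_sign x C"
proof -
  have inj: "inj x" using permutation_bijective[OF x] by (rule bij_is_inj)
  have "x ` insert u C = insert u C \<longleftrightarrow> x ` C = C"
  proof
    assume *: "x ` insert u C = insert u C"
    have "u \<notin> x ` C" using C fx inj by (metis inj_image_mem_iff)
    then show "x ` C = C" using * C fx by auto
  qed (use fx in auto)
  moreover have "card (orbit x ` insert u C) = Suc (card (orbit x ` C))" if "x ` C = C"
  proof -
    have "{u} \<notin> orbit x ` C"
    proof
      assume "{u} \<in> orbit x ` C"
      then obtain c where "c \<in> C" "{u} = orbit x c" by blast
      then show False using orbit_subset_invariant[of x C c] that C by auto
    qed
    then show ?thesis using C orbit_fixed[of x u, OF fx] by simp
  qed
  ultimately show ?thesis by (simp add: invariant_sign_def)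
qed

text \<open>The restrictions to \<open>A\<close> and to \<open>S - A\<close> can be chosen
  independently, and \<open>perm_restrict\<close> recovers both factors.\<close>

lemma card_permutes_stabilizing:
  assumes S: "finite S" and A: "A \<subseteq> S"
  shows "card {x. x permutes S \<and> x ` A = A} = fact (card A) * fact (card S - card A)"
proof -
  have fA: "finite A" using assms finite_subset by blast
  have "bij_betw (\<lambda>(p, q). p \<circ> q) ({p. p permutes A} \<times> {q. q permutes S - A}) {x. x permutes S \<and> x ` A = A}"
  proof (rule bij_betw_byWitness[where f' = "\<lambda>x. (perm_restrict x A, perm_restrict x (S - A))"])
    have val: "(p \<circ> q) a = (if a \<in> A then p a else q a)" if "p permutes A" "q permutes S - A" for p q a
    proof (cases "a \<in> A")
      case True
      then have "q a = a" using that(2) by (auto simp: permutes_def)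
      then show ?thesis using True by simp
    next
      case False
      have "q a \<notin> A"
      proof (cases "a \<in> S")
        case True
        then have "q a \<in> S - A" using that(2) False by (metis DiffI permutes_in_image)
        then show ?thesis by simp
      next
        case nS: False
        then have "q a = a" using that(2) by (auto simp: permutes_def)
        then show ?thesis using False by simp
      qed
      then show ?thesis using that(1) False by (auto simp: permutes_def)
    qed
    show "\<forall>pq\<in>{p. p permutes A} \<times> {q. q permutes S - A}.
      (\<lambda>x. (perm_restrict x A, perm_restrict x (S - A))) (case pq of (p, q) \<Rightarrow> p \<circ> q) = pq"
    proof clarify
      fix p q assume pq: "p permutes A" "q permutes S - A"
      have "perm_restrict (p \<circ> q) A = p"
        using pq(1) by (auto simp: fun_eq_iff perm_restrict_def val[OF pq, unfolded comp_def] permutes_def)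
      moreover have "perm_restrict (p \<circ> q) (S - A) = q"
        using pq(2) by (auto simp: fun_eq_iff perm_restrict_def val[OF pq, unfolded comp_def] permutes_def)
      ultimately show "perm_restrict (p \<circ> q) A = p \<and> perm_restrict (p \<circ> q) (S - A) = q" by simp
    qed
    have restr: "perm_restrict x A permutes A" "perm_restrict x (S - A) permutes S - A"
      if "x permutes S" "x ` A = A" for x
    proof -
      have "x ` (S - A) = S - A"
        using that permutes_image[OF that(1)] permutes_inj[OF that(1)] by (simp add: image_set_diff)
      then have "bij_betw x A A" "bij_betw x (S - A) (S - A)"
        using that permutes_inj_on[OF that(1)] by (auto simp: bij_betw_def)
      moreover have "bij_betw (perm_restrict x T) T T" if "bij_betw x T T" for T
        using that bij_betw_cong[of T "perm_restrict x T" x T] by (simp add: perm_restrict_def)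
      ultimately have "bij_betw (perm_restrict x A) A A" "bij_betw (perm_restrict x (S - A)) (S - A) (S - A)"
        by blast+
      then show "perm_restrict x A permutes A" "perm_restrict x (S - A) permutes S - A"
        by (auto intro!: bij_imp_permutes simp: perm_restrict_def split: if_splits)
    qed
    show "\<forall>x\<in>{x. x permutes S \<and> x ` A = A}.
      (case (perm_restrict x A, perm_restrict x (S - A)) of (p, q) \<Rightarrow> p \<circ> q) = x"
    proof clarify
      fix x assume x: "x permutes S" "x ` A = A"
      show "perm_restrict x A \<circ> perm_restrict x (S - A) = x"
      proof
        fix a
        have "x a = a" if "a \<notin> S" using that x(1) by (auto simp: permutes_def)
        then show "(perm_restrict x A \<circ> perm_restrict x (S - A)) a = x a"
          using val[OF restr[OF x], of a] A by (auto simp: perm_restrict_def)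
      qed
    qed
    show "(\<lambda>(p, q). p \<circ> q) ` ({p. p permutes A} \<times> {q. q permutes S - A}) \<subseteq> {x. x permutes S \<and> x ` A = A}"
    proof clarify
      fix p q assume pq: "p permutes A" "q permutes S - A"
      have "p permutes S" "q permutes S" using pq A by (auto intro: permutes_subset)
      moreover have "(p \<circ> q) ` A = p ` A"
        by (rule image_cong) (auto simp: val[OF pq, unfolded comp_def])
      ultimately show "p \<circ> q permutes S \<and> (p \<circ> q) ` A = A"
        using permutes_image[OF pq(1)] by (auto intro: permutes_compose)
    qed
    show "(\<lambda>x. (perm_restrict x A, perm_restrict x (S - A))) ` {x. x permutes S \<and> x ` A = A}
      \<subseteq> {p. p permutes A} \<times> {q. q permutes S - A}"
      using restr by auto
  qed
  then have "card {x. x permutes S \<and> x ` A = A} = card ({p. p permutes A} \<times> {q. q permutes S - A})"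
    by (rule bij_betw_same_card[symmetric])
  then show ?thesis
    using assms fA by (simp add: card_cartesian_product card_permutations[OF refl] card_Diff_subset)
qed

text \<open>Two points of \<open>A - B\<close> can be interchanged, which flips one sign only. So only sets differing
  by at most one exchange contribute, and the pairing of coefficients is tridiagonal.\<close>

definition sign_pairing :: "nat \<Rightarrow> nat set \<Rightarrow> nat set \<Rightarrow> int" where
  "sign_pairing n A B = (\<Sum>x | x permutes {1..n}. invariant_sign x A * invariant_sign x B)"

lemma sign_pairing_commute: "sign_pairing n A B = sign_pairing n B A"
  by (simp add: sign_pairing_def mult.commute)

lemma invariant_sign_mult_self:
  "invariant_sign x A * invariant_sign x A = (if x ` A = A then 1 else 0)"
  by (simp add: invariant_sign_def flip: power_mult_distrib)

lemma sum_indicator_permutes: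
  "(\<Sum>x | x permutes {1..n::nat}. if P x then 1 else (0::int)) = int (card {x. x permutes {1..n} \<and> P x})"
proof -
  have "{x. x permutes {1..n} \<and> P x} = {x. x permutes {1..n}} \<inter> {x. P x}" by auto
  then show ?thesis
    using sum.If_cases[OF finite_perms[of n], of P "\<lambda>_. 1::int" "\<lambda>_. 0"] by simp
qed

lemma sign_pairing_self:
  assumes "A \<subseteq> {1..n}"
  shows "sign_pairing n A A = fact (card A) * fact (n - card A)"
  unfolding sign_pairing_def invariant_sign_mult_self sum_indicator_permutes
  using card_permutes_stabilizing[OF _ assms] by simp

lemma permutes_fixing_iff: "x permutes S - {u} \<longleftrightarrow> x permutes S \<and> x u = u" if "u \<in> S"
  using that by (auto intro: permutes_superset permutes_subset simp: permutes_def)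

text \<open>If both sets are invariant, then \<open>u\<close> is fixed, and as an additional orbit
  it makes the signs opposite. What remains is to count the permutations of the other points that
  stabilize \<open>C\<close>.\<close>

lemma sign_pairing_insert:
  assumes C: "insert u C \<subseteq> {1..n}" "u \<notin> C"
  shows "sign_pairing n C (insert u C) = - (fact (card C) * fact (n - 1 - card C))"
proof -
  have fC: "finite C" by (rule finite_subset[of _ "{1..n}"]) (use C in auto)
  have "invariant_sign x C * invariant_sign x (insert u C) = - (if x u = u \<and> x ` C = C then 1 else 0)"
    if "x permutes {1..n}" for x
  proof (cases "x u = u")
    case True
    then show ?thesis
      using invariant_sign_insert[OF permutes_interval_permutation[OF that] fC C(2) True] invariant_sign_mult_self[of x C]
      by (auto split: if_splits)
  next
    case False
    have "x u = u" if "x ` C = C" "x ` insert u C = insert u C"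
    proof -
      have "u \<in> x ` insert u C" unfolding that(2) by simp
      moreover have "u \<notin> x ` C" unfolding that(1) using C(2) .
      ultimately show ?thesis by auto
    qed
    then show ?thesis using False by (auto simp: invariant_sign_def)
  qed
  then have "sign_pairing n C (insert u C) = - (\<Sum>x | x permutes {1..n}. if x u = u \<and> x ` C = C then 1 else 0)"
    unfolding sign_pairing_def sum_negf[symmetric] by (intro sum.cong) auto
  also have "\<dots> = - int (card {x. x permutes {1..n} \<and> x u = u \<and> x ` C = C})"
    unfolding sum_indicator_permutes ..
  also have "{x. x permutes {1..n} \<and> x u = u \<and> x ` C = C} = {x. x permutes {1..n} - {u} \<and> x ` C = C}"
    using C by (auto simp: permutes_fixing_iff)
  also have "card \<dots> = fact (card C) * fact (card ({1..n} - {u}) - card C)"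
    using C by (intro card_permutes_stabilizing) auto
  finally show ?thesis using C by simp
qed

text \<open>Invariance of both sets passes to their intersection \<open>C\<close> and so forces
  \<open>u\<close> and \<open>v\<close> to be fixed. Each then contributes one orbit, so the two
  signs agree.\<close>

lemma sign_pairing_exchange:
  assumes C: "insert u (insert v C) \<subseteq> {1..n}" "u \<notin> C" "v \<notin> C" "u \<noteq> v"
  shows "sign_pairing n (insert u C) (insert v C) = fact (card C) * fact (n - 2 - card C)"
proof -
  have fC: "finite C" by (rule finite_subset[of _ "{1..n}"]) (use C in auto)
  have "invariant_sign x (insert u C) * invariant_sign x (insert v C) = (if x u = u \<and> x v = v \<and> x ` C = C then 1 else 0)"
    if "x permutes {1..n}" for x
  proof (cases "x u = u \<and> x v = v")
    case True
    then show ?thesis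
      using invariant_sign_insert[OF permutes_interval_permutation[OF that] fC] C invariant_sign_mult_self[of x C]
      by simp
  next
    case False
    have "x u = u \<and> x v = v" if "x ` insert u C = insert u C" "x ` insert v C = insert v C"
    proof -
      have "inj x" using permutes_inj[OF \<open>x permutes _\<close>] .
      then have "x ` (insert u C \<inter> insert v C) = insert u C \<inter> insert v C"
        using that by (simp add: image_Int)
      moreover have "insert u C \<inter> insert v C = C" using C by auto
      ultimately have xC: "x ` C = C" by simp
      have "u \<in> x ` insert u C" "v \<in> x ` insert v C" unfolding that by simp_all
      moreover have "u \<notin> x ` C" "v \<notin> x ` C" unfolding xC using C by auto
      ultimately show ?thesis by auto
    qed
    then show ?thesis using False by (auto simp: invariant_sign_def)
  qed
  then have "sign_pairing n (insert u C) (insert v C) = (\<Sum>x | x permutes {1..n}. if x u = u \<and> x v = v \<and> x ` C = C then 1 else 0)"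
    unfolding sign_pairing_def by (intro sum.cong) auto
  also have "\<dots> = int (card {x. x permutes {1..n} \<and> x u = u \<and> x v = v \<and> x ` C = C})"
    unfolding sum_indicator_permutes ..
  also have "{x. x permutes {1..n} \<and> x u = u \<and> x v = v \<and> x ` C = C} = {x. x permutes {1..n} - {u} - {v} \<and> x ` C = C}"
    using C by (auto simp: permutes_fixing_iff)
  also have "card \<dots> = fact (card C) * fact (card ({1..n} - {u} - {v}) - card C)"
    using C by (intro card_permutes_stabilizing) auto
  also have "card ({1..n} - {u} - {v}) = n - 2" using C by (simp add: numeral_2_eq_2)
  finally show ?thesis by simp
qed

lemma sign_pairing_vanish:
  assumes "A \<subseteq> {1..n}" "card (A - B) \<ge> 2"
  shows "sign_pairing n A B = 0"
proof -
  obtain T where "T \<subseteq> A - B" "card T = 2"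
    using obtain_subset_with_card_n[OF assms(2)] by metis
  then obtain u v where "u \<in> A - B" "v \<in> A - B" "u \<noteq> v"
    unfolding card_2_iff by blast
  then show ?thesis unfolding sign_pairing_def using invariant_sign_mult_vanish[OF assms(1)] by blast
qed

section \<open>The tridiagonal matrix of pairings of the coefficients of \<Delta>\<close>

definition coeff_pairing :: "nat \<Rightarrow> nat \<Rightarrow> nat \<Rightarrow> int" where
  "coeff_pairing n i j = (\<Sum>x | x permutes {1..n}. fps_nth (cyc_poly n x) i * fps_nth (cyc_poly n x) j)"

lemma coeff_pairing_commute: "coeff_pairing n i j = coeff_pairing n j i"
  by (simp add: coeff_pairing_def mult.commute)

lemma coeff_pairing_eq:
  "coeff_pairing n i j =
    (\<Sum>A | A \<subseteq> {1..n} \<and> card A = i. \<Sum>B | B \<subseteq> {1..n} \<and> card B = j. sign_pairing n A B)"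
proof -
  have "coeff_pairing n i j = (\<Sum>x | x permutes {1..n}.
     \<Sum>A | A \<subseteq> {1..n} \<and> card A = i. \<Sum>B | B \<subseteq> {1..n} \<and> card B = j. invariant_sign x A * invariant_sign x B)"
    unfolding coeff_pairing_def by (intro sum.cong) (simp_all add: cyc_poly_nth sum_product)
  also have "\<dots> = (\<Sum>A | A \<subseteq> {1..n} \<and> card A = i. \<Sum>B | B \<subseteq> {1..n} \<and> card B = j. sign_pairing n A B)"
    unfolding sign_pairing_def by (subst sum.swap, intro sum.cong refl, rule sum.swap)
  finally show ?thesis .
qed

lemma card_subsets_mult_fact:
  assumes "i \<le> n"
  shows "(\<Sum>A | A \<subseteq> {1..n} \<and> card A = i. fact i * fact (n - i)) = (fact n :: int)"
proof -
  have "(\<Sum>A | A \<subseteq> {1..n} \<and> card A = i. fact i * fact (n - i)) = int ((n choose i) * (fact i * fact (n - i)))"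
    using n_subsets[of "{1..n}" i] by simp
  also have "(n choose i) * (fact i * fact (n - i)) = fact n"
    using binomial_fact_lemma[OF assms] by (simp add: mult_ac)
  finally show ?thesis by simp
qed

lemma coeff_pairing_far:
  assumes "i + 2 \<le> j"
  shows "coeff_pairing n i j = 0"
  unfolding coeff_pairing_eq
proof (intro sum.neutral ballI)
  fix A B assume "A \<in> {A. A \<subseteq> {1..n} \<and> card A = i}" "B \<in> {B. B \<subseteq> {1..n} \<and> card B = j}"
  then have AB: "A \<subseteq> {1..n}" "card A = i" "B \<subseteq> {1..n}" "card B = j" by auto
  have "card B - card A \<le> card (B - A)" using AB finite_subset by (intro diff_card_le_card_Diff) auto
  then have "card (B - A) \<ge> 2" using AB assms by simp
  then have "sign_pairing n B A = 0" using AB by (intro sign_pairing_vanish)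
  then show "sign_pairing n A B = 0" by (simp add: sign_pairing_commute)
qed

text \<open>Only sets \<open>B\<close> containing \<open>A\<close> contribute, since otherwise
  \<open>B - A\<close> has two points. The \<open>n - i\<close> choices of the new point combine
  with \<open>fact (n - 1 - i)\<close> to \<open>fact (n - i)\<close>.\<close>

lemma coeff_pairing_Suc:
  assumes "Suc i \<le> n"
  shows "coeff_pairing n i (Suc i) = - fact n"
proof -
  have inner: "(\<Sum>B | B \<subseteq> {1..n} \<and> card B = Suc i. sign_pairing n A B) = - (fact i * fact (n - i))"
    if A: "A \<subseteq> {1..n}" "card A = i" for A
  proof -
    have fA: "finite A" using A finite_subset by blast
    have "(\<Sum>B | B \<subseteq> {1..n} \<and> card B = Suc i. sign_pairing n A B) =
       (\<Sum>B\<in>(\<lambda>u. insert u A) ` ({1..n} - A). sign_pairing n A B)"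
    proof (rule sum.mono_neutral_right)
      show "(\<lambda>u. insert u A) ` ({1..n} - A) \<subseteq> {B. B \<subseteq> {1..n} \<and> card B = Suc i}"
        using A fA by auto
      show "\<forall>B\<in>{B. B \<subseteq> {1..n} \<and> card B = Suc i} - (\<lambda>u. insert u A) ` ({1..n} - A). sign_pairing n A B = 0"
      proof
        fix B assume B: "B \<in> {B. B \<subseteq> {1..n} \<and> card B = Suc i} - (\<lambda>u. insert u A) ` ({1..n} - A)"
        then have fB: "finite B" using finite_subset by blast
        have "card (B - A) \<ge> 2"
        proof (rule ccontr)
          assume "\<not> card (B - A) \<ge> 2"
          moreover have "card B - card A \<le> card (B - A)" using fA by (intro diff_card_le_card_Diff)
          ultimately have c1: "card (B - A) = 1" using A B by auto
          then obtain u where u: "B - A = {u}" by (auto simp: card_1_singleton_iff)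
          have "card B = card (B - A) + card (B \<inter> A)"
            using fB by (metis card_Diff_subset_Int card_Int_Diff add.commute finite_Int)
          then have "card (B \<inter> A) = card A" using A B c1 by auto
          then have "B \<inter> A = A" using fA by (intro card_subset_eq) auto
          then have "B = insert u A" "u \<in> {1..n} - A" using u B by auto
          then show False using B by blast
        qed
        then have "sign_pairing n B A = 0" using B by (intro sign_pairing_vanish) auto
        then show "sign_pairing n A B = 0" by (simp add: sign_pairing_commute)
      qed
    qed simp
    also have "\<dots> = (\<Sum>u\<in>{1..n} - A. sign_pairing n A (insert u A))"
      by (rule sum.reindex_cong[OF _ refl refl]) (auto intro!: inj_onI)
    also have "\<dots> = (\<Sum>u\<in>{1..n} - A. - (fact i * fact (n - 1 - i)))"
      by (intro sum.cong refl) (use A in \<open>auto simp: sign_pairing_insert\<close>)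
    also have "\<dots> = - (int (n - i) * (fact i * fact (n - 1 - i)))"
      using A fA by (simp add: card_Diff_subset)
    also have "\<dots> = - (fact i * (int (n - i) * fact (n - i - 1)))" by (simp add: mult_ac)
    also have "int (n - i) * fact (n - i - 1) = fact (n - i)"
      by (rule fact_reduce[symmetric]) (use assms in simp)
    finally show ?thesis .
  qed
  have "coeff_pairing n i (Suc i) = - (\<Sum>A | A \<subseteq> {1..n} \<and> card A = i. fact i * fact (n - i))"
    unfolding coeff_pairing_eq sum_negf[symmetric] by (intro sum.cong refl) (use inner in auto)
  then show ?thesis using card_subsets_mult_fact[of i n] assms by simp
qed

text \<open>The set \<open>A\<close> itself gives \<open>fact i * fact (n - i)\<close>. The
  \<open>i (n - i)\<close> exchanges of one point give the same amount once more, except that no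
  exchange exists for \<open>i = 0\<close> and \<open>i = n\<close>; hence the factor 2 or
  1.\<close>

lemma coeff_pairing_same:
  assumes "i \<le> n"
  shows "coeff_pairing n i i = (if 1 \<le> i \<and> i < n then 2 else 1) * fact n"
proof -
  have inner: "(\<Sum>B | B \<subseteq> {1..n} \<and> card B = i. sign_pairing n A B) =
     (if 1 \<le> i \<and> i < n then 2 else 1) * (fact i * fact (n - i))"
    if A: "A \<subseteq> {1..n}" "card A = i" for A
  proof -
    have fA: "finite A" using A finite_subset by blast
    let ?g = "\<lambda>(u, v). insert v (A - {u})"
    have gcard: "card (insert v (A - {u})) = i" if "u \<in> A" "v \<in> {1..n} - A" for u v
    proof -
      have "card (insert v (A - {u})) = Suc (card (A - {u}))" using that fA by simp
      also have "\<dots> = card A" using that fA by (rule_tac card.remove[symmetric])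
      finally show ?thesis using A by simp
    qed
    have "(\<Sum>B | B \<subseteq> {1..n} \<and> card B = i. sign_pairing n A B) =
       (\<Sum>B\<in>insert A (?g ` (A \<times> ({1..n} - A))). sign_pairing n A B)"
    proof (rule sum.mono_neutral_right)
      show "insert A (?g ` (A \<times> ({1..n} - A))) \<subseteq> {B. B \<subseteq> {1..n} \<and> card B = i}"
        using A gcard by auto
      show "\<forall>B\<in>{B. B \<subseteq> {1..n} \<and> card B = i} - insert A (?g ` (A \<times> ({1..n} - A))). sign_pairing n A B = 0"
      proof
        fix B assume B: "B \<in> {B. B \<subseteq> {1..n} \<and> card B = i} - insert A (?g ` (A \<times> ({1..n} - A)))"
        then have fB: "finite B" using finite_subset by blast
        have "card (A - B) \<ge> 2"
        proof (rule ccontr)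
          assume small: "\<not> card (A - B) \<ge> 2"
          have cA: "card A = card (A - B) + card (A \<inter> B)"
            using fA by (metis card_Int_Diff add.commute)
          have cB: "card B = card (B - A) + card (A \<inter> B)"
            using fB by (metis card_Int_Diff add.commute inf_commute)
          have eq: "card (A - B) = card (B - A)" using cA cB A B by auto
          show False
          proof (cases "card (A - B) = 0")
            case True
            then have "A - B = {}" "B - A = {}" using eq fA fB by (metis card_0_eq finite_Diff)+
            then have "A = B" by blast
            then show False using B by blast
          next
            case False
            then have "card (A - B) = 1" "card (B - A) = 1" using small eq by auto
            then obtain u v where "A - B = {u}" "B - A = {v}" by (auto simp: card_1_singleton_iff)
            then have "B = insert v (A - {u})" "u \<in> A" "v \<in> {1..n} - A" using B by blast+
            then have "B \<in> ?g ` (A \<times> ({1..n} - A))" by (auto intro!: image_eqI[of _ _ "(u, v)"])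
            then show False using B by blast
          qed
        qed
        then show "sign_pairing n A B = 0" using A by (intro sign_pairing_vanish)
      qed
    qed simp
    also have "\<dots> = sign_pairing n A A + (\<Sum>B\<in>?g ` (A \<times> ({1..n} - A)). sign_pairing n A B)"
      by (rule sum.insert) (use fA in auto)
    also have "(\<Sum>B\<in>?g ` (A \<times> ({1..n} - A)). sign_pairing n A B) =
       (\<Sum>(u, v)\<in>A \<times> ({1..n} - A). sign_pairing n A (insert v (A - {u})))"
    proof (subst sum.reindex)
      show "inj_on ?g (A \<times> ({1..n} - A))"
      proof (rule inj_onI, clarsimp)
        fix u v u' v' assume "u \<in> A" "u' \<in> A" "v \<notin> A" "v' \<notin> A"
          "insert v (A - {u}) = insert v' (A - {u'})"
        then show "u = u' \<and> v = v'" by (metis Diff_iff insert_iff singletonD singletonI)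
      qed
    qed (simp add: case_prod_unfold)
    also have "\<dots> = (\<Sum>(u, v)\<in>A \<times> ({1..n} - A). fact (i - 1) * fact (n - i - 1))"
    proof (rule sum.cong[OF refl], clarify)
      fix u v assume uv: "u \<in> A" "v \<in> {1..n}" "v \<notin> A"
      have i: "card (A - {u}) = i - 1" using uv A by simp
      have "0 < i" using uv A fA by (auto simp: card_gt_0_iff)
      have "sign_pairing n (insert u (A - {u})) (insert v (A - {u})) =
         fact (card (A - {u})) * fact (n - 2 - card (A - {u}))"
        using uv A by (intro sign_pairing_exchange) auto
      then show "sign_pairing n A (insert v (A - {u})) = fact (i - 1) * fact (n - i - 1)"
        unfolding i using uv \<open>0 < i\<close> by (simp add: insert_absorb numeral_2_eq_2)
    qed
    also have "\<dots> = int i * int (n - i) * (fact (i - 1) * fact (n - i - 1))"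
      using A fA by (simp add: card_cartesian_product card_Diff_subset case_prod_unfold)
    also have "\<dots> = (if 1 \<le> i \<and> i < n then fact i * fact (n - i) else 0)"
    proof (cases "1 \<le> i \<and> i < n")
      case True
      have "int i * fact (i - 1) = fact i"
        by (rule fact_reduce[symmetric]) (use True in simp)
      moreover have "int (n - i) * fact (n - i - 1) = fact (n - i)"
        by (rule fact_reduce[symmetric]) (use True in simp)
      moreover have "int i * int (n - i) * (fact (i - 1) * fact (n - i - 1)) =
        (int i * fact (i - 1)) * (int (n - i) * fact (n - i - 1))" by (simp only: mult_ac)
      ultimately show ?thesis using True by simp
    next
      case False
      then show ?thesis using assms by auto
    qed
    finally show ?thesis using sign_pairing_self[OF A(1)] A(2) by auto
  qed
  have "coeff_pairing n i i = (if 1 \<le> i \<and> i < n then 2 else 1) * (\<Sum>A | A \<subseteq> {1..n} \<and> card A = i. fact i * fact (n - i))"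
    unfolding coeff_pairing_eq sum_distrib_left by (intro sum.cong refl) (use inner in auto)
  then show ?thesis using card_subsets_mult_fact[OF assms] by simp
qed

text \<open>Up to \<open>fact n\<close>, row \<open>i\<close> is \<open>-1, 2, -1\<close> around the
  diagonal, with corner entry 1 for \<open>i = 0\<close>. Its partial sums are therefore
  \<open>-1\<close> just before the diagonal, \<open>1\<close> on it, and 0 elsewhere. The bound
  \<open>k < n\<close> keeps clear of the other corner.\<close>

lemma coeff_pairing_row_sum:
  assumes "k < n" "i < n"
  shows "(\<Sum>j\<le>k. coeff_pairing n i j) = (if i = k then 1 else if i = Suc k then -1 else 0) * fact n"
  using assms(1)
proof (induction k)
  case 0
  consider "i = 0" | "i = 1" | "i \<ge> 2" by linarith
  then show ?case
  proof cases
    case 1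
    then show ?thesis using coeff_pairing_same[of 0 n] by simp
  next
    case 2
    then show ?thesis using coeff_pairing_Suc[of 0 n] 0 coeff_pairing_commute[of n 1 0] by simp
  next
    case 3
    then show ?thesis using coeff_pairing_far[of 0 i n] coeff_pairing_commute[of n i 0] by simp
  qed
next
  case (Suc k)
  have IH: "(\<Sum>j\<le>k. coeff_pairing n i j) = (if i = k then 1 else if i = Suc k then -1 else 0) * fact n"
    using Suc by simp
  consider "i < k" | "i = k" | "i = Suc k" | "i = Suc (Suc k)" | "Suc k + 2 \<le> i" by linarith
  then have "coeff_pairing n i (Suc k) =
     (if i = k then -1 else if i = Suc k then 2 else if i = Suc (Suc k) then -1 else 0) * fact n"
  proof cases
    case 1
    then show ?thesis using coeff_pairing_far[of i "Suc k" n] by simp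
  next
    case 2
    then show ?thesis using coeff_pairing_Suc[of k n] Suc.prems by simp
  next
    case 3
    then show ?thesis using coeff_pairing_same[of "Suc k" n] Suc.prems by simp
  next
    case 4
    then show ?thesis using coeff_pairing_Suc[of "Suc k" n] assms(2) coeff_pairing_commute[of n i "Suc k"] by simp
  next
    case 5
    then show ?thesis using coeff_pairing_far[of "Suc k" i n] coeff_pairing_commute[of n i "Suc k"] by simp
  qed
  then show ?case using IH by auto
qed

text \<open>Both characters are partial sums of coefficients. Summing the partial row sums over rows
  up to \<open>i\<close>, the \<open>1\<close> at \<open>k\<close> is cancelled by the
  \<open>-1\<close> at \<open>Suc k\<close> unless the summation stops at \<open>k\<close>.\<close>

lemma signed_hook_char_orthogonal:
  assumes "i < n" "k < n"
  shows "(\<Sum>x | x permutes {1..n}. signed_hook_char n i x * signed_hook_char n k x) = (if i = k then fact n else 0)"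
proof -
  have "(\<Sum>x | x permutes {1..n}. signed_hook_char n i x * signed_hook_char n k x) =
    (\<Sum>x | x permutes {1..n}. \<Sum>l\<le>i. \<Sum>j\<le>k. fps_nth (cyc_poly n x) l * fps_nth (cyc_poly n x) j)"
    by (simp add: signed_hook_char_def sum_product)
  also have "\<dots> = (\<Sum>l\<le>i. \<Sum>j\<le>k. coeff_pairing n l j)"
    unfolding coeff_pairing_def by (subst sum.swap, intro sum.cong refl, rule sum.swap)
  also have "\<dots> = (\<Sum>l\<le>i. (if l = k then 1 else if l = Suc k then -1 else 0) * fact n)"
    using assms by (intro sum.cong refl coeff_pairing_row_sum) auto
  also have "\<dots> = (\<Sum>l\<le>i. (if l = k then 1 else 0) + (if l = Suc k then -1 else 0)) * fact n"
    unfolding sum_distrib_right by (intro sum.cong) auto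
  also have "(\<Sum>l\<le>i. (if l = k then 1 else 0) + (if l = Suc k then -1 else (0::int))) = (if i = k then 1 else 0)"
    by (auto simp: sum.distrib)
  finally show ?thesis by simp
qed

section \<open>The inner product and the Gram--Schmidt process\<close>

lemma cycle_class_inv:
  assumes "s \<in> cycle_class n i"
  shows "inv s \<in> cycle_class n i"
proof -
  have s: "s permutes {1..n}" using assms by (simp add: cycle_class_def)
  have "orbit (inv s) = orbit s"
    using orbit_inv_eq[OF permutes_interval_permutation[OF s]] by blast
  then show ?thesis using assms permutes_inv[OF s] by (simp add: cycle_class_def num_cycles_def)
qed

text \<open>The inverse appears because \<open>x\<close> lies in the translate of a class by
  \<open>s\<close> exactly if \<open>inv s \<circ> x\<close> lies in the class.\<close>

definition cycle_average :: "nat \<Rightarrow> ((nat \<Rightarrow> nat) \<Rightarrow> complex) \<Rightarrow> (nat \<Rightarrow> nat) \<Rightarrow> complex" where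
  "cycle_average n \<theta> x = (\<Sum>s\<in>cycle_class n 1. \<theta> (inv s \<circ> x)) / of_nat (card (cycle_class n 1))"

lemma full_cycles_nonempty: "n \<ge> 1 \<Longrightarrow> cycle_class n 1 \<noteq> {}"
  using card_full_cycles[of n] by (metis card.empty fact_nonzero)

lemma sum_class_value:
  assumes n: "n \<ge> 1" and \<theta>: "\<theta> \<in> CF_cyc n" and y: "y permutes {1..n}"
  shows "(\<Sum>i=1..n. class_value n \<theta> i * (if y \<in> cycle_class n i then 1 else 0)) = \<theta> y"
proof -
  have iff: "y \<in> cycle_class n i \<longleftrightarrow> i = num_cycles n y" for i
    using y by (auto simp: cycle_class_def)
  have "(\<Sum>i=1..n. class_value n \<theta> i * (if y \<in> cycle_class n i then 1 else 0)) =
    (\<Sum>i=1..n. if i = num_cycles n y then class_value n \<theta> i else 0)"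
    by (intro sum.cong) (auto simp: iff)
  also have "\<dots> = class_value n \<theta> (num_cycles n y)"
    using num_cycles_pos[OF n, of y] num_cycles_le[of n y] by simp
  also have "\<dots> = \<theta> y" using \<theta> by (rule class_value_eq) (simp add: iff)
  finally show ?thesis .
qed

text \<open>Counting point by point makes the dependence on \<open>s\<close> and on \<open>t\<close>
  a product, so that independence can be used for each \<open>x\<close> separately.\<close>

lemma card_translates_inter:
  assumes s: "s permutes {1..n}" and t: "t permutes {1..n}"
  shows "card ((\<lambda>x. s \<circ> x) ` cycle_class n i \<inter> (\<lambda>x. t \<circ> x) ` cycle_class n j) =
    (\<Sum>x | x permutes {1..n}. (if inv s \<circ> x \<in> cycle_class n i then 1 else 0) *
                              (if inv t \<circ> x \<in> cycle_class n j then 1 else 0))"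
proof -
  have im: "x \<in> (\<lambda>x. s \<circ> x) ` cycle_class n i \<longleftrightarrow> x permutes {1..n} \<and> inv s \<circ> x \<in> cycle_class n i"
    if s: "s permutes {1..n}" for s x i
  proof
    assume "x \<in> (\<lambda>x. s \<circ> x) ` cycle_class n i"
    then obtain z where z: "z \<in> cycle_class n i" "x = s \<circ> z" by blast
    then have "z permutes {1..n}" by (simp add: cycle_class_def)
    moreover have "inv s \<circ> x = z"
      using permutes_inv_o(2)[OF s] by (simp add: z(2) comp_assoc[symmetric])
    ultimately show "x permutes {1..n} \<and> inv s \<circ> x \<in> cycle_class n i"
      using z s by (auto intro: permutes_compose)
  next
    assume "x permutes {1..n} \<and> inv s \<circ> x \<in> cycle_class n i"
    moreover have "x = s \<circ> (inv s \<circ> x)"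
      using permutes_inv_o(1)[OF s] by (simp add: comp_assoc[symmetric])
    ultimately show "x \<in> (\<lambda>x. s \<circ> x) ` cycle_class n i" by blast
  qed
  have "(\<lambda>x. s \<circ> x) ` cycle_class n i \<inter> (\<lambda>x. t \<circ> x) ` cycle_class n j =
    {x. x permutes {1..n}} \<inter> {x. inv s \<circ> x \<in> cycle_class n i \<and> inv t \<circ> x \<in> cycle_class n j}"
    using im[OF s] im[OF t] by blast
  then have "card ((\<lambda>x. s \<circ> x) ` cycle_class n i \<inter> (\<lambda>x. t \<circ> x) ` cycle_class n j) =
    (\<Sum>x | x permutes {1..n}. if inv s \<circ> x \<in> cycle_class n i \<and> inv t \<circ> x \<in> cycle_class n j then 1 else 0)"
    using sum.If_cases[OF finite_perms[of n],
        of "\<lambda>x. inv s \<circ> x \<in> cycle_class n i \<and> inv t \<circ> x \<in> cycle_class n j" "\<lambda>_. 1::nat" "\<lambda>_. 0"]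
    by simp
  also have "\<dots> = (\<Sum>x | x permutes {1..n}. (if inv s \<circ> x \<in> cycle_class n i then 1 else 0) *
                              (if inv t \<circ> x \<in> cycle_class n j then 1 else 0))"
    by (intro sum.cong) auto
  finally show ?thesis .
qed

lemma pair_pmf_of_set:
  assumes "finite A" "A \<noteq> {}" "finite B" "B \<noteq> {}"
  shows "pair_pmf (pmf_of_set A) (pmf_of_set B) = pmf_of_set (A \<times> B)"
proof (rule pmf_eqI)
  fix z :: "'a \<times> 'b"
  show "pmf (pair_pmf (pmf_of_set A) (pmf_of_set B)) z = pmf (pmf_of_set (A \<times> B)) z"
    using assms by (cases z) (simp add: pmf_pair indicator_def card_cartesian_product)
qed

lemma sum_rotate:
  "(\<Sum>a\<in>A. \<Sum>b\<in>B. \<Sum>c\<in>C. g a b c) = (\<Sum>c\<in>C. \<Sum>a\<in>A. \<Sum>b\<in>B. g a b c)"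
proof -
  have "(\<Sum>a\<in>A. \<Sum>b\<in>B. \<Sum>c\<in>C. g a b c) = (\<Sum>a\<in>A. \<Sum>c\<in>C. \<Sum>b\<in>B. g a b c)"
    by (intro sum.cong refl sum.swap)
  also have "\<dots> = (\<Sum>c\<in>C. \<Sum>a\<in>A. \<Sum>b\<in>B. g a b c)" by (rule sum.swap)
  finally show ?thesis .
qed

text \<open>For fixed \<open>x\<close> the expectation factors into one sum over \<open>s\<close>
  and one over \<open>t\<close>. Summing over the classes with the class values then reassembles the
  two functions at \<open>inv s \<circ> x\<close> and \<open>inv t \<circ> x\<close>.\<close>

lemma cyc_inner_eq:
  assumes n: "n \<ge> 1" and \<theta>: "\<theta> \<in> CF_cyc n" and \<psi>: "\<psi> \<in> CF_cyc n"
  shows "cyc_inner n \<theta> \<psi> =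
    (\<Sum>x | x permutes {1..n}. cycle_average n \<theta> x * cnj (cycle_average n \<psi> x)) / fact n"
proof -
  let ?C = "cycle_class n 1"
  define N where "N = (of_nat (card ?C) :: complex)"
  define I where "I s i x = (if inv s \<circ> x \<in> cycle_class n i then 1 else 0 :: complex)"
    for s :: "nat \<Rightarrow> nat" and i and x :: "nat \<Rightarrow> nat"
  have fin: "finite ?C" and ne: "?C \<noteq> {}"
    using finite_cycle_class full_cycles_nonempty[OF n] by auto
  have ex: "of_real (measure_pmf.expectation (pair_pmf (pmf_of_set ?C) (pmf_of_set ?C))
      (\<lambda>(s, t). real (card ((\<lambda>x. s \<circ> x) ` cycle_class n i \<inter> (\<lambda>x. t \<circ> x) ` cycle_class n j)))) =
    (\<Sum>s\<in>?C. \<Sum>t\<in>?C. \<Sum>x | x permutes {1..n}. I s i x * I t j x) / (N * N)" for i j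
  proof -
    have "measure_pmf.expectation (pair_pmf (pmf_of_set ?C) (pmf_of_set ?C))
      (\<lambda>(s, t). real (card ((\<lambda>x. s \<circ> x) ` cycle_class n i \<inter> (\<lambda>x. t \<circ> x) ` cycle_class n j))) =
      (\<Sum>(s, t)\<in>?C \<times> ?C. real (card ((\<lambda>x. s \<circ> x) ` cycle_class n i \<inter> (\<lambda>x. t \<circ> x) ` cycle_class n j)))
        / real (card (?C \<times> ?C))"
      using fin ne by (simp add: pair_pmf_of_set integral_pmf_of_set)
    then have "complex_of_real (measure_pmf.expectation (pair_pmf (pmf_of_set ?C) (pmf_of_set ?C))
      (\<lambda>(s, t). real (card ((\<lambda>x. s \<circ> x) ` cycle_class n i \<inter> (\<lambda>x. t \<circ> x) ` cycle_class n j)))) =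
      (\<Sum>(s, t)\<in>?C \<times> ?C. of_nat (card ((\<lambda>x. s \<circ> x) ` cycle_class n i \<inter> (\<lambda>x. t \<circ> x) ` cycle_class n j))) / (N * N)"
      by (simp add: card_cartesian_product N_def case_prod_unfold)
    also have "(\<Sum>(s, t)\<in>?C \<times> ?C. of_nat (card ((\<lambda>x. s \<circ> x) ` cycle_class n i \<inter> (\<lambda>x. t \<circ> x) ` cycle_class n j))) =
      (\<Sum>(s, t)\<in>?C \<times> ?C. \<Sum>x | x permutes {1..n}. I s i x * I t j x)"
    proof (rule sum.cong[OF refl], clarify)
      fix s t assume "s \<in> ?C" "t \<in> ?C"
      then have st: "s permutes {1..n}" "t permutes {1..n}" by (simp_all add: cycle_class_def)
      show "of_nat (card ((\<lambda>x. s \<circ> x) ` cycle_class n i \<inter> (\<lambda>x. t \<circ> x) ` cycle_class n j)) =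
        (\<Sum>x | x permutes {1..n}. I s i x * I t j x)"
        unfolding card_translates_inter[OF st] of_nat_sum I_def by (intro sum.cong) auto
    qed
    finally show ?thesis unfolding sum.cartesian_product[symmetric] .
  qed
  have avg: "(\<Sum>i=1..n. class_value n \<xi> i * (\<Sum>s\<in>?C. I s i x)) = N * cycle_average n \<xi> x"
    if \<xi>: "\<xi> \<in> CF_cyc n" and x: "x permutes {1..n}" for \<xi> x
  proof -
    have "(\<Sum>i=1..n. class_value n \<xi> i * (\<Sum>s\<in>?C. I s i x)) = (\<Sum>s\<in>?C. \<Sum>i=1..n. class_value n \<xi> i * I s i x)"
      unfolding sum_distrib_left by (rule sum.swap)
    also have "\<dots> = (\<Sum>s\<in>?C. \<xi> (inv s \<circ> x))"
    proof (rule sum.cong[OF refl])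
      fix s assume "s \<in> ?C"
      then have "inv s permutes {1..n}" by (simp add: cycle_class_def permutes_inv)
      then have "inv s \<circ> x permutes {1..n}" using x by (rule permutes_compose[rotated])
      then show "(\<Sum>i=1..n. class_value n \<xi> i * I s i x) = \<xi> (inv s \<circ> x)"
        unfolding I_def by (rule sum_class_value[OF n \<xi>])
    qed
    finally show ?thesis using fin ne by (simp add: cycle_average_def N_def)
  qed
  have cI: "cnj (I s i x) = I s i x" for s i x by (simp add: I_def)
  have "(\<Sum>i=1..n. \<Sum>j=1..n. class_value n \<theta> i * cnj (class_value n \<psi> j) *
      (\<Sum>s\<in>?C. \<Sum>t\<in>?C. \<Sum>x | x permutes {1..n}. I s i x * I t j x)) =
    (\<Sum>i=1..n. \<Sum>j=1..n. \<Sum>x | x permutes {1..n}.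
      (class_value n \<theta> i * (\<Sum>s\<in>?C. I s i x)) * cnj (class_value n \<psi> j * (\<Sum>t\<in>?C. I t j x)))"
  proof (intro sum.cong refl)
    fix i j
    have "(\<Sum>s\<in>?C. \<Sum>t\<in>?C. \<Sum>x | x permutes {1..n}. I s i x * I t j x) =
      (\<Sum>x | x permutes {1..n}. \<Sum>s\<in>?C. \<Sum>t\<in>?C. I s i x * I t j x)"
      by (rule sum_rotate)
    also have "\<dots> = (\<Sum>x | x permutes {1..n}. (\<Sum>s\<in>?C. I s i x) * (\<Sum>t\<in>?C. I t j x))"
      by (simp add: sum_product)
    finally show "class_value n \<theta> i * cnj (class_value n \<psi> j) *
      (\<Sum>s\<in>?C. \<Sum>t\<in>?C. \<Sum>x | x permutes {1..n}. I s i x * I t j x) =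
      (\<Sum>x | x permutes {1..n}.
      (class_value n \<theta> i * (\<Sum>s\<in>?C. I s i x)) * cnj (class_value n \<psi> j * (\<Sum>t\<in>?C. I t j x)))"
      by (simp add: sum_distrib_left cI mult_ac)
  qed
  also have "\<dots> = (\<Sum>x | x permutes {1..n}. \<Sum>i=1..n. \<Sum>j=1..n.
      (class_value n \<theta> i * (\<Sum>s\<in>?C. I s i x)) * cnj (class_value n \<psi> j * (\<Sum>t\<in>?C. I t j x)))"
    by (rule sum_rotate)
  also have "\<dots> = (\<Sum>x | x permutes {1..n}. (N * cycle_average n \<theta> x) * cnj (N * cycle_average n \<psi> x))"
  proof (intro sum.cong refl, clarify)
    fix x assume x: "x permutes {1..n}"
    show "(\<Sum>i=1..n. \<Sum>j=1..n.
      (class_value n \<theta> i * (\<Sum>s\<in>?C. I s i x)) * cnj (class_value n \<psi> j * (\<Sum>t\<in>?C. I t j x))) =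
      (N * cycle_average n \<theta> x) * cnj (N * cycle_average n \<psi> x)"
      unfolding avg[OF \<theta> x, symmetric] avg[OF \<psi> x, symmetric] by (simp add: sum_product)
  qed
  also have "\<dots> = (N * N) * (\<Sum>x | x permutes {1..n}. cycle_average n \<theta> x * cnj (cycle_average n \<psi> x))"
    by (simp add: N_def sum_distrib_left mult_ac)
  finally have total: "(\<Sum>i=1..n. \<Sum>j=1..n. class_value n \<theta> i * cnj (class_value n \<psi> j) *
      (\<Sum>s\<in>?C. \<Sum>t\<in>?C. \<Sum>x | x permutes {1..n}. I s i x * I t j x)) =
      (N * N) * (\<Sum>x | x permutes {1..n}. cycle_average n \<theta> x * cnj (cycle_average n \<psi> x))" .
  have "N \<noteq> 0" using fin ne by (simp add: N_def)
  then show ?thesis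
    unfolding cyc_inner_def ex times_divide_eq_right sum_divide_distrib[symmetric] total
    using card_permutations[of "{1..n}" n] by simp
qed

text \<open>Only the unitriangular relation to the powers enters, which separates this argument from
  the modules. By orthonormality of the averages, the coefficient of a power along an earlier \<phi>
  is its binomial coefficient in the relation, so each step of the process undoes one row of
  it.\<close>

lemma gram_schmidt_cyc_power:
  fixes \<phi> :: "nat \<Rightarrow> (nat \<Rightarrow> nat) \<Rightarrow> complex"
  assumes n: "n \<ge> 1"
    and rel: "\<And>k p. k < n \<Longrightarrow> p permutes {1..n} \<Longrightarrow>
      cyc_power n (k + 1) p = (\<Sum>i\<le>k. of_nat ((n + (k - i)) choose n) * \<phi> i p)"
  shows "k < n \<Longrightarrow> p permutes {1..n} \<Longrightarrow>
      gram_schmidt (cyc_inner n) (\<lambda>j. cyc_power n (j + 1)) k p = \<phi> k p"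
proof -
  define b where "b k i = (of_nat ((n + (k - i)) choose n) :: complex)" for k i
  have b1: "b k k = 1" for k by (simp add: b_def)
  have rel': "\<phi> k p = cyc_power n (k + 1) p - (\<Sum>i<k. b k i * \<phi> i p)" if "k < n" "p permutes {1..n}" for k p
    using rel[OF that] by (simp add: b_def lessThan_Suc_atMost[symmetric])
  \<comment> \<open>The relation expresses each \<phi> by a power and earlier ones, so dependence on
    the number of cycles alone is inherited recursively.\<close>
  have CF: "\<phi> k \<in> CF_cyc n" if "k < n" for k
    using that
  proof (induction k rule: less_induct)
    case (less k)
    show ?case
      unfolding CF_cyc_def
    proof clarify
      fix p q assume pq: "p permutes {1..n}" "q permutes {1..n}" "num_cycles n p = num_cycles n q"
      have "\<phi> i p = \<phi> i q" if "i < k" for i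
      proof -
        have "\<phi> i \<in> CF_cyc n" using less.IH[OF that] that less.prems by simp
        then show ?thesis using pq unfolding CF_cyc_def mem_Collect_eq by metis
      qed
      then show "\<phi> k p = \<phi> k q"
        using rel'[OF less.prems pq(1)] rel'[OF less.prems pq(2)] pq(3) by (simp add: cyc_power_def)
    qed
  qed
  have avg_v: "cycle_average n (cyc_power n (k + 1)) x = (\<Sum>i\<le>k. b k i * of_int (signed_hook_char n i x))"
    if x: "x permutes {1..n}" for k x
  proof -
    have bij: "bij_betw inv (cycle_class n 1) (cycle_class n 1)"
    proof (rule bij_betw_byWitness[where f' = inv])
      have "inv (inv s) = s" if "s \<in> cycle_class n 1" for s :: "nat \<Rightarrow> nat"
      proof -
        have "s permutes {1..n}" using that by (simp add: cycle_class_def)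
        from inv_inv_eq[OF permutes_bij[OF this]] show ?thesis .
      qed
      then show "\<forall>s\<in>cycle_class n 1. inv (inv s) = s" "\<forall>s\<in>cycle_class n 1. inv (inv s) = s" by blast+
    qed (use cycle_class_inv in blast)+
    have "(\<Sum>s\<in>cycle_class n 1. cyc_power n (k + 1) (inv s \<circ> x)) = (\<Sum>s\<in>cycle_class n 1. cyc_power n (k + 1) (s \<circ> x))"
      by (rule sum.reindex_bij_betw[OF bij])
    also have "\<dots> = of_int (cyc_sum n (Suc k) x)"
      by (simp add: cyc_sum_def cyc_power_def)
    also have "\<dots> = fact (n - 1) * (\<Sum>i\<le>k. b k i * of_int (signed_hook_char n i x))"
      unfolding cyc_sum_eq[OF n x] by (simp add: b_def)
    finally show ?thesis
      unfolding cycle_average_def card_full_cycles[OF n] by simp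
  qed
  have avg_lin: "cycle_average n (\<phi> k) x = cycle_average n (cyc_power n (k + 1)) x - (\<Sum>i<k. b k i * cycle_average n (\<phi> i) x)"
    if k: "k < n" and x: "x permutes {1..n}" for k x
  proof -
    have "(\<Sum>s\<in>cycle_class n 1. \<phi> k (inv s \<circ> x)) =
      (\<Sum>s\<in>cycle_class n 1. cyc_power n (k + 1) (inv s \<circ> x) - (\<Sum>i<k. b k i * \<phi> i (inv s \<circ> x)))"
    proof (rule sum.cong[OF refl])
      fix s assume "s \<in> cycle_class n 1"
      then have "inv s permutes {1..n}" by (simp add: cycle_class_def permutes_inv)
      then have "inv s \<circ> x permutes {1..n}" using x by (rule permutes_compose[rotated])
      then show "\<phi> k (inv s \<circ> x) = cyc_power n (k + 1) (inv s \<circ> x) - (\<Sum>i<k. b k i * \<phi> i (inv s \<circ> x))"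
        by (rule rel'[OF k])
    qed
    also have "\<dots> = (\<Sum>s\<in>cycle_class n 1. cyc_power n (k + 1) (inv s \<circ> x)) -
       (\<Sum>i<k. b k i * (\<Sum>s\<in>cycle_class n 1. \<phi> i (inv s \<circ> x)))"
      unfolding sum_subtractf sum_distrib_left by (subst sum.swap) simp
    finally show ?thesis
      unfolding cycle_average_def by (simp add: diff_divide_distrib sum_divide_distrib[where A = "{..<k}"])
  qed
  \<comment> \<open>\<open>avg_v\<close> and \<open>avg_lin\<close> have the same coefficients
    \<open>b\<close>, with 1 on the diagonal, so the two families agree by recursion.\<close>
  have avg: "cycle_average n (\<phi> k) x = of_int (signed_hook_char n k x)"
    if "k < n" "x permutes {1..n}" for k x
    using that
  proof (induction k rule: less_induct)
    case (less k)
    have "(\<Sum>i<k. b k i * cycle_average n (\<phi> i) x) = (\<Sum>i<k. b k i * of_int (signed_hook_char n i x))"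
      by (intro sum.cong refl) (use less in auto)
    then show ?case
      unfolding avg_lin[OF less.prems] avg_v[OF less.prems(2)]
      by (simp add: b1 lessThan_Suc_atMost[symmetric])
  qed
  have orth: "(\<Sum>x | x permutes {1..n}. of_int (signed_hook_char n i x) * cnj (of_int (signed_hook_char n j x))) =
     (if i = j then fact n else (0::complex))" if "i < n" "j < n" for i j
  proof -
    have "(\<Sum>x | x permutes {1..n}. of_int (signed_hook_char n i x) * cnj (of_int (signed_hook_char n j x))) =
      (of_int (\<Sum>x | x permutes {1..n}. signed_hook_char n i x * signed_hook_char n j x) :: complex)"
      by simp
    then show ?thesis unfolding signed_hook_char_orthogonal[OF that] by simp
  qed
  have ip: "cyc_inner n (cyc_power n (k + 1)) (\<phi> j) = b k j" if "j \<le> k" "k < n" for j k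
  proof -
    have "cyc_inner n (cyc_power n (k + 1)) (\<phi> j) =
      (\<Sum>x | x permutes {1..n}. (\<Sum>i\<le>k. b k i * of_int (signed_hook_char n i x)) *
         cnj (of_int (signed_hook_char n j x))) / fact n"
      unfolding cyc_inner_eq[OF n cyc_power_in_CF_cyc CF[OF le_less_trans[OF that]]]
      using that by (intro arg_cong2[of _ _ _ _ "(/)"] sum.cong refl) (auto simp: avg avg_v[simplified])
    also have "(\<Sum>x | x permutes {1..n}. (\<Sum>i\<le>k. b k i * of_int (signed_hook_char n i x)) *
         cnj (of_int (signed_hook_char n j x))) =
       (\<Sum>i\<le>k. b k i * (\<Sum>x | x permutes {1..n}. of_int (signed_hook_char n i x) * cnj (of_int (signed_hook_char n j x))))"
      unfolding sum_distrib_right sum_distrib_left by (subst sum.swap) (simp add: mult.assoc)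
    also have "\<dots> = (\<Sum>i\<le>k. if i = j then b k i * fact n else 0)"
    proof (rule sum.cong[OF refl])
      fix i assume "i \<in> {..k}"
      then have "i < n" "j < n" using that by auto
      from orth[OF this] show "b k i * (\<Sum>x | x permutes {1..n}. of_int (signed_hook_char n i x) *
          cnj (of_int (signed_hook_char n j x))) = (if i = j then b k i * fact n else 0)"
        by simp
    qed
    also have "\<dots> = b k j * fact n" using that by simp
    finally show ?thesis by simp
  qed
  have ip1: "cyc_inner n (\<phi> k) (\<phi> k) = 1" if "k < n" for k
  proof -
    have "cyc_inner n (\<phi> k) (\<phi> k) =
      (\<Sum>x | x permutes {1..n}. of_int (signed_hook_char n k x) * cnj (of_int (signed_hook_char n k x))) / fact n"
      unfolding cyc_inner_eq[OF n CF[OF that] CF[OF that]]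
      using that by (intro arg_cong2[of _ _ _ _ "(/)"] sum.cong refl) (auto simp: avg)
    then show ?thesis using orth[OF that that] by (simp del: complex_cnj_of_int)
  qed
  have class_cong: "class_value n \<theta> = class_value n \<psi>" if "\<And>p. p permutes {1..n} \<Longrightarrow> \<theta> p = \<psi> p" for \<theta> \<psi>
  proof
    fix i
    have "\<theta> ` cycle_class n i = \<psi> ` cycle_class n i"
      by (rule image_cong) (use that in \<open>auto simp: cycle_class_def\<close>)
    then show "class_value n \<theta> i = class_value n \<psi> i" by (simp add: class_value_def)
  qed
  \<comment> \<open>The vectors of the process are known only at permutations of
    \<open>{1..n}\<close>; the form depends on no other values.\<close>
  have inner_cong: "cyc_inner n \<theta> \<psi> = cyc_inner n \<theta>' \<psi>'"
    if "\<And>p. p permutes {1..n} \<Longrightarrow> \<theta> p = \<theta>' p" "\<And>p. p permutes {1..n} \<Longrightarrow> \<psi> p = \<psi>' p" for \<theta> \<theta>' \<psi> \<psi>'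
  proof -
    have "class_value n \<theta> = class_value n \<theta>'" "class_value n \<psi> = class_value n \<psi>'"
      by (rule class_cong, rule that(1), assumption, rule class_cong, rule that(2), assumption)
    then show ?thesis by (simp only: cyc_inner_def)
  qed
  show "gram_schmidt (cyc_inner n) (\<lambda>j. cyc_power n (j + 1)) k p = \<phi> k p"
    if "k < n" "p permutes {1..n}" for k p
    using that
  proof (induction k arbitrary: p rule: less_induct)
    case (less k)
    let ?gs = "gram_schmidt (cyc_inner n) (\<lambda>j. cyc_power n (j + 1))"
    define u where "u x = cyc_power n (k + 1) x - (\<Sum>j<k. cyc_inner n (cyc_power n (k + 1)) (?gs j) * ?gs j x)" for x
    have gs_eq: "?gs j q = \<phi> j q" if "j < k" "q permutes {1..n}" for j q
      using less.IH[of j q] that less.prems by simp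
    have "cyc_inner n (cyc_power n (k + 1)) (?gs j) = b k j" if "j < k" for j
    proof -
      have "cyc_inner n (cyc_power n (k + 1)) (?gs j) = cyc_inner n (cyc_power n (k + 1)) (\<phi> j)"
        using gs_eq[OF that] by (intro inner_cong) auto
      then show ?thesis using ip[of j k] that less.prems by simp
    qed
    \<comment> \<open>The projections subtracted by the process are exactly the lower terms of the
      relation. The remainder already has norm 1, so the normalization changes nothing.\<close>
    then have u: "u q = \<phi> k q" if "q permutes {1..n}" for q
      unfolding u_def rel'[OF less.prems(1) that] using gs_eq that by simp
    have "cyc_inner n u u = cyc_inner n (\<phi> k) (\<phi> k)" using u by (intro inner_cong) auto
    then have "cyc_inner n u u = 1" using ip1 less.prems by simp
    moreover have "?gs k p = u p / csqrt (cyc_inner n u u)"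
      by (subst gram_schmidt.simps) (simp add: Let_def u_def[abs_def])
    ultimately show ?case using u[OF less.prems(2)] by simp
  qed
qed

section \<open>Young subgroups acting on words\<close>

text \<open>A set \<open>J\<close> of steps \<open>d\<close> stands for the adjacent transpositions \<open>(d, d + 1)\<close>; two positions have the
  same \<open>block_index\<close> iff they are joined by steps in \<open>J\<close>.\<close>

definition block_index :: "nat set \<Rightarrow> nat \<Rightarrow> nat" where
  "block_index J j = card ({1..<j} - J)"

definition young :: "nat \<Rightarrow> nat set \<Rightarrow> (nat \<Rightarrow> nat) set" where
  "young n J = {q. q permutes {1..n} \<and> (\<forall>j. block_index J (q j) = block_index J j)}"

text \<open>For a subgroup \<open>Y\<close>, \<open>rsum\<close> and \<open>ksum\<close> are right
  multiplication by its plain and signed sum. They permute the positions of a word, and hence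
  commute with the action of permutations on the entries, which is composition on the left.\<close>

definition rsum :: "(nat \<Rightarrow> nat) set \<Rightarrow> ((nat \<Rightarrow> nat) \<Rightarrow> complex) \<Rightarrow> (nat \<Rightarrow> nat) \<Rightarrow> complex" where
  "rsum Y v u = (\<Sum>r\<in>Y. v (u \<circ> r))"

definition ksum :: "(nat \<Rightarrow> nat) set \<Rightarrow> ((nat \<Rightarrow> nat) \<Rightarrow> complex) \<Rightarrow> (nat \<Rightarrow> nat) \<Rightarrow> complex" where
  "ksum Y v u = (\<Sum>q\<in>Y. of_int (sign q) * v (u \<circ> q))"

lemma block_index_eq_iff:
  assumes "1 \<le> a" "a \<le> b"
  shows "block_index J a = block_index J b \<longleftrightarrow> {a..<b} \<subseteq> J"
proof -
  have "{1..<b} - J = ({1..<a} - J) \<union> ({a..<b} - J)" using assms by auto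
  then have "block_index J b = block_index J a + card ({a..<b} - J)"
    unfolding block_index_def by (simp add: card_Un_disjoint disjoint_iff)
  then show ?thesis by auto
qed

lemma young_subset_perms: "young n J \<subseteq> perms n"
  by (auto simp: young_def)

lemma finite_young: "finite (young n J)"
  using finite_subset[OF young_subset_perms finite_perms] .

lemma id_in_young: "id \<in> young n J"
  by (simp add: young_def permutes_id)

lemma young_comp: "p \<in> young n J \<Longrightarrow> q \<in> young n J \<Longrightarrow> p \<circ> q \<in> young n J"
  by (auto simp: young_def intro: permutes_compose)

lemma young_inv:
  assumes "p \<in> young n J"
  shows "inv p \<in> young n J"
proof -
  have p: "p permutes {1..n}" using assms by (simp add: young_def)
  have "block_index J (inv p j) = block_index J j" for j
  proof -
    have "block_index J (p (inv p j)) = block_index J (inv p j)" using assms by (simp add: young_def)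
    then show ?thesis using permutes_inverses(1)[OF p] by simp
  qed
  then show ?thesis using permutes_inv[OF p] by (simp add: young_def)
qed

lemma inv_inv_perm: "p permutes S \<Longrightarrow> inv (inv p) = p"
  using inv_inv_eq[OF permutes_bij] .

lemma bij_betw_inv_young: "bij_betw inv (young n J) (young n J)"
proof (rule bij_betw_byWitness[where f' = inv])
  have "inv (inv s) = s" if "s \<in> young n J" for s
    using that inv_inv_perm by (auto simp: young_def)
  then show "\<forall>s\<in>young n J. inv (inv s) = s" "\<forall>s\<in>young n J. inv (inv s) = s" by blast+
qed (use young_inv in blast)+

lemma bij_betw_comp_right_young:
  assumes "r \<in> young n J"
  shows "bij_betw (\<lambda>q. q \<circ> r) (young n J) (young n J)"
proof (rule bij_betw_byWitness[where f' = "\<lambda>q. q \<circ> inv r"])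
  have r: "r permutes {1..n}" using assms by (simp add: young_def)
  show "\<forall>q\<in>young n J. q \<circ> r \<circ> inv r = q" "\<forall>q\<in>young n J. q \<circ> inv r \<circ> r = q"
    by (simp_all add: comp_assoc permutes_inv_o[OF r])
qed (use young_comp young_inv assms in blast)+

lemma bij_betw_comp_left_young:
  assumes "r \<in> young n J"
  shows "bij_betw (\<lambda>q. r \<circ> q) (young n J) (young n J)"
proof (rule bij_betw_byWitness[where f' = "\<lambda>q. inv r \<circ> q"])
  have r: "r permutes {1..n}" using assms by (simp add: young_def)
  show "\<forall>q\<in>young n J. inv r \<circ> (r \<circ> q) = q" "\<forall>q\<in>young n J. r \<circ> (inv r \<circ> q) = q"
    by (simp_all add: comp_assoc[symmetric] permutes_inv_o[OF r])
qed (use young_comp young_inv assms in blast)+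

lemma transp_in_young:
  assumes "d \<in> J" "1 \<le> d" "d < n"
  shows "transp d (Suc d) \<in> young n J"
proof -
  have "block_index J d = block_index J (Suc d)"
    using assms by (subst block_index_eq_iff) auto
  then show ?thesis
    using assms by (auto simp: young_def Transposition.transpose_def intro!: permutes_swap_id)
qed

lemma young_mono:
  assumes "J \<subseteq> J'"
  shows "young n J \<subseteq> young n J'"
proof
  fix q assume q: "q \<in> young n J"
  have "block_index J' (q j) = block_index J' j" for j
  proof (cases "j \<in> {1..n}")
    case True
    have q': "q permutes {1..n}" using q by (simp add: young_def)
    then have "q j \<in> {1..n}" using True permutes_in_image by metis
    moreover have "block_index J (q j) = block_index J j" using q by (simp add: young_def)
    ultimately show ?thesis
      using True assms block_index_eq_iff[of j "q j"] block_index_eq_iff[of "q j" j]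
      by (metis atLeastAtMost_iff nle_le subset_trans)
  next
    case False
    then show ?thesis using q by (simp add: young_def permutes_def)
  qed
  then show "q \<in> young n J'" using q by (simp add: young_def)
qed

lemma comp_right_perm_iff:
  assumes "r permutes {1..n::nat}"
  shows "u \<circ> r \<in> perms n \<longleftrightarrow> u \<in> perms n"
proof
  assume "u \<circ> r \<in> perms n"
  then have "u \<circ> r \<circ> inv r permutes {1..n}"
    using permutes_inv[OF assms] by (auto intro: permutes_compose)
  then show "u \<in> perms n" by (simp add: comp_assoc permutes_inv_o[OF assms])
qed (use assms in \<open>auto intro: permutes_compose\<close>)

lemma bij_betw_comp_right_perms:
  assumes r: "r permutes {1..n::nat}"
  shows "bij_betw (\<lambda>u. u \<circ> r) (perms n) (perms n)"
proof (rule bij_betw_byWitness[where f' = "\<lambda>q. q \<circ> inv r"])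
  show "\<forall>q\<in>perms n. q \<circ> r \<circ> inv r = q" "\<forall>q\<in>perms n. q \<circ> inv r \<circ> r = q"
    by (simp_all add: comp_assoc permutes_inv_o[OF r])
qed (use r permutes_inv[OF r] in \<open>auto intro: permutes_compose\<close>)

lemma sign_perm_comp:
  "p permutes {1..n::nat} \<Longrightarrow> q permutes {1..n} \<Longrightarrow> sign (p \<circ> q) = sign p * sign q"
  by (intro sign_compose) (auto simp: permutation_permutes)

section \<open>Self-adjointness of the plain and signed sums over Young subgroups\<close>

definition word_inner :: "nat \<Rightarrow> ((nat \<Rightarrow> nat) \<Rightarrow> complex) \<Rightarrow> ((nat \<Rightarrow> nat) \<Rightarrow> complex) \<Rightarrow> complex" where
  "word_inner n f g = (\<Sum>w\<in>perms n. f w * cnj (g w))"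

lemma word_inner_shift:
  assumes r: "r permutes {1..n}"
  shows "(\<Sum>w\<in>perms n. f (w \<circ> r) * cnj (g w)) = (\<Sum>w\<in>perms n. f w * cnj (g (w \<circ> inv r)))"
  using sum.reindex_bij_betw[OF bij_betw_comp_right_perms[OF r], of "\<lambda>w. f w * cnj (g (w \<circ> inv r))"]
  by (simp add: comp_assoc permutes_inv_o[OF r])

text \<open>The adjoint of translation by \<open>r\<close> is translation by \<open>inv r\<close>,
  and a subgroup is closed under inversion. The signed version uses in addition that inversion
  preserves the sign.\<close>

lemma word_inner_rsum:
  "word_inner n (rsum (young n J) f) g = word_inner n f (rsum (young n J) g)"
proof -
  have "word_inner n (rsum (young n J) f) g = (\<Sum>r\<in>young n J. \<Sum>w\<in>perms n. f (w \<circ> r) * cnj (g w))"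
    unfolding word_inner_def rsum_def sum_distrib_right by (rule sum.swap)
  also have "\<dots> = (\<Sum>r\<in>young n J. \<Sum>w\<in>perms n. f w * cnj (g (w \<circ> inv r)))"
    by (intro sum.cong refl word_inner_shift) (simp add: young_def)
  also have "\<dots> = (\<Sum>r\<in>young n J. \<Sum>w\<in>perms n. f w * cnj (g (w \<circ> r)))"
    by (rule sum.reindex_bij_betw[OF bij_betw_inv_young])
  also have "\<dots> = word_inner n f (rsum (young n J) g)"
    unfolding word_inner_def rsum_def cnj_sum sum_distrib_left by (rule sum.swap)
  finally show ?thesis .
qed

lemma word_inner_ksum:
  "word_inner n (ksum (young n J) f) g = word_inner n f (ksum (young n J) g)"
proof -
  have "word_inner n (ksum (young n J) f) g =
      (\<Sum>r\<in>young n J. \<Sum>w\<in>perms n. of_int (sign r) * f (w \<circ> r) * cnj (g w))"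
    unfolding word_inner_def ksum_def sum_distrib_right by (rule sum.swap)
  also have "\<dots> = (\<Sum>r\<in>young n J. \<Sum>w\<in>perms n. of_int (sign r) * (f w * cnj (g (w \<circ> inv r))))"
    unfolding mult.assoc sum_distrib_left[symmetric]
    by (intro sum.cong refl arg_cong2[of _ _ _ _ "(*)"] word_inner_shift) (simp add: young_def)
  also have "\<dots> = (\<Sum>r\<in>young n J. \<Sum>w\<in>perms n. of_int (sign (inv r)) * (f w * cnj (g (w \<circ> inv r))))"
  proof (rule sum.cong[OF refl])
    fix r assume "r \<in> young n J"
    then have "r permutes {1..n}" by (simp add: young_def)
    then have "permutation r" by (rule permutes_imp_permutation[rotated]) simp
    then show "(\<Sum>w\<in>perms n. of_int (sign r) * (f w * cnj (g (w \<circ> inv r)))) =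
      (\<Sum>w\<in>perms n. of_int (sign (inv r)) * (f w * cnj (g (w \<circ> inv r))))"
      by (simp add: sign_inverse)
  qed
  also have "\<dots> = (\<Sum>r\<in>young n J. \<Sum>w\<in>perms n. of_int (sign r) * (f w * cnj (g (w \<circ> r))))"
    by (rule sum.reindex_bij_betw[OF bij_betw_inv_young])
  also have "\<dots> = word_inner n f (ksum (young n J) g)"
    unfolding word_inner_def ksum_def cnj_sum sum_distrib_left
    by (subst sum.swap) (simp add: mult_ac)
  finally show ?thesis .
qed

lemma rsum_invariant:
  assumes "r \<in> young n J"
  shows "rsum (young n J) v (u \<circ> r) = rsum (young n J) v u"
  unfolding rsum_def comp_assoc
  using sum.reindex_bij_betw[OF bij_betw_comp_left_young[OF assms], of "\<lambda>q. v (u \<circ> q)"] by simp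

lemma rsum_of_invariant:
  assumes "\<And>r. r \<in> young n J \<Longrightarrow> v (u \<circ> r) = v u"
  shows "rsum (young n J) v u = of_nat (card (young n J)) * v u"
  unfolding rsum_def using assms by simp

text \<open>Replacing \<open>q\<close> by \<open>q \<circ> transp d (Suc d)\<close> reverses the
  sign and leaves the value of \<open>v\<close>, so the sum equals its own negative.\<close>

lemma ksum_of_invariant:
  assumes d: "d \<in> J" "1 \<le> d" "d < n" and inv: "\<And>u. u \<in> perms n \<Longrightarrow> v (u \<circ> transp d (Suc d)) = v u"
    and u: "u \<in> perms n"
  shows "ksum (young n J) v u = 0"
proof -
  let ?s = "transp d (Suc d)"
  have s: "?s \<in> young n J" by (rule transp_in_young[OF d])
  then have sp: "?s permutes {1..n}" by (simp add: young_def)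
  have "ksum (young n J) v u = (\<Sum>q\<in>young n J. of_int (sign (q \<circ> ?s)) * v (u \<circ> (q \<circ> ?s)))"
    unfolding ksum_def by (rule sum.reindex_bij_betw[OF bij_betw_comp_right_young[OF s], symmetric])
  also have "\<dots> = (\<Sum>q\<in>young n J. - (of_int (sign q) * v (u \<circ> q)))"
  proof (rule sum.cong[OF refl])
    fix q assume "q \<in> young n J"
    then have q: "q permutes {1..n}" by (simp add: young_def)
    have "u \<circ> q \<in> perms n" using u q by (auto intro: permutes_compose)
    from inv[OF this] have "v (u \<circ> (q \<circ> ?s)) = v (u \<circ> q)" by (simp only: comp_assoc)
    then show "of_int (sign (q \<circ> ?s)) * v (u \<circ> (q \<circ> ?s)) = - (of_int (sign q) * v (u \<circ> q))"
      by (simp add: sign_perm_comp[OF q sp] sign_swap_id)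
  qed
  also have "\<dots> = - ksum (young n J) v u" by (simp add: ksum_def sum_negf)
  finally show ?thesis by simp
qed

text \<open>With \<open>v = \<rho> \<kappa> a\<close>, self-adjointness of \<open>\<rho>\<close> and \<open>\<kappa>\<close> gives
  \<open>\<langle>v, v\<rangle> = |Y| \<langle>\<kappa> v, a\<rangle>\<close>.\<close>

lemma rsum_ksum_eq_0:
  assumes v: "\<And>u. u \<in> perms n \<Longrightarrow> v u = rsum (young n J) (ksum (young n E) a) u"
    and k: "\<And>u. u \<in> perms n \<Longrightarrow> ksum (young n E) v u = 0" and w: "w \<in> perms n"
  shows "v w = 0"
proof -
  define x where "x = ksum (young n E) a"
  define z where "z = rsum (young n J) x"
  have vz: "v u = z u" if "u \<in> perms n" for u using v[OF that] by (simp add: z_def x_def)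
  have "word_inner n z z = word_inner n (rsum (young n J) z) x"
    by (simp add: z_def word_inner_rsum)
  also have "\<dots> = of_nat (card (young n J)) * word_inner n z x"
    unfolding word_inner_def sum_distrib_left z_def
    by (intro sum.cong refl) (simp add: rsum_of_invariant rsum_invariant mult.assoc)
  also have "word_inner n z x = word_inner n (ksum (young n E) z) a"
    unfolding x_def by (simp add: word_inner_ksum)
  also have "\<dots> = 0"
  proof -
    have "ksum (young n E) z u = 0" if "u \<in> perms n" for u
    proof -
      have "ksum (young n E) z u = ksum (young n E) v u"
        unfolding ksum_def
      proof (rule sum.cong[OF refl])
        fix q assume "q \<in> young n E"
        then have "u \<circ> q \<in> perms n" using that by (auto simp: young_def intro: permutes_compose)
        then show "of_int (sign q) * z (u \<circ> q) = of_int (sign q) * v (u \<circ> q)" by (simp only: vz)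
      qed
      then show ?thesis using k[OF that] by simp
    qed
    then show ?thesis by (simp add: word_inner_def)
  qed
  finally have "(\<Sum>u\<in>perms n. z u * cnj (z u)) = 0" by (simp add: word_inner_def)
  then have "complex_of_real (\<Sum>u\<in>perms n. (cmod (z u))\<^sup>2) = 0"
    by (simp only: of_real_sum complex_norm_square)
  then have "(\<Sum>u\<in>perms n. (cmod (z u))\<^sup>2) = 0" using of_real_eq_0_iff by blast
  then have "(cmod (z w))\<^sup>2 = 0" using w finite_perms by (subst (asm) sum_nonneg_eq_0_iff) auto
  then show ?thesis using vz[OF w] by simp
qed

text \<open>Membership in the left ideal \<open>A \<kappa>\<^sub>D \<rho>\<^sub>D\<close>, demanded
  at words only: \<open>\<kappa>\<^sub>D\<close> is applied first, so the elements are invariant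
  under the Young subgroup of the complement of \<open>D\<close>.\<close>

definition in_component :: "nat \<Rightarrow> nat set \<Rightarrow> ((nat \<Rightarrow> nat) \<Rightarrow> complex) \<Rightarrow> bool" where
  "in_component n D v \<longleftrightarrow>
     (\<exists>a. \<forall>u\<in>perms n. v u = rsum (young n ({1..<n} - D)) (ksum (young n D) a) u)"

lemma rsum_linear: "rsum Y (\<lambda>u. \<Sum>i\<in>A. c i * f i u) u = (\<Sum>i\<in>A. c i * rsum Y (f i) u)"
  unfolding rsum_def sum_distrib_left by (rule sum.swap)

lemma ksum_linear: "ksum Y (\<lambda>u. \<Sum>i\<in>A. c i * f i u) u = (\<Sum>i\<in>A. c i * ksum Y (f i) u)"
  unfolding ksum_def sum_distrib_left by (subst sum.swap) (simp add: mult_ac)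

lemma ksum_sum: "ksum Y (\<lambda>u. \<Sum>i\<in>A. f i u) u = (\<Sum>i\<in>A. ksum Y (f i) u)"
  using ksum_linear[of Y "\<lambda>_. 1" f A u] by simp

lemma in_component_linear:
  assumes "\<And>i. i \<in> A \<Longrightarrow> in_component n D (f i)"
  shows "in_component n D (\<lambda>u. \<Sum>i\<in>A. c i * f i u)"
proof -
  have "\<forall>i\<in>A. \<exists>a. \<forall>u\<in>perms n. f i u = rsum (young n ({1..<n} - D)) (ksum (young n D) a) u"
    using assms unfolding in_component_def by blast
  then obtain a where a: "\<And>i u. i \<in> A \<Longrightarrow> u \<in> perms n \<Longrightarrow>
      f i u = rsum (young n ({1..<n} - D)) (ksum (young n D) (a i)) u"
    by metis
  have k: "ksum (young n D) (\<lambda>u. \<Sum>i\<in>A. c i * a i u) = (\<lambda>u. \<Sum>i\<in>A. c i * ksum (young n D) (a i) u)"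
    by (rule ext) (rule ksum_linear)
  show ?thesis
    unfolding in_component_def
    by (rule exI[of _ "\<lambda>u. \<Sum>i\<in>A. c i * a i u"], unfold k rsum_linear) (simp add: a)
qed

lemma in_component_diff:
  assumes "in_component n D f" "in_component n D g"
  shows "in_component n D (\<lambda>u. f u - g u)"
  using in_component_linear[of "{True, False}" n D "\<lambda>b. if b then f else g" "\<lambda>b. if b then 1 else -1"] assms
  by simp

lemma in_component_invariant:
  assumes v: "in_component n D v" and r: "r \<in> young n ({1..<n} - D)" and u: "u \<in> perms n"
  shows "v (u \<circ> r) = v u"
proof -
  have "u \<circ> r \<in> perms n" using u r by (auto simp: young_def intro: permutes_compose)
  then show ?thesis using v u rsum_invariant[OF r] unfolding in_component_def by metis
qed

text \<open>A step of \<open>E\<close> outside \<open>D\<close> belongs to the subgroup under which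
  \<open>v\<close> is invariant, and the signed sum over \<open>E\<close> antisymmetrizes in that
  step.\<close>

lemma ksum_in_component:
  assumes v: "in_component n D v" and E: "E \<subseteq> {1..<n}" "\<not> E \<subseteq> D" and u: "u \<in> perms n"
  shows "ksum (young n E) v u = 0"
proof -
  obtain d where d: "d \<in> E" "d \<notin> D" using E by blast
  then have d': "1 \<le> d" "d < n" using E by auto
  show ?thesis
  proof (rule ksum_of_invariant[OF d(1) d' _ u])
    fix u assume "u \<in> perms n"
    then show "v (u \<circ> transp d (Suc d)) = v u"
      using d d' by (intro in_component_invariant[OF v] transp_in_young) auto
  qed
qed

text \<open>Applying \<open>\<kappa>\<^sub>E\<close> kills every component except those with \<open>D \<supseteq> E\<close>, so a maximal nonzero
  component in \<open>F\<close> is isolated.\<close>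

lemma components_vanish:
  assumes v: "\<And>D. D \<subseteq> {1..<n} \<Longrightarrow> in_component n D (v D)"
    and up: "\<And>E D. E \<in> F \<Longrightarrow> E \<subseteq> D \<Longrightarrow> D \<subseteq> {1..<n} \<Longrightarrow> D \<in> F" and F: "F \<subseteq> Pow {1..<n}"
    and k: "\<And>E u. E \<in> F \<Longrightarrow> u \<in> perms n \<Longrightarrow> ksum (young n E) (\<lambda>u. \<Sum>D\<in>Pow {1..<n}. v D u) u = 0"
    and E: "E \<in> F" and w: "w \<in> perms n"
  shows "v E w = 0"
proof (rule ccontr)
  assume "v E w \<noteq> 0"
  define B where "B = {D \<in> F. \<exists>u\<in>perms n. v D u \<noteq> 0}"
  have "finite B" unfolding B_def using F by (auto intro: finite_subset)
  moreover have "B \<noteq> {}" using E w \<open>v E w \<noteq> 0\<close> by (auto simp: B_def)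
  ultimately obtain M where M: "M \<in> B" "\<And>D. D \<in> B \<Longrightarrow> M \<subseteq> D \<Longrightarrow> D = M"
    using finite_has_maximal[of B] by metis
  have MF: "M \<in> F" "M \<subseteq> {1..<n}" using M(1) F by (auto simp: B_def)
  have "ksum (young n M) (v M) u = 0" if u: "u \<in> perms n" for u
  proof -
    have z: "ksum (young n M) (v D) u = 0" if D: "D \<in> Pow {1..<n} - {M}" for D
    proof (cases "M \<subseteq> D")
      case False
      then show ?thesis using D u MF(2) by (intro ksum_in_component[OF v]) auto
    next
      case True
      then have "D \<in> F" using up MF D by blast
      then have "D \<notin> B" using M(2) True D by blast
      then have "v D x = 0" if "x \<in> perms n" for x using that \<open>D \<in> F\<close> by (auto simp: B_def)
      then show ?thesis
        unfolding ksum_def using u by (intro sum.neutral ballI) (auto simp: young_def permutes_compose)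
    qed
    have "0 = (\<Sum>D\<in>Pow {1..<n}. ksum (young n M) (v D) u)"
      using k[OF MF(1) u] by (simp add: ksum_sum)
    also have "\<dots> = ksum (young n M) (v M) u + (\<Sum>D\<in>Pow {1..<n} - {M}. ksum (young n M) (v D) u)"
      using MF by (intro sum.remove) auto
    also have "(\<Sum>D\<in>Pow {1..<n} - {M}. ksum (young n M) (v D) u) = 0"
      using z by (rule sum.neutral[OF ballI])
    finally show ?thesis by simp
  qed
  moreover obtain a where "\<And>u. u \<in> perms n \<Longrightarrow> v M u = rsum (young n ({1..<n} - M)) (ksum (young n M) a) u"
    using v[OF MF(2)] unfolding in_component_def by blast
  ultimately have "v M u = 0" if "u \<in> perms n" for u
    using rsum_ksum_eq_0[of n "v M"] that by blast
  then show False using M(1) by (auto simp: B_def)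
qed

section \<open>Descent vectors\<close>

definition lex_less :: "(nat \<Rightarrow> nat) \<Rightarrow> (nat \<Rightarrow> nat) \<Rightarrow> bool" where
  "lex_less u v \<longleftrightarrow> (\<exists>j. u j < v j \<and> (\<forall>i<j. u i = v i))"

lemma lex_less_irrefl: "\<not> lex_less u u"
  by (simp add: lex_less_def)

lemma lex_less_trans:
  assumes "lex_less u v" "lex_less v w"
  shows "lex_less u w"
proof -
  obtain i where i: "u i < v i" "\<forall>k<i. u k = v k" using assms(1) by (auto simp: lex_less_def)
  obtain j where j: "v j < w j" "\<forall>k<j. v k = w k" using assms(2) by (auto simp: lex_less_def)
  have "u (min i j) < w (min i j) \<and> (\<forall>k<min i j. u k = w k)"
    using i j by (cases i j rule: linorder_cases) (auto simp: min_def)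
  then show ?thesis unfolding lex_less_def by blast
qed

lemma lex_less_maximal:
  assumes "finite A" "A \<noteq> {}"
  obtains m where "m \<in> A" "\<And>x. x \<in> A \<Longrightarrow> \<not> lex_less m x"
proof -
  have "\<exists>m\<in>A. \<forall>x\<in>A. x \<noteq> m \<longrightarrow> \<not> lex_less m x"
  proof (rule Finite_Set.bex_max_element[OF assms(1) _ _ assms(2)])
    show "asymp_on A lex_less"
      using lex_less_trans lex_less_irrefl by (intro asymp_onI) blast
    show "transp_on A lex_less"
      using lex_less_trans by (intro transp_onI) blast
  qed
  then show ?thesis using that lex_less_irrefl by metis
qed

text \<open>The first moved position is sent to the right, since everything to its left is fixed.
  Position and image lie in one block, so all steps between them are in \<open>J\<close>.\<close>

lemma young_first_moved:
  assumes q: "q \<in> young n J" "q \<noteq> id"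
  obtains j where "q j \<noteq> j" "\<And>i. i < j \<Longrightarrow> q i = i" "1 \<le> j" "j < q j" "q j \<le> n" "{j..<q j} \<subseteq> J"
proof -
  define j where "j = (LEAST j. q j \<noteq> j)"
  have ex: "\<exists>j. q j \<noteq> j" using q(2) by (auto simp: fun_eq_iff)
  have j: "q j \<noteq> j" unfolding j_def by (rule LeastI_ex[OF ex])
  have less: "q i = i" if "i < j" for i using not_less_Least[of i "\<lambda>j. q j \<noteq> j"] that by (auto simp: j_def)
  have qp: "q permutes {1..n}" using q by (simp add: young_def)
  have jn: "j \<in> {1..n}" using j qp by (auto simp: permutes_def)
  then have qj: "q j \<in> {1..n}" using qp permutes_in_image by metis
  have gt: "j < q j"
  proof (rule ccontr)
    assume "\<not> j < q j"
    then have "q j < j" using j by simp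
    then have "q (q j) = q j" by (rule less)
    then show False using permutes_inj[OF qp] j by (simp add: inj_eq)
  qed
  have "block_index J j = block_index J (q j)" using q by (simp add: young_def)
  then have "{j..<q j} \<subseteq> J" using gt jn by (subst (asm) block_index_eq_iff) auto
  then show ?thesis using that j less jn qj gt by auto
qed

lemma chain_less:
  fixes u :: "nat \<Rightarrow> nat"
  assumes "i < j" "\<And>d. d \<in> {i..<j} \<Longrightarrow> u d < u (Suc d)"
  shows "u i < u j"
  using assms
proof (induction j)
  case (Suc j)
  show ?case
  proof (cases "i = j")
    case True
    then show ?thesis using Suc.prems(2)[of j] by simp
  next
    case False
    then have "u i < u j" using Suc by auto
    also have "u j < u (Suc j)" using Suc.prems by auto
    finally show ?thesis .
  qed
qed simp

lemma chain_greater: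
  fixes u :: "nat \<Rightarrow> nat"
  assumes "i < j" "\<And>d. d \<in> {i..<j} \<Longrightarrow> u (Suc d) < u d"
  shows "u j < u i"
  using assms
proof (induction j)
  case (Suc j)
  show ?case
  proof (cases "i = j")
    case True
    then show ?thesis using Suc.prems(2)[of j] by simp
  next
    case False
    then have "u j < u i" using Suc by auto
    then show ?thesis using Suc.prems(2)[of j] Suc.prems(1) by auto
  qed
qed simp

text \<open>At the first moved position the entry is replaced by a later one of the same increasing
  run.\<close>

lemma lex_less_young_increasing:
  assumes u: "\<And>d. d \<in> J \<Longrightarrow> 1 \<le> d \<Longrightarrow> d < n \<Longrightarrow> u d < u (Suc d)" and q: "q \<in> young n J" "q \<noteq> id"
  shows "lex_less u (u \<circ> q)"
proof -
  obtain j where j: "\<And>i. i < j \<Longrightarrow> q i = i" "1 \<le> j" "j < q j" "q j \<le> n" "{j..<q j} \<subseteq> J"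
    using young_first_moved[OF q] by metis
  have "u j < u (q j)" using j(3) by (rule chain_less) (use j u in auto)
  then show ?thesis unfolding lex_less_def using j(1) by auto
qed

lemma lex_less_young_decreasing:
  assumes u: "\<And>d. d \<in> J \<Longrightarrow> 1 \<le> d \<Longrightarrow> d < n \<Longrightarrow> u (Suc d) < u d" and q: "q \<in> young n J" "q \<noteq> id"
  shows "lex_less (u \<circ> q) u"
proof -
  obtain j where j: "\<And>i. i < j \<Longrightarrow> q i = i" "1 \<le> j" "j < q j" "q j \<le> n" "{j..<q j} \<subseteq> J"
    using young_first_moved[OF q] by metis
  have "u (q j) < u j" using j(3) by (rule chain_greater) (use j u in auto)
  then show ?thesis unfolding lex_less_def using j(1) by auto
qed

definition des :: "nat \<Rightarrow> (nat \<Rightarrow> nat) \<Rightarrow> nat set" where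
  "des n w = {d\<in>{1..<n}. w (Suc d) < w d}"

definition delta :: "(nat \<Rightarrow> nat) \<Rightarrow> (nat \<Rightarrow> nat) \<Rightarrow> complex" where
  "delta w u = (if u = w then 1 else 0)"

definition descent_vector :: "nat \<Rightarrow> (nat \<Rightarrow> nat) \<Rightarrow> (nat \<Rightarrow> nat) \<Rightarrow> complex" where
  "descent_vector n w = rsum (young n ({1..<n} - des n w)) (ksum (young n (des n w)) (delta w))"

lemma des_subset: "des n w \<subseteq> {1..<n}"
  by (auto simp: des_def)

lemma not_des:
  assumes "w \<in> perms n" "d \<in> {1..<n} - des n w"
  shows "w d < w (Suc d)"
proof -
  have "inj w" using assms(1) permutes_inj by auto
  then have "w d \<noteq> w (Suc d)" by (simp add: inj_eq)
  then show ?thesis using assms(2) by (auto simp: des_def)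
qed

lemma descent_vector_in_component: "in_component n (des n w) (descent_vector n w)"
  unfolding in_component_def descent_vector_def by blast

lemma descent_vector_support:
  assumes "w \<in> perms n" "u \<notin> perms n"
  shows "descent_vector n w u = 0"
proof -
  have "u \<circ> r \<circ> q \<noteq> w" if "r \<in> young n J" "q \<in> young n E" for r q J E
    using that assms comp_right_perm_iff[of q n "u \<circ> r"] comp_right_perm_iff[of r n u]
    by (auto simp: young_def)
  then show ?thesis
    by (auto simp: descent_vector_def rsum_def ksum_def delta_def intro!: sum.neutral)
qed

text \<open>A word \<open>u\<close> in the support satisfies
  \<open>u \<circ> r = w \<circ> inv q\<close>. Passing from \<open>u\<close> to
  \<open>u \<circ> r\<close> goes up, because \<open>u\<close> increases along the complement of the
  common descent set, and passing from \<open>w \<circ> inv q\<close> to \<open>w\<close> goes up,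
  because \<open>w\<close> decreases along it. The first half needs equal descent sets; words with
  different ones are separated by \<open>components_vanish\<close>.\<close>

lemma descent_vector_leading:
  assumes w: "w \<in> perms n" and u: "u \<in> perms n" "des n u = des n w" "u \<noteq> w" and nz: "descent_vector n w u \<noteq> 0"
  shows "lex_less u w"
proof -
  let ?D = "des n w" and ?J = "{1..<n} - des n w"
  have "\<exists>r\<in>young n ?J. \<exists>q\<in>young n ?D. u \<circ> r \<circ> q = w"
  proof (rule ccontr)
    assume "\<not> ?thesis"
    then have "descent_vector n w u = 0"
      by (auto simp: descent_vector_def rsum_def ksum_def delta_def intro!: sum.neutral)
    then show False using nz by simp
  qed
  then obtain r q where rq: "r \<in> young n ?J" "q \<in> young n ?D" "u \<circ> r \<circ> q = w" by blast
  have qp: "q permutes {1..n}" using rq by (simp add: young_def)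
  have x: "u \<circ> r = w \<circ> inv q"
    using arg_cong[OF rq(3), of "\<lambda>f. f \<circ> inv q"] by (simp add: comp_assoc permutes_inv_o[OF qp])
  have iq: "inv q \<in> young n ?D" using rq(2) by (rule young_inv)
  have 1: "u \<circ> r = u \<or> lex_less u (u \<circ> r)"
  proof (cases "r = id")
    case False
    then show ?thesis using rq(1) u not_des[of u n]
      by (intro disjI2 lex_less_young_increasing[of ?J n]) auto
  qed simp
  have 2: "w \<circ> inv q = w \<or> lex_less (w \<circ> inv q) w"
  proof (cases "inv q = id")
    case False
    then show ?thesis using iq
      by (intro disjI2 lex_less_young_decreasing[of ?D n]) (auto simp: des_def)
  qed simp
  show ?thesis using 1 2 u(3) lex_less_trans[of u "w \<circ> inv q" w] unfolding x by auto
qed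

text \<open>For \<open>u = w\<close> the chain of inequalities in
  \<open>descent_vector_leading\<close> closes up, so only \<open>r = id\<close> and
  \<open>q = id\<close> contribute.\<close>

lemma descent_vector_self:
  assumes w: "w \<in> perms n"
  shows "descent_vector n w w = 1"
proof -
  let ?D = "des n w" and ?J = "{1..<n} - des n w"
  have only: "r = id \<and> q = id" if rq: "r \<in> young n ?J" "q \<in> young n ?D" "w \<circ> r \<circ> q = w" for r q
  proof -
    have qp: "q permutes {1..n}" using rq by (simp add: young_def)
    have x: "w \<circ> r = w \<circ> inv q"
      using arg_cong[OF rq(3), of "\<lambda>f. f \<circ> inv q"] by (simp add: comp_assoc permutes_inv_o[OF qp])
    have iq: "inv q \<in> young n ?D" using rq(2) by (rule young_inv)
    have 1: "r = id \<or> lex_less w (w \<circ> r)"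
      using rq(1) w not_des[of w n] lex_less_young_increasing[of ?J n w r] by auto
    have 2: "inv q = id \<or> lex_less (w \<circ> inv q) w"
      using iq lex_less_young_decreasing[of ?D n w "inv q"] by (auto simp: des_def)
    have r: "r = id"
    proof (rule ccontr)
      assume "r \<noteq> id"
      then have "lex_less w (w \<circ> inv q)" using 1 x by simp
      moreover have "w \<circ> inv q = w \<or> lex_less (w \<circ> inv q) w" using 2 by auto
      ultimately show False using lex_less_irrefl[of w] lex_less_trans[of w "w \<circ> inv q" w] by auto
    qed
    then have "w \<circ> inv q = w" using x by simp
    then have "inv q = id" using 2 lex_less_irrefl[of w] by auto
    then show ?thesis using r inv_inv_perm[OF qp] by simp
  qed
  have "descent_vector n w w = (\<Sum>r\<in>young n ?J. \<Sum>q\<in>young n ?D. if r = id \<and> q = id then 1 else 0)"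
    unfolding descent_vector_def rsum_def ksum_def delta_def
    by (intro sum.cong refl) (use only in \<open>auto simp: sign_id\<close>)
  also have "\<dots> = (\<Sum>r\<in>young n ?J. if r = id then (\<Sum>q\<in>young n ?D. if q = id then 1 else 0) else 0)"
    by (intro sum.cong) auto
  also have "\<dots> = 1"
    using id_in_young finite_young by simp
  finally show ?thesis .
qed

text \<open>Evaluation at the lexicographically largest word with nonzero coefficient leaves only
  its own term.\<close>

lemma descent_vectors_same_des_independent:
  assumes z: "\<And>u. u \<in> perms n \<Longrightarrow> (\<Sum>w | w \<in> perms n \<and> des n w = D. c w * descent_vector n w u) = 0"
    and w: "w \<in> perms n" "des n w = D"
  shows "c w = 0"
proof (rule ccontr)
  assume "c w \<noteq> 0"
  define A where "A = {w \<in> perms n. des n w = D \<and> c w \<noteq> 0}"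
  have A: "finite A" "A \<noteq> {}" using finite_perms w \<open>c w \<noteq> 0\<close> by (auto simp: A_def)
  obtain m where m: "m \<in> A" "\<And>x. x \<in> A \<Longrightarrow> \<not> lex_less m x"
    using lex_less_maximal[OF A] by metis
  have mp: "m \<in> perms n" "des n m = D" "c m \<noteq> 0" using m(1) by (auto simp: A_def)
  have "0 = (\<Sum>w | w \<in> perms n \<and> des n w = D. c w * descent_vector n w m)"
    using z[OF mp(1)] by simp
  also have "\<dots> = (\<Sum>w | w \<in> perms n \<and> des n w = D. if w = m then c m else 0)"
  proof (rule sum.cong[OF refl], clarify)
    fix w assume w: "w permutes {1..n}" "D = des n w"
    show "c w * descent_vector n w m = (if w = m then c m else 0)"
    proof (cases "w = m")
      case True
      then show ?thesis using descent_vector_self[OF mp(1)] by simp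
    next
      case False
      have "c w = 0 \<or> descent_vector n w m = 0"
        using descent_vector_leading[of w n m] w mp False m(2)[of w] by (auto simp: A_def)
      then show ?thesis using False by auto
    qed
  qed
  also have "\<dots> = c m" using mp finite_perms by simp
  finally show False using mp by simp
qed

lemma sum_by_des:
  "(\<Sum>D\<in>Pow {1..<n}. \<Sum>w | w \<in> perms n \<and> des n w = D. f w) = (\<Sum>w\<in>perms n. f w)"
proof -
  have "(\<Sum>D\<in>des n ` perms n. \<Sum>w | w \<in> perms n \<and> des n w = D. f w) = (\<Sum>w\<in>perms n. f w)"
    using sum.image_gen[OF finite_perms, of f n "des n"] by (simp add: Collect_conj_eq Int_commute)
  moreover have "(\<Sum>D\<in>des n ` perms n. \<Sum>w | w \<in> perms n \<and> des n w = D. f w) =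
    (\<Sum>D\<in>Pow {1..<n}. \<Sum>w | w \<in> perms n \<and> des n w = D. f w)"
  proof (rule sum.mono_neutral_left)
    show "des n ` perms n \<subseteq> Pow {1..<n}" using des_subset by auto
    show "\<forall>D\<in>Pow {1..<n} - des n ` perms n. (\<Sum>w | w \<in> perms n \<and> des n w = D. f w) = 0"
    proof
      fix D assume "D \<in> Pow {1..<n} - des n ` perms n"
      then have "{w. w \<in> perms n \<and> des n w = D} = {}" by blast
      then show "(\<Sum>w | w \<in> perms n \<and> des n w = D. f w) = 0" by (metis sum.empty)
    qed
  qed simp
  ultimately show ?thesis by simp
qed

lemma des_part_in_component:
  "in_component n D (\<lambda>u. \<Sum>w | w \<in> perms n \<and> des n w = D. c w * descent_vector n w u)"
  by (rule in_component_linear) (use descent_vector_in_component in auto)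

text \<open>Grouped by descent set, the combination is a sum of components, so
  \<open>components_vanish\<close> isolates each group and triangularity finishes. The upward closed
  family \<open>F\<close> has two uses: all sets give independence, and the sets meeting
  \<open>J\<close> give the coordinates of invariant functions.\<close>

lemma descent_vector_coefficients_vanish:
  assumes up: "\<And>E D. E \<in> F \<Longrightarrow> E \<subseteq> D \<Longrightarrow> D \<subseteq> {1..<n} \<Longrightarrow> D \<in> F" and F: "F \<subseteq> Pow {1..<n}"
    and k: "\<And>E u. E \<in> F \<Longrightarrow> u \<in> perms n \<Longrightarrow>
      ksum (young n E) (\<lambda>u. \<Sum>w\<in>perms n. c w * descent_vector n w u) u = 0"
    and w: "w \<in> perms n" "des n w \<in> F"
  shows "c w = 0"
proof (rule descent_vectors_same_des_independent[OF _ w(1) refl])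
  fix u assume u: "u \<in> perms n"
  let ?v = "\<lambda>D u. \<Sum>w | w \<in> perms n \<and> des n w = D. c w * descent_vector n w u"
  show "?v (des n w) u = 0"
  proof (rule components_vanish[of n ?v F, OF des_part_in_component up F _ w(2) u])
    fix E u assume "E \<in> F" "u \<in> perms n"
    then show "ksum (young n E) (\<lambda>u. \<Sum>D\<in>Pow {1..<n}. ?v D u) u = 0"
      unfolding sum_by_des by (rule k)
  qed
qed

section \<open>Frames and traces\<close>

lemma sum_fun_apply: "(\<Sum>a\<in>A. f a) x = (\<Sum>a\<in>A. f a x)"
  by (induction A rule: infinite_finite_induct) auto

text \<open>The vectors \<open>e i\<close> only have to span, with coefficient functionals \<open>l i\<close>; they need not be
  independent.\<close>

lemma frame_trace_unique:
  fixes V :: "('a \<Rightarrow> complex) set"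
  assumes e: "\<And>i. i \<in> I \<Longrightarrow> e i \<in> V" and e': "\<And>j. j \<in> J \<Longrightarrow> e' j \<in> V"
    and ex: "\<And>v. v \<in> V \<Longrightarrow> v = (\<lambda>x. \<Sum>i\<in>I. l i v * e i x)"
    and ex': "\<And>v. v \<in> V \<Longrightarrow> v = (\<lambda>x. \<Sum>j\<in>J. l' j v * e' j x)"
    and f: "\<And>v. v \<in> V \<Longrightarrow> f v \<in> V"
    and f_lin: "\<And>c. f (\<lambda>x. \<Sum>j\<in>J. c j * e' j x) = (\<lambda>x. \<Sum>j\<in>J. c j * f (e' j) x)"
    and l_lin: "\<And>i c. i \<in> I \<Longrightarrow> l i (\<lambda>x. \<Sum>j\<in>J. c j * f (e' j) x) = (\<Sum>j\<in>J. c j * l i (f (e' j)))"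
    and l'_lin: "\<And>j c. j \<in> J \<Longrightarrow> l' j (\<lambda>x. \<Sum>i\<in>I. c i * e i x) = (\<Sum>i\<in>I. c i * l' j (e i))"
  shows "(\<Sum>i\<in>I. l i (f (e i))) = (\<Sum>j\<in>J. l' j (f (e' j)))"
proof -
  \<comment> \<open>The argument is that of equal traces of \<open>A B\<close> and
    \<open>B A\<close>: expanding \<open>e i\<close> in the second family, and later
    \<open>f (e' j)\<close> in the first, leads to one double sum.\<close>
  have "(\<Sum>i\<in>I. l i (f (e i))) = (\<Sum>i\<in>I. \<Sum>j\<in>J. l' j (e i) * l i (f (e' j)))"
  proof (rule sum.cong[OF refl])
    fix i assume i: "i \<in> I"
    have "f (e i) = f (\<lambda>x. \<Sum>j\<in>J. l' j (e i) * e' j x)" using ex'[OF e[OF i]] by simp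
    also have "\<dots> = (\<lambda>x. \<Sum>j\<in>J. l' j (e i) * f (e' j) x)" by (rule f_lin)
    finally have fe: "f (e i) = (\<lambda>x. \<Sum>j\<in>J. l' j (e i) * f (e' j) x)" .
    show "l i (f (e i)) = (\<Sum>j\<in>J. l' j (e i) * l i (f (e' j)))"
      unfolding fe by (rule l_lin[OF i])
  qed
  also have "\<dots> = (\<Sum>j\<in>J. \<Sum>i\<in>I. l i (f (e' j)) * l' j (e i))"
    by (subst sum.swap) (simp add: mult.commute)
  also have "\<dots> = (\<Sum>j\<in>J. l' j (f (e' j)))"
  proof (rule sum.cong[OF refl])
    fix j assume j: "j \<in> J"
    have "l' j (f (e' j)) = l' j (\<lambda>x. \<Sum>i\<in>I. l i (f (e' j)) * e i x)"
      using ex[OF f[OF e'[OF j]]] by simp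
    then show "(\<Sum>i\<in>I. l i (f (e' j)) * l' j (e i)) = l' j (f (e' j))"
      unfolding l'_lin[OF j] by simp
  qed
  finally show ?thesis .
qed

lemma cfun_sum_eq: "(\<Sum>b\<in>B. (\<lambda>x. c b * g b x)) = (\<lambda>x. \<Sum>b\<in>B. c b * (g b x :: complex))"
  by (rule ext) (simp add: sum_fun_apply)

lemma cfun_subspace_sum:
  assumes "cfun.subspace V" "\<And>j. j \<in> J \<Longrightarrow> g j \<in> V"
  shows "(\<lambda>x. \<Sum>j\<in>J. c j * g j x) \<in> V"
  unfolding cfun_sum_eq[symmetric]
  by (intro cfun.subspace_sum[OF assms(1)] cfun.subspace_scale[OF assms(1)] assms(2))

lemma cfun_representation_sum:
  assumes B: "cfun.independent B" and g: "\<And>j. j \<in> J \<Longrightarrow> g j \<in> cfun.span B"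
  shows "cfun.representation B (\<lambda>x. \<Sum>j\<in>J. c j * g j x) b = (\<Sum>j\<in>J. c j * cfun.representation B (g j) b)"
proof -
  have "(\<lambda>x. c j * g j x) \<in> cfun.span B" if "j \<in> J" for j
    using cfun.span_scale[OF g[OF that]] .
  then show ?thesis
    unfolding cfun_sum_eq[symmetric] using g
    by (simp add: cfun.representation_sum[OF B] cfun.representation_scale[OF B])
qed

lemma cfun_representation_expand:
  assumes "cfun.independent B" "finite B" "v \<in> cfun.span B"
  shows "v = (\<lambda>x. \<Sum>b\<in>B. cfun.representation B v b * b x)"
proof -
  have "(\<Sum>b\<in>B. (\<lambda>x. cfun.representation B v b * b x)) = v"
    using assms by (intro cfun.sum_representation_eq) auto
  then show ?thesis by (simp only: cfun_sum_eq)
qed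

text \<open>The basis selected inside \<open>trace_on\<close> is itself such a family, with
  \<open>cfun.representation\<close> as functionals, so \<open>frame_trace_unique\<close> applies.
  Its elements serve as their own indices, which is why linearity is required for sums indexed by
  functions.\<close>

lemma trace_on_frame:
  fixes V :: "('a \<Rightarrow> complex) set"
  assumes V: "cfun.subspace V" and I: "finite I"
    and e: "\<And>i. i \<in> I \<Longrightarrow> e i \<in> V"
    and ex: "\<And>v. v \<in> V \<Longrightarrow> v = (\<lambda>x. \<Sum>i\<in>I. l i v * e i x)"
    and f: "\<And>v. v \<in> V \<Longrightarrow> f v \<in> V"
    and f_lin: "\<And>(J :: ('a \<Rightarrow> complex) set) c g. f (\<lambda>x. \<Sum>j\<in>J. c j * g j x) = (\<lambda>x. \<Sum>j\<in>J. c j * f (g j) x)"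
    and l_lin: "\<And>i (J :: ('a \<Rightarrow> complex) set) c g. i \<in> I \<Longrightarrow> (\<And>j. j \<in> J \<Longrightarrow> g j \<in> V) \<Longrightarrow>
      l i (\<lambda>x. \<Sum>j\<in>J. c j * g j x) = (\<Sum>j\<in>J. c j * l i (g j))"
  shows "trace_on V f = (\<Sum>i\<in>I. l i (f (e i)))"
proof -
  define B where "B = (SOME B. cfun.independent B \<and> cfun.span B = V)"
  have "\<exists>B. cfun.independent B \<and> cfun.span B = V"
  proof -
    obtain B where B: "B \<subseteq> V" "cfun.independent B" "V \<subseteq> cfun.span B"
      using cfun.maximal_independent_subset[of V] by metis
    then show ?thesis using cfun.span_minimal[OF B(1) V] by blast
  qed
  then have B: "cfun.independent B" "cfun.span B = V"
    unfolding B_def by (metis (mono_tags, lifting) someI_ex)+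
  have BV: "B \<subseteq> V" using cfun.span_superset[of B] B(2) by simp
  have "V \<subseteq> cfun.span (e ` I)"
  proof
    fix v assume "v \<in> V"
    then have "v = (\<Sum>i\<in>I. (\<lambda>x. l i v * e i x))" using ex by (simp only: cfun_sum_eq)
    moreover have "(\<Sum>i\<in>I. (\<lambda>x. l i v * e i x)) \<in> cfun.span (e ` I)"
      by (intro cfun.span_sum cfun.span_scale cfun.span_base) auto
    ultimately show "v \<in> cfun.span (e ` I)" by simp
  qed
  \<comment> \<open>An independent set in the span of a finite set is finite, whatever basis was
    selected.\<close>
  then have finB: "finite B"
    using cfun.independent_span_bound[of "e ` I" B] I B(1) BV by blast
  have "(\<Sum>i\<in>I. l i (f (e i))) = (\<Sum>b\<in>B. cfun.representation B (f b) b)"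
  proof (rule frame_trace_unique[where V = V and e = e and e' = "\<lambda>b. b" and l' = "\<lambda>b v. cfun.representation B v b"])
    show "v = (\<lambda>x. \<Sum>b\<in>B. cfun.representation B v b * b x)" if "v \<in> V" for v
      using cfun_representation_expand[OF B(1) finB, of v] that B(2) by simp
    show "cfun.representation B (\<lambda>x. \<Sum>i\<in>I. c i * e i x) b = (\<Sum>i\<in>I. c i * cfun.representation B (e i) b)" for b c
      using cfun_representation_sum[OF B(1), of I e c b] e B(2) by simp
    show "l i (\<lambda>x. \<Sum>b\<in>B. c b * f b x) = (\<Sum>b\<in>B. c b * l i (f b))" if "i \<in> I" for i c
      using l_lin[OF that, of B f c] f BV by blast
  qed (use e ex f f_lin BV in auto)
  then show ?thesis unfolding trace_on_def Let_def B_def by simp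
qed

section \<open>The basis of descent vectors and its coordinates\<close>

definition word_functions :: "nat \<Rightarrow> ((nat \<Rightarrow> nat) \<Rightarrow> complex) set" where
  "word_functions n = {v. \<forall>u. u \<notin> perms n \<longrightarrow> v u = 0}"

definition coord :: "nat \<Rightarrow> (nat \<Rightarrow> nat) \<Rightarrow> ((nat \<Rightarrow> nat) \<Rightarrow> complex) \<Rightarrow> complex" where
  "coord n w v = cfun.representation (descent_vector n ` perms n) v (descent_vector n w)"

lemma descent_vectors_independent:
  assumes z: "\<And>u. u \<in> perms n \<Longrightarrow> (\<Sum>w\<in>perms n. c w * descent_vector n w u) = 0" and w: "w \<in> perms n"
  shows "c w = 0"
proof (rule descent_vector_coefficients_vanish[where F = "Pow {1..<n}", OF _ _ _ w])
  fix E u assume u: "u \<in> perms n"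
  show "ksum (young n E) (\<lambda>u. \<Sum>w\<in>perms n. c w * descent_vector n w u) u = 0"
    unfolding ksum_def
  proof (intro sum.neutral ballI)
    fix q assume "q \<in> young n E"
    then have "u \<circ> q \<in> perms n" using u by (auto simp: young_def intro: permutes_compose)
    then show "of_int (sign q) * (\<Sum>w\<in>perms n. c w * descent_vector n w (u \<circ> q)) = 0"
      by (simp only: z mult_zero_right)
  qed
qed (use des_subset in auto)

lemma inj_on_descent_vector: "inj_on (descent_vector n) (perms n)"
proof (rule inj_onI, rule ccontr)
  fix x y assume xy: "x \<in> perms n" "y \<in> perms n" "descent_vector n x = descent_vector n y" "x \<noteq> y"
  define c where "c w = (if w = x then 1 else if w = y then -1 else 0 :: complex)" for w
  have "(\<Sum>w\<in>perms n. c w * descent_vector n w u) = 0" for u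
  proof -
    have "(\<Sum>w\<in>perms n. c w * descent_vector n w u) = (\<Sum>w\<in>{x, y}. c w * descent_vector n w u)"
      using xy finite_perms by (intro sum.mono_neutral_right) (auto simp: c_def)
    then show ?thesis using xy by (simp add: c_def)
  qed
  then have "c x = 0" by (rule descent_vectors_independent) (use xy in auto)
  then show False by (simp add: c_def)
qed

lemma independent_descent_vectors: "cfun.independent (descent_vector n ` perms n)"
proof
  assume "cfun.dependent (descent_vector n ` perms n)"
  then obtain c where c: "\<exists>v\<in>descent_vector n ` perms n. c v \<noteq> 0"
    "(\<Sum>v\<in>descent_vector n ` perms n. (\<lambda>x. c v * v x)) = 0"
    using cfun.dependent_finite[of "descent_vector n ` perms n"] finite_perms by auto
  have "(\<Sum>w\<in>perms n. c (descent_vector n w) * descent_vector n w u) = 0" for u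
    using fun_cong[OF c(2), of u] unfolding sum_fun_apply sum.reindex[OF inj_on_descent_vector]
    by (simp only: comp_apply zero_fun_apply)
  then have "c (descent_vector n w) = 0" if "w \<in> perms n" for w
    using descent_vectors_independent[of n "\<lambda>w. c (descent_vector n w)"] that by blast
  then show False using c(1) by blast
qed

lemma descent_vector_in_word_functions: "w \<in> perms n \<Longrightarrow> descent_vector n w \<in> word_functions n"
  using descent_vector_support by (auto simp: word_functions_def)

lemma word_functions_delta_expand:
  assumes "v \<in> word_functions n"
  shows "v = (\<lambda>x. \<Sum>w\<in>perms n. v w * delta w x)"
proof
  fix x
  have "(\<Sum>w\<in>perms n. v w * delta w x) = (\<Sum>w\<in>perms n. if w = x then v x else 0)"
    by (intro sum.cong) (auto simp: delta_def)
  then show "v x = (\<Sum>w\<in>perms n. v w * delta w x)"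
    using assms finite_perms by (simp add: word_functions_def)
qed

text \<open>By counting: the descent vectors are as many independent vectors as there are words, and
  they lie in the span of the indicator functions of words.\<close>

lemma word_functions_span: "word_functions n \<subseteq> cfun.span (descent_vector n ` perms n)"
proof -
  let ?B = "descent_vector n ` perms n" and ?T = "delta ` perms n"
  have T: "word_functions n \<subseteq> cfun.span ?T"
  proof
    fix v assume "v \<in> word_functions n"
    then have "v = (\<Sum>w\<in>perms n. (\<lambda>x. v w * delta w x))"
      using word_functions_delta_expand by (simp only: cfun_sum_eq)
    moreover have "(\<Sum>w\<in>perms n. (\<lambda>x. v w * delta w x)) \<in> cfun.span ?T"
      by (intro cfun.span_sum cfun.span_scale cfun.span_base) auto
    ultimately show "v \<in> cfun.span ?T" by simp
  qed
  moreover have "?B \<subseteq> word_functions n" using descent_vector_in_word_functions by auto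
  ultimately have BT: "?B \<subseteq> cfun.span ?T" by blast
  have finT: "finite ?T" using finite_perms by simp
  have card: "card ?T \<le> card ?B"
    using card_image_le[OF finite_perms, of delta n] card_image[OF inj_on_descent_vector, of n] by simp
  show ?thesis
  proof
    fix v assume v: "v \<in> word_functions n"
    show "v \<in> cfun.span ?B"
    proof (rule ccontr)
      assume nv: "v \<notin> cfun.span ?B"
      then have nB: "v \<notin> ?B" by (rule contrapos_nn) (rule cfun.span_base)
      have "cfun.independent (insert v ?B)"
        using cfun.independent_insert[of v ?B] nv nB independent_descent_vectors by simp
      moreover have "insert v ?B \<subseteq> cfun.span ?T" using v T BT by blast
      ultimately have "card (insert v ?B) \<le> card ?T"
        using cfun.independent_span_bound[OF finT] by blast
      moreover have "card (insert v ?B) = Suc (card ?B)"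
        using nB by (rule card_insert_disjoint[OF finite_imageI[OF finite_perms]])
      ultimately show False using card by simp
    qed
  qed
qed

lemma coord_expand:
  assumes "v \<in> word_functions n"
  shows "v = (\<lambda>u. \<Sum>w\<in>perms n. coord n w v * descent_vector n w u)"
proof -
  have fin: "finite (descent_vector n ` perms n)" using finite_perms by simp
  have "v \<in> cfun.span (descent_vector n ` perms n)" using assms word_functions_span by blast
  note * = cfun_representation_expand[OF independent_descent_vectors fin this]
  show ?thesis
    by (subst *) (simp only: sum.reindex[OF inj_on_descent_vector] comp_def coord_def)
qed

lemma coord_linear:
  assumes "\<And>j. j \<in> J \<Longrightarrow> g j \<in> word_functions n"
  shows "coord n w (\<lambda>x. \<Sum>j\<in>J. c j * g j x) = (\<Sum>j\<in>J. c j * coord n w (g j))"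
  unfolding coord_def
  by (intro cfun_representation_sum independent_descent_vectors)
    (use assms word_functions_span in blast)

text \<open>Subtracting \<open>v\<close> from the part of its expansion with descent set
  \<open>D\<close> gives a family of components with sum 0. All of them vanish, and for a descent
  set other than \<open>D\<close> the vanishing component is just the corresponding part of the
  expansion.\<close>

lemma coord_in_component:
  assumes v: "v \<in> word_functions n" "in_component n D v" and D: "D \<subseteq> {1..<n}"
    and w: "w \<in> perms n" "des n w \<noteq> D"
  shows "coord n w v = 0"
proof (rule descent_vectors_same_des_independent[OF _ w(1) refl])
  fix u assume u: "u \<in> perms n"
  let ?c = "\<lambda>w. coord n w v"
  let ?p = "\<lambda>E u. \<Sum>w | w \<in> perms n \<and> des n w = E. ?c w * descent_vector n w u"
  let ?v = "\<lambda>E u. ?p E u - (if E = D then v u else 0)"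
  have total: "(\<Sum>E\<in>Pow {1..<n}. ?v E u) = 0" for u
  proof -
    have "(\<Sum>E\<in>Pow {1..<n}. ?v E u) = (\<Sum>w\<in>perms n. ?c w * descent_vector n w u) - v u"
      unfolding sum_subtractf sum_by_des using D by simp
    then show ?thesis using fun_cong[OF coord_expand[OF v(1)], of u] by simp
  qed
  have "?v (des n w) u = 0"
  proof (rule components_vanish[of n ?v "Pow {1..<n}"])
    show "in_component n E (?v E)" for E
    proof (cases "E = D")
      case True
      then show ?thesis using in_component_diff[OF des_part_in_component v(2)] by simp
    next
      case False
      then show ?thesis using des_part_in_component by simp
    qed
    show "ksum (young n E) (\<lambda>u. \<Sum>D\<in>Pow {1..<n}. ?v D u) u = 0" for E u
      unfolding total by (simp add: ksum_def)
  qed (use des_subset u in auto)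
  then show "?p (des n w) u = 0" using w(2) by simp
qed

text \<open>The signed sum over \<open>E\<close> kills \<open>v\<close> as soon as \<open>E\<close>
  meets \<open>J\<close>, and the sets meeting \<open>J\<close> form an upward closed
  family.\<close>

lemma coord_invariant:
  assumes v: "v \<in> word_functions n"
    and inv: "\<And>u d. d \<in> J \<Longrightarrow> 1 \<le> d \<Longrightarrow> d < n \<Longrightarrow> u \<in> perms n \<Longrightarrow> v (u \<circ> transp d (Suc d)) = v u"
    and w: "w \<in> perms n" "des n w \<inter> J \<noteq> {}"
  shows "coord n w v = 0"
proof (rule descent_vector_coefficients_vanish[where F = "{E. E \<subseteq> {1..<n} \<and> E \<inter> J \<noteq> {}}", OF _ _ _ w(1)])
  fix E u assume E: "E \<in> {E. E \<subseteq> {1..<n} \<and> E \<inter> J \<noteq> {}}" and u: "u \<in> perms n"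
  then obtain d where d12: "d \<in> E" "d \<in> J" by blast
  then have "1 \<le> d" "d < n" using E by auto
  with d12 have d: "d \<in> E" "d \<in> J" "1 \<le> d" "d < n" by blast+
  have "ksum (young n E) v u = 0"
    by (rule ksum_of_invariant[OF d(1,3,4) _ u]) (rule inv[OF d(2-4)])
  then show "ksum (young n E) (\<lambda>u. \<Sum>w\<in>perms n. coord n w v * descent_vector n w u) u = 0"
    using coord_expand[OF v] by simp
qed (use w(2) des_subset in auto)

text \<open>The diagonal entry at \<open>w\<close> of left translation by \<open>p\<close> in the
  basis of descent vectors. Summed over the words with one descent set, it gives the trace on that
  component.\<close>

definition descent_trace :: "nat \<Rightarrow> (nat \<Rightarrow> nat) \<Rightarrow> (nat \<Rightarrow> nat) \<Rightarrow> complex" where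
  "descent_trace n p w = coord n w (\<lambda>u. descent_vector n w (inv p \<circ> u))"

lemma word_functions_translate:
  assumes "p permutes {1..n}" "v \<in> word_functions n"
  shows "(\<lambda>u. v (inv p \<circ> u)) \<in> word_functions n"
proof -
  have "inv p \<circ> u \<notin> perms n" if u: "u \<notin> perms n" for u
  proof
    assume "inv p \<circ> u \<in> perms n"
    then have "p \<circ> (inv p \<circ> u) \<in> perms n" using assms(1) by (auto intro: permutes_compose)
    then show False using u by (simp add: comp_assoc[symmetric] permutes_inv_o[OF assms(1)])
  qed
  then show ?thesis using assms(2) by (simp add: word_functions_def)
qed

text \<open>The trace of \<open>p\<close> on the functions invariant under the Young subgroup of
  \<open>J\<close>, computed from two families: the descent vectors with descents outside
  \<open>J\<close>, and the averaged indicator functions. The second computation counts the cosets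
  fixed by \<open>p\<close>, each once for every word in it.\<close>

lemma sum_descent_trace:
  assumes p: "p permutes {1..n}" and J: "J \<subseteq> {1..<n}"
  shows "(\<Sum>w | w \<in> perms n \<and> des n w \<inter> J = {}. descent_trace n p w) =
    (\<Sum>w\<in>perms n. \<Sum>r\<in>young n J. if inv p \<circ> w \<circ> r = w then 1 else 0) / of_nat (card (young n J))"
proof -
  define Y where "Y = young n J"
  define N where "N = (of_nat (card Y) :: complex)"
  have "card Y \<noteq> 0" using finite_young[of n J] id_in_young[of n J] by (auto simp: Y_def)
  then have N: "N \<noteq> 0" by (simp add: N_def)
  define V where "V = {v \<in> word_functions n. \<forall>r\<in>Y. \<forall>u. v (u \<circ> r) = v u}"
  \<comment> \<open>Words in the same coset give the same vector. With evaluation at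
    \<open>w\<close> as coefficient functional, each coset is counted \<open>N\<close> times, for
    which the division by \<open>N\<close> compensates.\<close>
  define e' where "e' w = (\<lambda>u. rsum Y (delta w) u / N)" for w
  define I where "I = {w. w \<in> perms n \<and> des n w \<inter> J = {}}"
  have bV: "descent_vector n w \<in> V" if "w \<in> I" for w
  proof -
    have w: "w \<in> perms n" "des n w \<inter> J = {}" using that by (auto simp: I_def)
    have "descent_vector n w (u \<circ> r) = descent_vector n w u" if r: "r \<in> Y" for r u
    proof -
      have "J \<subseteq> {1..<n} - des n w" using w J by auto
      then have "r \<in> young n ({1..<n} - des n w)" using r young_mono unfolding Y_def by blast
      then show ?thesis unfolding descent_vector_def by (rule rsum_invariant)
    qed
    then show ?thesis using descent_vector_in_word_functions[OF w(1)] by (simp add: V_def)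
  qed
  have e'V: "e' w \<in> V" if "w \<in> perms n" for w
  proof -
    have "rsum Y (delta w) u = 0" if "u \<notin> perms n" for u
      unfolding rsum_def
    proof (intro sum.neutral ballI)
      fix r assume "r \<in> Y"
      then have "u \<circ> r \<notin> perms n" using comp_right_perm_iff[of r n u] that by (auto simp: Y_def young_def)
      then show "delta w (u \<circ> r) = 0" using \<open>w \<in> perms n\<close> by (auto simp: delta_def)
    qed
    then show ?thesis
      by (auto simp: V_def e'_def word_functions_def Y_def rsum_invariant)
  qed
  have exI: "v = (\<lambda>x. \<Sum>w\<in>I. coord n w v * descent_vector n w x)" if v: "v \<in> V" for v
  proof -
    have vw: "v \<in> word_functions n" using v by (simp add: V_def)
    have z: "coord n w v = 0" if "w \<in> perms n - I" for w
    proof (rule coord_invariant[OF vw, of J])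
      fix u d assume "d \<in> J" "1 \<le> d" "d < n"
      then have "transp d (Suc d) \<in> Y" unfolding Y_def by (rule transp_in_young)
      then show "v (u \<circ> transp d (Suc d)) = v u" using v by (simp add: V_def)
    qed (use that in \<open>auto simp: I_def\<close>)
    have "(\<Sum>w\<in>perms n. coord n w v * descent_vector n w x) = (\<Sum>w\<in>I. coord n w v * descent_vector n w x)" for x
      using finite_perms z by (intro sum.mono_neutral_right) (auto simp: I_def)
    then show ?thesis using coord_expand[OF vw] by simp
  qed
  have exP: "v = (\<lambda>x. \<Sum>w\<in>perms n. v w * e' w x)" if v: "v \<in> V" for v
  proof
    fix x
    have vw: "v \<in> word_functions n" using v by (simp add: V_def)
    have "(\<Sum>w\<in>perms n. v w * e' w x) = (\<Sum>w\<in>perms n. v w * rsum Y (delta w) x) / N"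
      by (simp add: e'_def sum_divide_distrib)
    also have "(\<Sum>w\<in>perms n. v w * rsum Y (delta w) x) = rsum Y (\<lambda>u. \<Sum>w\<in>perms n. v w * delta w u) x"
      by (rule rsum_linear[symmetric])
    also have "(\<lambda>u. \<Sum>w\<in>perms n. v w * delta w u) = v"
      using word_functions_delta_expand[OF vw] by simp
    also have "rsum Y v x = N * v x"
      unfolding Y_def N_def by (rule rsum_of_invariant) (use v in \<open>simp add: V_def Y_def\<close>)
    finally show "v x = (\<Sum>w\<in>perms n. v w * e' w x)" using N by simp
  qed
  have "(\<Sum>w\<in>I. coord n w (\<lambda>u. descent_vector n w (inv p \<circ> u))) = (\<Sum>w\<in>perms n. e' w (inv p \<circ> w))"
  proof (rule frame_trace_unique[where V = V and f = "\<lambda>v u. v (inv p \<circ> u)" and e = "descent_vector n"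
        and e' = e' and l = "coord n" and l' = "\<lambda>w v. v w"])
    show "(\<lambda>u. v (inv p \<circ> u)) \<in> V" if "v \<in> V" for v
    proof -
      have "v \<in> word_functions n" "\<And>r u. r \<in> Y \<Longrightarrow> v (inv p \<circ> u \<circ> r) = v (inv p \<circ> u)"
        using that by (auto simp: V_def)
      then show ?thesis using word_functions_translate[OF p] by (simp add: V_def comp_assoc)
    qed
    show "coord n i (\<lambda>x. \<Sum>j\<in>perms n. c j * e' j (inv p \<circ> x)) =
      (\<Sum>j\<in>perms n. c j * coord n i (\<lambda>u. e' j (inv p \<circ> u)))" for i c
      by (rule coord_linear) (use word_functions_translate[OF p] e'V in \<open>auto simp: V_def\<close>)
  qed (use bV e'V exI exP in auto)
  also have "\<dots> = (\<Sum>w\<in>perms n. \<Sum>r\<in>Y. if inv p \<circ> w \<circ> r = w then 1 else 0) / N"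
    by (simp add: e'_def rsum_def delta_def sum_divide_distrib)
  finally show ?thesis by (simp add: I_def descent_trace_def Y_def N_def)
qed

section \<open>Colourings\<close>

text \<open>There are \<open>k + 1\<close> colours, matching the exponent base in
  \<open>cyc_power n (k + 1)\<close>. Extensionality makes a colouring determined by its values on
  \<open>{1..n}\<close>.\<close>

definition colourings :: "nat \<Rightarrow> nat \<Rightarrow> (nat \<Rightarrow> nat) set" where
  "colourings n k = {1..n} \<rightarrow>\<^sub>E {..k}"

definition increasing_colourings :: "nat \<Rightarrow> nat \<Rightarrow> (nat \<Rightarrow> nat) set" where
  "increasing_colourings n k = {g \<in> colourings n k. \<forall>d\<in>{1..<n}. g d \<le> g (Suc d)}"

definition plateaus :: "nat \<Rightarrow> (nat \<Rightarrow> nat) \<Rightarrow> nat set" where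
  "plateaus n g = {d\<in>{1..<n}. g d = g (Suc d)}"

lemma finite_colourings: "finite (colourings n k)"
  unfolding colourings_def by (intro finite_PiE) auto

text \<open>A fixed colouring is constant along cycles, so it amounts to a free choice of one colour
  per orbit.\<close>

lemma card_fixed_colourings:
  assumes p: "p permutes {1..n}"
  shows "card {f \<in> colourings n k. \<forall>j\<in>{1..n}. f (p j) = f j} = Suc k ^ num_cycles n p"
proof -
  have perm: "permutation p" using p by (rule permutes_imp_permutation[rotated]) simp
  let ?O = "orbit p ` {1..n}"
  have self: "j \<in> orbit p j" for j using perm by (rule permutation_self_in_orbit)
  have const: "f c = f j" if f: "\<forall>j\<in>{1..n}. f (p j) = f j" and j: "j \<in> {1..n}" and c: "c \<in> orbit p j"
    for f :: "nat \<Rightarrow> nat" and j c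
    using c
  proof induction
    case base
    then show ?case using f j by simp
  next
    case (step c)
    then have "c \<in> {1..n}" using permutes_orbit_subset[OF p j] by blast
    then show ?case using step f by simp
  qed
  have "bij_betw (\<lambda>h. \<lambda>j\<in>{1..n}. h (orbit p j)) (?O \<rightarrow>\<^sub>E {..k}) {f \<in> colourings n k. \<forall>j\<in>{1..n}. f (p j) = f j}"
  proof (rule bij_betw_byWitness[where f' = "\<lambda>f. \<lambda>Q\<in>?O. f (SOME j. j \<in> Q)"])
    have some: "(SOME j. j \<in> orbit p i) \<in> orbit p i" for i
      using self by (rule someI)
    have some': "orbit p (SOME j. j \<in> orbit p i) = orbit p i" for i
      using orbit_cyclic_eq3[OF cyclic_on_orbit'[OF perm] some] .
    have range: "(SOME j. j \<in> orbit p i) \<in> {1..n}" if "i \<in> {1..n}" for i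
      using some permutes_orbit_subset[OF p that] by blast
    show "\<forall>h\<in>?O \<rightarrow>\<^sub>E {..k}. (\<lambda>Q\<in>?O. (\<lambda>j\<in>{1..n}. h (orbit p j)) (SOME j. j \<in> Q)) = h"
    proof (intro ballI ext)
      fix h Q assume h: "h \<in> ?O \<rightarrow>\<^sub>E {..k}"
      show "(\<lambda>Q\<in>?O. (\<lambda>j\<in>{1..n}. h (orbit p j)) (SOME j. j \<in> Q)) Q = h Q"
      proof (cases "Q \<in> ?O")
        case True
        then obtain i where i: "i \<in> {1..n}" "Q = orbit p i" by blast
        then show ?thesis using range[OF i(1)] some'[of i] by (simp add: restrict_def)
      next
        case False
        then show ?thesis using h by (auto simp: PiE_def extensional_def)
      qed
    qed
    show "\<forall>f\<in>{f \<in> colourings n k. \<forall>j\<in>{1..n}. f (p j) = f j}.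
       (\<lambda>j\<in>{1..n}. (\<lambda>Q\<in>?O. f (SOME j. j \<in> Q)) (orbit p j)) = f"
    proof (intro ballI ext)
      fix f j assume f: "f \<in> {f \<in> colourings n k. \<forall>j\<in>{1..n}. f (p j) = f j}"
      show "(\<lambda>j\<in>{1..n}. (\<lambda>Q\<in>?O. f (SOME j. j \<in> Q)) (orbit p j)) j = f j"
      proof (cases "j \<in> {1..n}")
        case True
        have fx: "\<forall>j\<in>{1..n}. f (p j) = f j" using f by blast
        have "f (SOME i. i \<in> orbit p j) = f j" by (rule const[OF fx True some])
        then show ?thesis using True by simp
      next
        case False
        then have "f j = undefined" using f by (auto simp: colourings_def PiE_def extensional_def)
        then show ?thesis using False by (simp add: restrict_def del: atLeastAtMost_iff)
      qed
    qed
    show "(\<lambda>h. \<lambda>j\<in>{1..n}. h (orbit p j)) ` (?O \<rightarrow>\<^sub>E {..k}) \<subseteq> {f \<in> colourings n k. \<forall>j\<in>{1..n}. f (p j) = f j}"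
    proof (rule image_subsetI, rule CollectI, intro conjI ballI)
      fix h assume h: "h \<in> ?O \<rightarrow>\<^sub>E {..k}"
      show "(\<lambda>j\<in>{1..n}. h (orbit p j)) \<in> colourings n k"
        using h by (auto simp: colourings_def)
      fix j assume j: "j \<in> {1..n}"
      then have "p j \<in> {1..n}" using p permutes_in_image by metis
      then show "(\<lambda>j\<in>{1..n}. h (orbit p j)) (p j) = (\<lambda>j\<in>{1..n}. h (orbit p j)) j"
        using j permutation_orbit_step[OF perm, of j] by simp
    qed
    show "(\<lambda>f. \<lambda>Q\<in>?O. f (SOME j. j \<in> Q)) ` {f \<in> colourings n k. \<forall>j\<in>{1..n}. f (p j) = f j} \<subseteq> ?O \<rightarrow>\<^sub>E {..k}"
    proof (rule image_subsetI, rule restrict_PiE_iff[THEN iffD2], rule ballI)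
      fix f Q assume f: "f \<in> {f \<in> colourings n k. \<forall>j\<in>{1..n}. f (p j) = f j}" and "Q \<in> ?O"
      then obtain i where i: "i \<in> {1..n}" "Q = orbit p i" by blast
      then show "f (SOME j. j \<in> Q) \<in> {..k}" using f range[OF i(1)] by (auto simp: colourings_def PiE_def Pi_def)
    qed
  qed
  then have "card {f \<in> colourings n k. \<forall>j\<in>{1..n}. f (p j) = f j} = card (?O \<rightarrow>\<^sub>E {..k})"
    by (rule bij_betw_same_card[symmetric])
  also have "\<dots> = Suc k ^ card ?O" by (simp add: card_PiE)
  finally show ?thesis by (simp add: num_cycles_def)
qed

section \<open>Weakly increasing colourings and the sorting of colourings\<close>

lemma increasing_chain:
  fixes g :: "nat \<Rightarrow> nat"
  assumes "\<And>d. d \<in> {i..<j} \<Longrightarrow> g d \<le> g (Suc d)" "i \<le> j"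
  shows "g i \<le> g j"
  using assms(2,1) by (induction j rule: dec_induct) (auto intro: order_trans)

lemma increasing_colouring_eq_iff:
  assumes g: "g \<in> increasing_colourings n k" and ab: "1 \<le> a" "a \<le> b" "b \<le> n"
  shows "g a = g b \<longleftrightarrow> {a..<b} \<subseteq> plateaus n g"
proof
  have inc: "g d \<le> g (Suc d)" if "d \<in> {a..<b}" for d
    using g that ab by (auto simp: increasing_colourings_def)
  assume eq: "g a = g b"
  show "{a..<b} \<subseteq> plateaus n g"
  proof
    fix d assume d: "d \<in> {a..<b}"
    have "g a \<le> g d" by (rule increasing_chain) (use d inc in auto)
    moreover have "g (Suc d) \<le> g b" by (rule increasing_chain) (use d inc in auto)
    ultimately have "g d = g (Suc d)" using eq inc[OF d] by simp
    then show "d \<in> plateaus n g" using d ab by (auto simp: plateaus_def)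
  qed
next
  assume "{a..<b} \<subseteq> plateaus n g"
  then have eq: "g d = g (Suc d)" if "d \<in> {a..<b}" for d using that by (auto simp: plateaus_def)
  have "d \<le> b \<longrightarrow> g a = g d" if "a \<le> d" for d
    using that
  proof (induction d rule: dec_induct)
    case (step d)
    then show ?case using eq[of d] by auto
  qed simp
  then show "g a = g b" using ab by blast
qed

text \<open>A weakly increasing colouring takes equal values at two positions exactly if all steps
  between them are plateaus, that is, if the positions share a block. So its stabilizer is a Young
  subgroup.\<close>

lemma young_plateaus_iff:
  assumes g: "g \<in> increasing_colourings n k" and q: "q permutes {1..n}"
  shows "q \<in> young n (plateaus n g) \<longleftrightarrow> (\<forall>j\<in>{1..n}. g (q j) = g j)"
proof -
  have iff: "g (q j) = g j \<longleftrightarrow> block_index (plateaus n g) (q j) = block_index (plateaus n g) j"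
    if j: "j \<in> {1..n}" for j
  proof -
    have qj: "q j \<in> {1..n}" using q j permutes_in_image by metis
    show ?thesis
    proof (cases "j \<le> q j")
      case True
      then show ?thesis
        using increasing_colouring_eq_iff[OF g, of j "q j"] block_index_eq_iff[of j "q j" "plateaus n g"] j qj
        by auto
    next
      case False
      then show ?thesis
        using increasing_colouring_eq_iff[OF g, of "q j" j] block_index_eq_iff[of "q j" j "plateaus n g"] j qj
        by auto
    qed
  qed
  have "q j = j" if "j \<notin> {1..n}" for j using q that by (auto simp: permutes_def)
  then show ?thesis using iff q unfolding young_def mem_Collect_eq by metis
qed

text \<open>Take the arrangement that is lexicographically maximal after reversing the colours:
  swapping neighbours in the wrong order would increase it. Reversal by \<open>k - f (w j)\<close>
  is faithful because the colours are at most \<open>k\<close>.\<close>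

lemma sorting_permutation_exists:
  assumes f: "f \<in> colourings n k"
  obtains w where "w \<in> perms n" "\<And>d. d \<in> {1..<n} \<Longrightarrow> f (w d) \<le> f (w (Suc d))"
proof -
  define h where "h w = (\<lambda>j. k - f (w j))" for w :: "nat \<Rightarrow> nat"
  have A: "finite (h ` perms n)" "h ` perms n \<noteq> {}"
    using finite_perms permutes_id by (blast intro: finite_imageI)+
  obtain m where m: "m \<in> h ` perms n" "\<And>x. x \<in> h ` perms n \<Longrightarrow> \<not> lex_less m x"
    using lex_less_maximal[OF A] by metis
  obtain w where w: "w \<in> perms n" "m = h w" using m(1) by blast
  have "f (w d) \<le> f (w (Suc d))" if d: "d \<in> {1..<n}" for d
  proof (rule ccontr)
    assume gt: "\<not> f (w d) \<le> f (w (Suc d))"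
    let ?w = "w \<circ> transp d (Suc d)"
    have "transp d (Suc d) permutes {1..n}" using d by (intro permutes_swap_id) auto
    then have "?w \<in> perms n" using w by (auto intro: permutes_compose)
    moreover have "lex_less (h w) (h ?w)"
    proof -
      have "w d \<in> {1..n}" using w(1) d permutes_in_image[of w "{1..n}" d] by auto
      then have "f (w d) \<le> k" using f by (auto simp: colourings_def)
      then have "h w d < h ?w d" using gt by (simp add: h_def)
      then show ?thesis unfolding lex_less_def by (intro exI[of _ d]) (auto simp: h_def)
    qed
    ultimately show False using m(2) w(2) by blast
  qed
  then show ?thesis using that w(1) by blast
qed

text \<open>Both arrangements are sorted lists with the same multiset of colours.\<close>

lemma sorted_arrangement_unique:
  fixes f :: "nat \<Rightarrow> nat"
  assumes w: "w \<in> perms n" "\<And>d. d \<in> {1..<n} \<Longrightarrow> f (w d) \<le> f (w (Suc d))"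
    and w': "w' \<in> perms n" "\<And>d. d \<in> {1..<n} \<Longrightarrow> f (w' d) \<le> f (w' (Suc d))"
    and j: "j \<in> {1..n}"
  shows "f (w j) = f (w' j)"
proof -
  let ?l = "\<lambda>w. map (\<lambda>j. f (w j)) [1..<Suc n]"
  have sorted: "sorted (?l w)" if "\<And>d. d \<in> {1..<n} \<Longrightarrow> f (w d) \<le> f (w (Suc d))" for w :: "nat \<Rightarrow> nat"
    unfolding sorted_iff_nth_mono
  proof (intro allI impI)
    fix a b assume ab: "a \<le> b" "b < length (?l w)"
    have "(\<lambda>j. f (w j)) (Suc a) \<le> (\<lambda>j. f (w j)) (Suc b)"
      by (rule increasing_chain) (use ab that in \<open>auto simp del: upt_Suc\<close>)
    then show "?l w ! a \<le> ?l w ! b" using ab by (simp add: nth_append del: upt_Suc)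
  qed
  have mset: "mset (?l w) = image_mset f (mset_set {1..n})" if "w \<in> perms n" for w
  proof -
    have wp: "w permutes {1..n}" using that by simp
    have "mset (?l w) = image_mset f (image_mset w (mset_set {1..n}))"
      by (simp add: image_mset.compositionality comp_def atLeastLessThanSuc_atLeastAtMost del: upt_Suc)
    also have "image_mset w (mset_set {1..n}) = mset_set (w ` {1..n})"
      by (rule image_mset_mset_set[OF permutes_inj_on[OF wp]])
    finally show ?thesis using permutes_image[OF wp] by simp
  qed
  have "mset (?l w) = mset (?l w')" using mset[OF w(1)] mset[OF w'(1)] by simp
  then have "?l w = ?l w'"
    using sorted[of w, OF w(2)] sorted[of w', OF w'(2)] properties_for_sort by metis
  then have "\<forall>j\<in>set [1..<Suc n]. f (w j) = f (w' j)" by (simp only: map_eq_conv)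
  then show ?thesis using j by (simp del: upt_Suc)
qed

text \<open>Sorting \<open>f\<close> yields exactly one increasing \<open>g\<close>, and the words
  that sort \<open>f\<close> form one coset of the stabilizer of \<open>g\<close>. The weight is the
  reciprocal of the number of these words, so every colouring is counted once.\<close>

lemma arrangements_weight:
  assumes f: "f \<in> colourings n k"
  shows "(\<Sum>g\<in>increasing_colourings n k. \<Sum>w\<in>perms n.
     (if \<forall>j\<in>{1..n}. f (w j) = g j then 1 else 0) / of_nat (card (young n (plateaus n g)))) = (1 :: complex)"
proof -
  obtain w0 where w0: "w0 \<in> perms n" "\<And>d. d \<in> {1..<n} \<Longrightarrow> f (w0 d) \<le> f (w0 (Suc d))"
    using sorting_permutation_exists[OF f] by metis
  have w0p: "w0 permutes {1..n}" using w0 by simp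
  define g0 where "g0 = (\<lambda>j\<in>{1..n}. f (w0 j))"
  have g0: "g0 j = f (w0 j)" if "j \<in> {1..n}" for j using that by (simp add: g0_def)
  have "w0 j \<in> {1..n}" if "j \<in> {1..n}" for j using that permutes_in_image[OF w0p] by blast
  then have g0c: "g0 \<in> colourings n k" using f unfolding colourings_def g0_def by (auto simp: PiE_iff)
  have g0i: "g0 \<in> increasing_colourings n k"
    using g0c w0(2) by (auto simp: increasing_colourings_def g0)
  let ?Y = "young n (plateaus n g0)"
  have other: "(if \<forall>j\<in>{1..n}. f (w j) = g j then 1 else 0) = (0::complex)"
    if g: "g \<in> increasing_colourings n k - {g0}" and w: "w \<in> perms n" for g w
  proof -
    have "g = g0" if e: "\<forall>j\<in>{1..n}. f (w j) = g j"
    proof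
      fix j
      show "g j = g0 j"
      proof (cases "j \<in> {1..n}")
        case True
        have "f (w d) \<le> f (w (Suc d))" if "d \<in> {1..<n}" for d
          using e g that by (auto simp: increasing_colourings_def)
        from sorted_arrangement_unique[of w n f w0, OF w this w0 True] show ?thesis using e True g0 by simp
      next
        case False
        then have "g j = undefined" "g0 j = undefined"
          using g g0c unfolding increasing_colourings_def colourings_def PiE_def extensional_def by blast+
        then show ?thesis by simp
      qed
    qed
    then show ?thesis using g by auto
  qed
  have "bij_betw (\<lambda>q. w0 \<circ> q) ?Y {w \<in> perms n. \<forall>j\<in>{1..n}. f (w j) = g0 j}"
  proof (rule bij_betw_byWitness[where f' = "\<lambda>w. inv w0 \<circ> w"])
    show "\<forall>q\<in>?Y. inv w0 \<circ> (w0 \<circ> q) = q" "\<forall>w\<in>{w \<in> perms n. \<forall>j\<in>{1..n}. f (w j) = g0 j}. w0 \<circ> (inv w0 \<circ> w) = w"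
      by (simp_all add: comp_assoc[symmetric] permutes_inv_o[OF w0p])
    show "(\<lambda>q. w0 \<circ> q) ` ?Y \<subseteq> {w \<in> perms n. \<forall>j\<in>{1..n}. f (w j) = g0 j}"
    proof (rule image_subsetI)
      fix q assume q: "q \<in> ?Y"
      then have qp: "q permutes {1..n}" by (simp add: young_def)
      have "f (w0 (q j)) = g0 j" if "j \<in> {1..n}" for j
      proof -
        have "q j \<in> {1..n}" using that qp permutes_in_image by metis
        then show ?thesis using q young_plateaus_iff[OF g0i qp] that g0 by metis
      qed
      then show "w0 \<circ> q \<in> {w \<in> perms n. \<forall>j\<in>{1..n}. f (w j) = g0 j}"
        using w0p qp by (auto intro: permutes_compose)
    qed
    show "(\<lambda>w. inv w0 \<circ> w) ` {w \<in> perms n. \<forall>j\<in>{1..n}. f (w j) = g0 j} \<subseteq> ?Y"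
    proof (rule image_subsetI)
      fix w assume w: "w \<in> {w \<in> perms n. \<forall>j\<in>{1..n}. f (w j) = g0 j}"
      then have wp: "w permutes {1..n}" by simp
      then have qp: "inv w0 \<circ> w permutes {1..n}" using permutes_inv[OF w0p] by (rule permutes_compose)
      have "g0 ((inv w0 \<circ> w) j) = g0 j" if j: "j \<in> {1..n}" for j
      proof -
        have "(inv w0 \<circ> w) j \<in> {1..n}" using j qp permutes_in_image by metis
        then have "g0 ((inv w0 \<circ> w) j) = f (w j)"
          using g0 permutes_inverses(1)[OF w0p] by simp
        then show ?thesis using w j by simp
      qed
      then show "inv w0 \<circ> w \<in> ?Y" using young_plateaus_iff[OF g0i qp] by blast
    qed
  qed
  then have card: "card {w \<in> perms n. \<forall>j\<in>{1..n}. f (w j) = g0 j} = card ?Y"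
    by (rule bij_betw_same_card[symmetric])
  have pos: "card ?Y \<noteq> 0" using finite_young[of n "plateaus n g0"] id_in_young[of n "plateaus n g0"] by auto
  have fin: "finite (increasing_colourings n k)"
    unfolding increasing_colourings_def using finite_colourings by simp
  have "(\<Sum>g\<in>increasing_colourings n k. \<Sum>w\<in>perms n.
     (if \<forall>j\<in>{1..n}. f (w j) = g j then 1 else 0) / of_nat (card (young n (plateaus n g)))) =
     (\<Sum>w\<in>perms n. (if \<forall>j\<in>{1..n}. f (w j) = g0 j then 1 else 0) / (of_nat (card ?Y) :: complex)) +
     (\<Sum>g\<in>increasing_colourings n k - {g0}. \<Sum>w\<in>perms n.
     (if \<forall>j\<in>{1..n}. f (w j) = g j then 1 else 0) / of_nat (card (young n (plateaus n g))))"
    by (rule sum.remove[OF fin g0i])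
  also have "(\<Sum>g\<in>increasing_colourings n k - {g0}. \<Sum>w\<in>perms n.
     (if \<forall>j\<in>{1..n}. f (w j) = g j then 1 else 0) / (of_nat (card (young n (plateaus n g))) :: complex)) = 0"
    by (intro sum.neutral ballI) (simp only: other div_0)
  also have "(\<Sum>w\<in>perms n. (if \<forall>j\<in>{1..n}. f (w j) = g0 j then 1 else 0) / (of_nat (card ?Y) :: complex)) =
     of_nat (card {w \<in> perms n. \<forall>j\<in>{1..n}. f (w j) = g0 j}) / of_nat (card ?Y)"
    unfolding sum_divide_distrib[symmetric] sum.inter_filter[OF finite_perms, symmetric] by simp
  finally show ?thesis using card pos by simp
qed

section \<open>Counting increasing colourings with prescribed strict steps\<close>

lemma block_index_Suc:
  "1 \<le> d \<Longrightarrow> block_index D (Suc d) = (if d \<in> D then block_index D d else Suc (block_index D d))"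
proof -
  assume "1 \<le> d"
  then have "{1..<Suc d} - D = (if d \<in> D then {1..<d} - D else insert d ({1..<d} - D))"
    by (auto simp: less_Suc_eq)
  then show ?thesis by (simp add: block_index_def)
qed

lemma block_index_le: "block_index D j \<le> j - 1"
  unfolding block_index_def using card_mono[of "{1..<j}" "{1..<j} - D"] by simp

text \<open>Adding \<open>block_index D\<close> raises the colouring by one at each step outside
  \<open>D\<close>, which makes all steps strict; at steps in \<open>D\<close> it is strict already.
  The result is an \<open>n\<close>-element set of numbers up to
  \<open>k + (n - 1 - card D)\<close>, and every such set arises.\<close>

lemma card_increasing_colourings:
  assumes n: "n \<ge> 1" and D: "D \<subseteq> {1..<n}"
  shows "card {g \<in> increasing_colourings n k. D \<inter> plateaus n g = {}} = (n + k - card D) choose n"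
proof -
  let ?G = "{g \<in> increasing_colourings n k. D \<inter> plateaus n g = {}}"
  define m where "m = n + k - card D"
  define b where "b = block_index D"
  define \<phi> where "\<phi> g = (\<lambda>j. g j + b j) ` {1..n}" for g :: "nat \<Rightarrow> nat"
  have finD: "finite D" using D finite_subset by blast
  have bn: "b n = n - 1 - card D"
    using D finD by (simp add: b_def block_index_def card_Diff_subset)
  have cD: "card D \<le> n - 1" using card_mono[OF _ D] by simp
  have step: "g d + b d < g (Suc d) + b (Suc d)" if g: "g \<in> ?G" and d: "d \<in> {1..<n}" for g d
  proof -
    have "g d \<le> g (Suc d)" using g d by (auto simp: increasing_colourings_def)
    moreover have "g d \<noteq> g (Suc d)" if "d \<in> D" using g d that by (auto simp: plateaus_def)
    ultimately show ?thesis using d block_index_Suc[of d D] by (auto simp: b_def)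
  qed
  have lists: "sorted_wrt (<) (map (\<lambda>j. g j + b j) [1..<Suc n])" if g: "g \<in> ?G" for g
    unfolding sorted_wrt_iff_nth_less
  proof (intro allI impI)
    fix i j assume ij: "i < j" "j < length (map (\<lambda>j. g j + b j) [1..<Suc n])"
    have "(\<lambda>j. g j + b j) (Suc i) < (\<lambda>j. g j + b j) (Suc j)"
      by (rule chain_less) (use ij step[OF g] in \<open>auto simp del: upt_Suc\<close>)
    then show "map (\<lambda>j. g j + b j) [1..<Suc n] ! i < map (\<lambda>j. g j + b j) [1..<Suc n] ! j"
      using ij by (simp del: upt_Suc)
  qed
  have set_list: "set (map (\<lambda>j. g j + b j) [1..<Suc n]) = \<phi> g" for g
    by (simp add: \<phi>_def atLeastLessThanSuc_atLeastAtMost del: upt_Suc)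
  have inj: "inj_on \<phi> ?G"
  proof (rule inj_onI)
    fix g g' assume g: "g \<in> ?G" and g': "g' \<in> ?G" and eq: "\<phi> g = \<phi> g'"
    have "map (\<lambda>j. g j + b j) [1..<Suc n] = map (\<lambda>j. g' j + b j) [1..<Suc n]"
      using strict_sorted_equal[OF lists[OF g] lists[OF g']] eq by (simp only: set_list)
    then have e: "g j = g' j" if "j \<in> {1..n}" for j
      using that by (auto simp del: upt_Suc)
    show "g = g'"
    proof
      fix j
      show "g j = g' j"
      proof (cases "j \<in> {1..n}")
        case False
        then have "g j = undefined" "g' j = undefined"
          using g g' unfolding increasing_colourings_def colourings_def PiE_def extensional_def by blast+
        then show ?thesis by simp
      qed (rule e)
    qed
  qed
  have sub: "\<phi> g \<in> {S. S \<subseteq> {..<m} \<and> card S = n}" if g: "g \<in> ?G" for g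
  proof -
    have "distinct (map (\<lambda>j. g j + b j) [1..<Suc n])"
      using lists[OF g] by (simp add: strict_sorted_iff del: upt_Suc)
    then have "card (\<phi> g) = n"
      using distinct_card[of "map (\<lambda>j. g j + b j) [1..<Suc n]"] set_list[of g] by (simp del: upt_Suc)
    moreover have "g j + b j < m" if j: "j \<in> {1..n}" for j
    proof -
      have "g j + b j \<le> g n + b n"
        by (rule increasing_chain[of j n "\<lambda>j. g j + b j"]) (use j step[OF g] in \<open>auto intro: less_imp_le\<close>)
      moreover have "g n \<le> k" using g n by (auto simp: increasing_colourings_def colourings_def)
      ultimately show ?thesis using bn cD n by (simp add: m_def)
    qed
    ultimately show ?thesis by (auto simp: \<phi>_def)
  qed
  have surj: "S \<in> \<phi> ` ?G" if S: "S \<subseteq> {..<m}" "card S = n" for S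
  proof -
    have finS: "finite S" using S(1) finite_subset by blast
    define xs where "xs = sorted_list_of_set S"
    have len: "length xs = n" using S by (simp add: xs_def)
    have sw: "sorted_wrt (<) xs" by (simp add: xs_def)
    have mono: "xs ! i < xs ! j" if "i < j" "j < n" for i j
      using sw that len by (simp add: sorted_wrt_iff_nth_less)
    have setxs: "set xs = S" using finS by (simp add: xs_def)
    have bound: "xs ! i < m" if "i < n" for i using that len setxs S nth_mem[of i xs] by auto
    define g where "g = (\<lambda>j\<in>{1..n}. xs ! (j - 1) - b j)"
    \<comment> \<open>The entries of a strictly increasing list are at least their indices, which
      dominate \<open>block_index\<close>; so the truncated subtraction in \<open>g\<close> is
      exact.\<close>
    have gb0: "j - 1 \<le> xs ! (j - 1)" if "1 \<le> j" "j \<le> n" for j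
      using that
    proof (induction j rule: dec_induct)
      case (step j)
      then show ?case using mono[of "j - 1" j] by simp
    qed simp
    have gb: "g j + b j = xs ! (j - 1)" if "j \<in> {1..n}" for j
      using gb0[of j] block_index_le[of D j] that by (simp add: g_def b_def)
    have gstep: "g d + b d < g (Suc d) + b (Suc d)" if "d \<in> {1..<n}" for d
    proof -
      have "xs ! (d - 1) < xs ! d" using that by (intro mono) auto
      then show ?thesis using gb[of d] gb[of "Suc d"] that by simp
    qed
    have g1: "g d \<le> g (Suc d)" "d \<in> D \<Longrightarrow> g d < g (Suc d)" if "d \<in> {1..<n}" for d
      using gstep[OF that] block_index_Suc[of d D] that by (auto simp: b_def split: if_splits)
    have gk: "g j \<le> k" if j: "j \<in> {1..n}" for j
    proof -
      have "g j \<le> g n" by (rule increasing_chain) (use j g1 in auto)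
      also have "g n + b n < m" using gb[of n] bound[of "n - 1"] n by simp
      then have "g n \<le> k" using bn cD n by (simp add: m_def)
      finally show ?thesis .
    qed
    have "g \<in> colourings n k" using gk by (auto simp: colourings_def g_def)
    then have "g \<in> ?G" using g1 by (fastforce simp: increasing_colourings_def plateaus_def)
    moreover have "\<phi> g = S"
    proof -
      have "\<phi> g = (\<lambda>j. xs ! (j - 1)) ` {1..n}" unfolding \<phi>_def by (rule image_cong) (auto simp: gb)
      also have "{1..n} = Suc ` {..<n}" by (simp only: lessThan_atLeast0 image_Suc_atLeastLessThan atLeastLessThanSuc_atLeastAtMost One_nat_def)
      also have "(\<lambda>j. xs ! (j - 1)) ` Suc ` {..<n} = (\<lambda>i. xs ! i) ` {..<n}" by (simp add: image_image)
      also have "\<dots> = set xs" using len by (auto simp: set_conv_nth)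
      finally show ?thesis using setxs by simp
    qed
    ultimately show ?thesis by blast
  qed
  have "\<phi> ` ?G = {S. S \<subseteq> {..<m} \<and> card S = n}"
  proof
    show "\<phi> ` ?G \<subseteq> {S. S \<subseteq> {..<m} \<and> card S = n}" using sub by (rule image_subsetI)
    show "{S. S \<subseteq> {..<m} \<and> card S = n} \<subseteq> \<phi> ` ?G"
    proof
      fix S assume "S \<in> {S. S \<subseteq> {..<m} \<and> card S = n}"
      then have "S \<subseteq> {..<m}" "card S = n" by simp_all
      then show "S \<in> \<phi> ` ?G" by (rule surj)
    qed
  qed
  then have "card ?G = card {S. S \<subseteq> {..<m} \<and> card S = n}"
    using card_image[OF inj] by simp
  also have "\<dots> = m choose n" using n_subsets[of "{..<m}" n] by simp
  finally show ?thesis by (simp add: m_def)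
qed

text \<open>The fixed colourings are counted through their sorted forms. For given \<open>g\<close>
  and \<open>w\<close> only one colouring is possible, and it is fixed by \<open>p\<close> exactly
  if \<open>inv w \<circ> p \<circ> w\<close> stabilizes \<open>g\<close>, which is the coset count
  of \<open>sum_descent_trace\<close> for the plateaus of \<open>g\<close>. Exchanging sums leaves,
  for each \<open>w\<close>, the number of \<open>g\<close> that are strict at the descents of
  \<open>w\<close>.\<close>

lemma cyc_power_eq_sum_descent_trace:
  assumes n: "n \<ge> 1" and p: "p permutes {1..n}"
  shows "cyc_power n (k + 1) p =
    (\<Sum>w\<in>perms n. of_nat ((n + k - card (des n w)) choose n) * descent_trace n p w)"
proof -
  define C where "C = {f \<in> colourings n k. \<forall>j\<in>{1..n}. f (p j) = f j}"
  define G where "G = increasing_colourings n k"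
  define Y where "Y g = young n (plateaus n g)" for g
  define c where "c g = (of_nat (card (Y g)) :: complex)" for g
  have finC: "finite C" using finite_colourings by (simp add: C_def)
  have finG: "finite G" unfolding G_def increasing_colourings_def using finite_colourings by simp
  have inner: "(\<Sum>f\<in>C. if \<forall>j\<in>{1..n}. f (w j) = g j then 1 else 0) =
     (\<Sum>r\<in>Y g. if inv p \<circ> w \<circ> r = w then 1 else (0::complex))"
    if g: "g \<in> G" and w: "w \<in> perms n" for g w
  proof -
    have wp: "w permutes {1..n}" using w by simp
    \<comment> \<open>\<open>q\<close> is the permutation of positions that \<open>p\<close> induces
      on the word \<open>w\<close>, and the only candidate for \<open>r\<close> on the
      right.\<close>
    define q where "q = inv w \<circ> p \<circ> w"
    have qp: "q permutes {1..n}"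
      unfolding q_def using wp p permutes_inv[OF wp] by (intro permutes_compose)
    define f0 where "f0 = (\<lambda>j\<in>{1..n}. g (inv w j))"
    have iw: "inv w j \<in> {1..n}" if "j \<in> {1..n}" for j
      using permutes_in_image[OF permutes_inv[OF wp]] that by blast
    have ww: "w j \<in> {1..n}" if "j \<in> {1..n}" for j using permutes_in_image[OF wp] that by blast
    have pp: "p j \<in> {1..n}" if "j \<in> {1..n}" for j using permutes_in_image[OF p] that by blast
    have gc: "g \<in> colourings n k" using g by (simp add: G_def increasing_colourings_def)
    have f0c: "f0 \<in> colourings n k" using gc iw unfolding colourings_def f0_def by (auto simp: PiE_iff)
    have f0w: "f0 (w j) = g j" if "j \<in> {1..n}" for j
      using ww[OF that] permutes_inverses(2)[OF wp] by (simp add: f0_def)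
    have uniq: "f = f0" if f: "f \<in> colourings n k" "\<forall>j\<in>{1..n}. f (w j) = g j" for f
    proof
      fix j
      show "f j = f0 j"
      proof (cases "j \<in> {1..n}")
        case True
        then have "f (w (inv w j)) = g (inv w j)" using f(2) iw by blast
        then show ?thesis using True permutes_inverses(1)[OF wp] by (simp add: f0_def)
      next
        case False
        then have "f j = undefined" "f0 j = undefined"
          using f f0c unfolding colourings_def PiE_def extensional_def by blast+
        then show ?thesis by simp
      qed
    qed
    have "f0 \<in> C \<longleftrightarrow> (\<forall>j\<in>{1..n}. g (inv w (p j)) = g (inv w j))"
      unfolding C_def using f0c pp by (simp add: f0_def)
    also have "\<dots> \<longleftrightarrow> (\<forall>i\<in>{1..n}. g (q i) = g i)"
    proof
      assume *: "\<forall>j\<in>{1..n}. g (inv w (p j)) = g (inv w j)"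
      show "\<forall>i\<in>{1..n}. g (q i) = g i"
        using * ww permutes_inverses(2)[OF wp] by (auto simp: q_def)
    next
      assume *: "\<forall>i\<in>{1..n}. g (q i) = g i"
      show "\<forall>j\<in>{1..n}. g (inv w (p j)) = g (inv w j)"
      proof
        fix j assume "j \<in> {1..n}"
        from * iw[OF this] have "g (q (inv w j)) = g (inv w j)" by blast
        then show "g (inv w (p j)) = g (inv w j)"
          using permutes_inverses(1)[OF wp] by (simp add: q_def)
      qed
    qed
    also have "\<dots> \<longleftrightarrow> q \<in> Y g"
      using young_plateaus_iff[OF _ qp] g by (simp add: Y_def G_def)
    finally have f0C: "f0 \<in> C \<longleftrightarrow> q \<in> Y g" .
    have "(\<Sum>f\<in>C. if \<forall>j\<in>{1..n}. f (w j) = g j then 1 else 0) = (\<Sum>f\<in>C. if f = f0 then 1 else (0::complex))"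
    proof (rule sum.cong[OF refl])
      fix f assume "f \<in> C"
      then have "f \<in> colourings n k" by (simp add: C_def)
      then have "(\<forall>j\<in>{1..n}. f (w j) = g j) \<longleftrightarrow> f = f0" using uniq[of f] f0w by metis
      then show "(if \<forall>j\<in>{1..n}. f (w j) = g j then 1 else 0) = (if f = f0 then 1 else (0::complex))" by simp
    qed
    also have "\<dots> = (if q \<in> Y g then 1 else 0)" using finC f0C by simp
    also have "\<dots> = (\<Sum>r\<in>Y g. if r = q then 1 else 0)" using finite_young by (simp add: Y_def)
    also have "\<dots> = (\<Sum>r\<in>Y g. if inv p \<circ> w \<circ> r = w then 1 else 0)"
    proof -
      have "r = q \<longleftrightarrow> inv p \<circ> w \<circ> r = w" for r
      proof
        assume "r = q"
        have "inv p \<circ> w \<circ> (inv w \<circ> p \<circ> w) = inv p \<circ> ((w \<circ> inv w) \<circ> p) \<circ> w" by (simp only: comp_assoc)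
        then show "inv p \<circ> w \<circ> r = w"
          unfolding \<open>r = q\<close> q_def permutes_inv_o[OF wp] by (simp add: permutes_inv_o[OF p])
      next
        assume "inv p \<circ> w \<circ> r = w"
        then have "q = inv w \<circ> p \<circ> (inv p \<circ> w \<circ> r)" by (simp add: q_def)
        also have "\<dots> = inv w \<circ> ((p \<circ> inv p) \<circ> w) \<circ> r" by (simp only: comp_assoc)
        also have "\<dots> = r" unfolding permutes_inv_o(1)[OF p] id_comp permutes_inv_o(2)[OF wp] ..
        finally show "r = q" by simp
      qed
      then show ?thesis by simp
    qed
    finally show ?thesis .
  qed
  have "cyc_power n (k + 1) p = of_nat (card C)"
    unfolding cyc_power_def C_def card_fixed_colourings[OF p] by simp
  also have "\<dots> = (\<Sum>f\<in>C. 1)" by simp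
  also have "\<dots> = (\<Sum>f\<in>C. \<Sum>g\<in>G. \<Sum>w\<in>perms n. (if \<forall>j\<in>{1..n}. f (w j) = g j then 1 else 0) / c g)"
    unfolding G_def c_def Y_def
    by (intro sum.cong refl arrangements_weight[symmetric]) (simp add: C_def)
  also have "\<dots> = (\<Sum>g\<in>G. \<Sum>f\<in>C. \<Sum>w\<in>perms n. (if \<forall>j\<in>{1..n}. f (w j) = g j then 1 else 0) / c g)"
    by (rule sum.swap)
  also have "\<dots> = (\<Sum>g\<in>G. \<Sum>w | w \<in> perms n \<and> des n w \<inter> plateaus n g = {}. descent_trace n p w)"
  proof (rule sum.cong[OF refl])
    fix g assume g: "g \<in> G"
    have "(\<Sum>f\<in>C. \<Sum>w\<in>perms n. (if \<forall>j\<in>{1..n}. f (w j) = g j then 1 else 0) / c g) =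
      (\<Sum>w\<in>perms n. (\<Sum>f\<in>C. if \<forall>j\<in>{1..n}. f (w j) = g j then 1 else 0)) / c g"
      unfolding sum_divide_distrib by (rule sum.swap)
    also have "\<dots> = (\<Sum>w\<in>perms n. \<Sum>r\<in>Y g. if inv p \<circ> w \<circ> r = w then 1 else 0) / c g"
      by (rule arg_cong[of _ _ "\<lambda>x. x / c g"], rule sum.cong[OF refl], rule inner[OF g])
    also have "\<dots> = (\<Sum>w | w \<in> perms n \<and> des n w \<inter> plateaus n g = {}. descent_trace n p w)"
      unfolding c_def Y_def by (rule sum_descent_trace[OF p, symmetric]) (auto simp: plateaus_def)
    finally show "(\<Sum>f\<in>C. \<Sum>w\<in>perms n. (if \<forall>j\<in>{1..n}. f (w j) = g j then 1 else 0) / c g) =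
      (\<Sum>w | w \<in> perms n \<and> des n w \<inter> plateaus n g = {}. descent_trace n p w)" .
  qed
  also have "\<dots> = (\<Sum>g\<in>G. \<Sum>w\<in>perms n. if des n w \<inter> plateaus n g = {} then descent_trace n p w else 0)"
    by (rule sum.cong[OF refl], rule sum.inter_filter[OF finite_perms])
  also have "\<dots> = (\<Sum>w\<in>perms n. \<Sum>g\<in>G. if des n w \<inter> plateaus n g = {} then descent_trace n p w else 0)"
    by (rule sum.swap)
  also have "\<dots> = (\<Sum>w\<in>perms n. of_nat ((n + k - card (des n w)) choose n) * descent_trace n p w)"
  proof (rule sum.cong[OF refl])
    fix w assume "w \<in> perms n"
    have "(\<Sum>g\<in>G. if des n w \<inter> plateaus n g = {} then descent_trace n p w else 0) =
      of_nat (card {g \<in> G. des n w \<inter> plateaus n g = {}}) * descent_trace n p w"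
      unfolding sum.inter_filter[OF finG, symmetric] by simp
    then show "(\<Sum>g\<in>G. if des n w \<inter> plateaus n g = {} then descent_trace n p w else 0) =
      of_nat ((n + k - card (des n w)) choose n) * descent_trace n p w"
      unfolding G_def card_increasing_colourings[OF n des_subset] .
  qed
  finally show ?thesis .
qed

section \<open>Border shapes as ribbons\<close>

text \<open>\<open>D\<close> is the set of \<open>j\<close> such that the step from the \<open>j\<close>-th to the next cell goes upwards.\<close>

definition cell :: "nat set \<Rightarrow> nat \<Rightarrow> nat \<times> nat" where
  "cell D j = (card {d \<in> D. j \<le> d}, block_index D j)"

definition ribbon :: "nat \<Rightarrow> nat set \<Rightarrow> (nat \<times> nat) set" where
  "ribbon n D = cell D ` {1..n}"

lemma fst_cell_Suc:
  assumes "finite D"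
  shows "fst (cell D j) = (if j \<in> D then Suc (fst (cell D (Suc j))) else fst (cell D (Suc j)))"
proof -
  have "{d \<in> D. j \<le> d} = (if j \<in> D then insert j {d \<in> D. Suc j \<le> d} else {d \<in> D. Suc j \<le> d})"
    by (auto simp: Suc_le_eq le_less)
  then show ?thesis using assms by (simp add: cell_def)
qed

lemma snd_cell_Suc:
  "1 \<le> j \<Longrightarrow> snd (cell D (Suc j)) = (if j \<in> D then snd (cell D j) else Suc (snd (cell D j)))"
  by (simp add: cell_def block_index_Suc)

text \<open>Each step goes either up or to the right, and both raise column minus row by one. Hence
  the content of a cell determines its index along the ribbon.\<close>

lemma cell_content:
  assumes D: "D \<subseteq> {1..<n}" and j: "1 \<le> j"
  shows "snd (cell D j) + card D = fst (cell D j) + (j - 1)"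
  using j
proof (induction j rule: dec_induct)
  case base
  have "{d \<in> D. 1 \<le> d} = D" using D by auto
  then show ?case by (simp add: cell_def block_index_def)
next
  case (step j)
  have "finite D" using D finite_subset by blast
  then show ?case
    using step fst_cell_Suc[of D j] snd_cell_Suc[of j D] by (auto split: if_splits)
qed

lemma fst_cell_antimono:
  assumes "finite D" "i \<le> j"
  shows "fst (cell D j) \<le> fst (cell D i)"
  unfolding cell_def using assms by (auto intro!: card_mono)

lemma snd_cell_mono:
  assumes "i \<le> j"
  shows "snd (cell D i) \<le> snd (cell D j)"
  unfolding cell_def block_index_def using assms by (auto intro!: card_mono)

lemma cell_eq_imp_index_eq:
  assumes "D \<subseteq> {1..<n}" "D' \<subseteq> {1..<n}" "card D = card D'" "1 \<le> i" "1 \<le> j" "cell D i = cell D' j"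
  shows "i = j"
  using cell_content[OF assms(1,4)] cell_content[OF assms(2,5)] assms by simp

lemma inj_on_cell: "D \<subseteq> {1..<n} \<Longrightarrow> inj_on (cell D) {1..n}"
  by (rule inj_onI) (rule cell_eq_imp_index_eq[of D n D], auto)

lemma discrete_intermediate_increasing:
  fixes f :: "nat \<Rightarrow> nat"
  assumes "i \<le> j" "\<And>k. i \<le> k \<Longrightarrow> k < j \<Longrightarrow> f (Suc k) \<le> Suc (f k)" "f i \<le> c" "c \<le> f j"
  shows "\<exists>k\<in>{i..j}. f k = c"
  using assms
proof (induction j rule: dec_induct)
  case base
  then show ?case by auto
next
  case (step j)
  show ?case
  proof (cases "c \<le> f j")
    case True
    then obtain k where "k \<in> {i..j}" "f k = c" using step by auto
    then show ?thesis by (intro bexI[of _ k]) auto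
  next
    case False
    moreover have "f (Suc j) \<le> Suc (f j)" using step by simp
    ultimately have "f (Suc j) = c" using step.prems by linarith
    then show ?thesis using step by (intro bexI[of _ "Suc j"]) auto
  qed
qed

lemma discrete_intermediate_decreasing:
  fixes f :: "nat \<Rightarrow> nat"
  assumes "i \<le> j" "\<And>k. i \<le> k \<Longrightarrow> k < j \<Longrightarrow> f k \<le> Suc (f (Suc k))" "f j \<le> c" "c \<le> f i"
  shows "\<exists>k\<in>{i..j}. f k = c"
  using assms
proof (induction j rule: dec_induct)
  case base
  then show ?case by auto
next
  case (step j)
  show ?case
  proof (cases "f j \<le> c")
    case True
    then obtain k where "k \<in> {i..j}" "f k = c" using step by auto
    then show ?thesis by (intro bexI[of _ k]) auto
  next
    case False
    moreover have "f j \<le> Suc (f (Suc j))" using step by simp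
    ultimately have "f (Suc j) = c" using step.prems by linarith
    then show ?thesis using step by (intro bexI[of _ "Suc j"]) auto
  qed
qed

text \<open>Differences of down-closed sets are order-convex. Conversely, convexity makes the cells
  of the down-closure that lie outside \<open>B\<close> down-closed again.\<close>

lemma skew_shape_iff:
  "skew_shape B \<longleftrightarrow> finite B \<and> (\<forall>x\<in>B. \<forall>z\<in>B. \<forall>r c. fst x \<le> r \<longrightarrow> r \<le> fst z \<longrightarrow> snd x \<le> c \<longrightarrow> c \<le> snd z \<longrightarrow> (r, c) \<in> B)"
proof
  assume "skew_shape B"
  then obtain L M where LM: "young_diagram L" "young_diagram M" "M \<subseteq> L" "B = L - M"
    unfolding skew_shape_def by blast
  have down: "(r, c) \<in> N" if "young_diagram N" "z \<in> N" "r \<le> fst z" "c \<le> snd z" for N z r c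
    using that unfolding young_diagram_def by (cases z) force
  show "finite B \<and> (\<forall>x\<in>B. \<forall>z\<in>B. \<forall>r c. fst x \<le> r \<longrightarrow> r \<le> fst z \<longrightarrow> snd x \<le> c \<longrightarrow> c \<le> snd z \<longrightarrow> (r, c) \<in> B)"
  proof (intro conjI ballI allI impI)
    show "finite B" using LM by (simp add: young_diagram_def)
    fix x z r c assume *: "x \<in> B" "z \<in> B" "fst x \<le> r" "r \<le> fst z" "snd x \<le> c" "c \<le> snd z"
    have "(r, c) \<in> L" using down[OF LM(1), of z r c] * LM(4) by blast
    moreover have "(r, c) \<notin> M"
    proof
      assume "(r, c) \<in> M"
      then have "(fst x, snd x) \<in> M" using down[OF LM(2), of "(r, c)" "fst x" "snd x"] * by simp
      then show False using *(1) LM(4) by simp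
    qed
    ultimately show "(r, c) \<in> B" using LM(4) by simp
  qed
next
  assume B: "finite B \<and> (\<forall>x\<in>B. \<forall>z\<in>B. \<forall>r c. fst x \<le> r \<longrightarrow> r \<le> fst z \<longrightarrow> snd x \<le> c \<longrightarrow> c \<le> snd z \<longrightarrow> (r, c) \<in> B)"
  define L where "L = (\<Union>b\<in>B. {..fst b} \<times> {..snd b})"
  have BL: "B \<subseteq> L" by (force simp: L_def)
  have finL: "finite L" using B by (auto simp: L_def)
  have "young_diagram L"
    unfolding young_diagram_def using finL by (auto simp: L_def intro: order_trans)
  moreover have "young_diagram (L - B)"
    unfolding young_diagram_def
  proof (intro conjI)
    show "finite (L - B)" using finL by simp
    show "\<forall>(r, c)\<in>L - B. \<forall>r'\<le>r. \<forall>c'\<le>c. (r', c') \<in> L - B"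
    proof clarify
      fix r c r' c' assume rc: "(r, c) \<in> L" "(r, c) \<notin> B" "r' \<le> r" "c' \<le> c"
      obtain z where z: "z \<in> B" "r \<le> fst z" "c \<le> snd z" using rc(1) by (auto simp: L_def)
      have "(r', c') \<in> L" using z rc by (auto simp: L_def intro!: bexI[of _ z])
      moreover have "(r', c') \<notin> B"
      proof
        assume "(r', c') \<in> B"
        then have "(r, c) \<in> B" using B z rc by (metis fst_conv snd_conv)
        then show False using rc by simp
      qed
      ultimately show "(r', c') \<in> L - B" by simp
    qed
  qed
  moreover have "L - (L - B) = B" using BL by blast
  ultimately show "skew_shape B" unfolding skew_shape_def using BL by (metis Diff_subset)
qed

lemma ribbon_in_border_shapes:
  assumes n: "n \<ge> 1" and D: "D \<subseteq> {1..<n}"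
  shows "ribbon n D \<in> border_shapes n (card D + 1)"
proof -
  have finD: "finite D" using D finite_subset by blast
  let ?B = "ribbon n D"
  have inB: "cell D k \<in> ?B" if "1 \<le> k" "k \<le> n" for k using that by (simp add: ribbon_def)
  have fst_step: "fst (cell D k) \<le> Suc (fst (cell D (Suc k)))" for k
    using fst_cell_Suc[OF finD, of k] by (auto split: if_splits)
  have snd_step: "snd (cell D (Suc k)) \<le> Suc (snd (cell D k))" if "1 \<le> k" for k
    using snd_cell_Suc[OF that, of D] by (auto split: if_splits)
  have "skew_shape ?B"
    unfolding skew_shape_iff
  proof (intro conjI ballI allI impI)
    show "finite ?B" by (simp add: ribbon_def)
    fix x z r c assume xz: "x \<in> ?B" "z \<in> ?B" and rc: "fst x \<le> r" "r \<le> fst z" "snd x \<le> c" "c \<le> snd z"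
    obtain i where i: "x = cell D i" "1 \<le> i" "i \<le> n" using xz(1) by (auto simp: ribbon_def)
    obtain j where j: "z = cell D j" "1 \<le> j" "j \<le> n" using xz(2) by (auto simp: ribbon_def)
    show "(r, c) \<in> ?B"
    \<comment> \<open>Along the ribbon rows never grow and columns never shrink. So for
      \<open>i \<le> j\<close> all rows involved equal \<open>r\<close>, and the columns, rising by
      at most one, attain \<open>c\<close>; in the other case the roles are exchanged.\<close>
    proof (cases "i \<le> j")
      case True
      have "\<exists>k\<in>{i..j}. snd (cell D k) = c"
        using True rc i j snd_step by (intro discrete_intermediate_increasing) auto
      then obtain k where k: "i \<le> k" "k \<le> j" "snd (cell D k) = c" by auto
      have "fst (cell D k) = r"
        using fst_cell_antimono[OF finD k(1)] fst_cell_antimono[OF finD k(2)] rc i j by simp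
      then have "(r, c) = cell D k" using k by (simp add: prod_eq_iff)
      then show ?thesis using inB[of k] k i j by simp
    next
      case False
      have "\<exists>k\<in>{j..i}. fst (cell D k) = r"
        using False rc i j fst_step by (intro discrete_intermediate_decreasing) auto
      then obtain k where k: "j \<le> k" "k \<le> i" "fst (cell D k) = r" by auto
      have "snd (cell D k) = c"
        using snd_cell_mono[OF k(1), of D] snd_cell_mono[OF k(2), of D] rc i j by simp
      then have "(r, c) = cell D k" using k by (simp add: prod_eq_iff)
      then show ?thesis using inB[of k] k i j by simp
    qed
  qed
  moreover have "connected_shape ?B"
  proof -
    let ?R = "{(a, b). a \<in> ?B \<and> b \<in> ?B \<and> adjacent a b}"
    have adj: "adjacent (cell D k) (cell D (Suc k))" if "1 \<le> k" for k
      using fst_cell_Suc[OF finD, of k] snd_cell_Suc[OF that, of D] unfolding adjacent_def by (auto split: if_splits)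
    have sym_adj: "adjacent a b \<Longrightarrow> adjacent b a" for a b by (auto simp: adjacent_def)
    have R_step: "(cell D k, cell D (Suc k)) \<in> ?R" "(cell D (Suc k), cell D k) \<in> ?R"
      if "1 \<le> k" "Suc k \<le> n" for k
      using adj[OF that(1)] sym_adj inB[of k] inB[of "Suc k"] that by auto
    have "j \<le> n \<longrightarrow> (cell D i, cell D j) \<in> ?R\<^sup>* \<and> (cell D j, cell D i) \<in> ?R\<^sup>*"
      if "1 \<le> i" "i \<le> j" for i j
      using that(2)
    proof (induction j rule: dec_induct)
      case (step j)
      show ?case
      proof
        assume "Suc j \<le> n"
        then have "(cell D j, cell D (Suc j)) \<in> ?R" "(cell D (Suc j), cell D j) \<in> ?R"
          using R_step[of j] that(1) step.hyps by auto
        then show "(cell D i, cell D (Suc j)) \<in> ?R\<^sup>* \<and> (cell D (Suc j), cell D i) \<in> ?R\<^sup>*"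
          using step.IH \<open>Suc j \<le> n\<close> rtrancl.rtrancl_into_rtrancl[of "cell D i" "cell D j" ?R "cell D (Suc j)"]
            converse_rtrancl_into_rtrancl[of "cell D (Suc j)" "cell D j" ?R "cell D i"]
          by (simp only: Suc_leD)
      qed
    qed simp
    then have conn: "(cell D i, cell D j) \<in> ?R\<^sup>*" if "i \<in> {1..n}" "j \<in> {1..n}" for i j
      using that by (cases "i \<le> j") auto
    show ?thesis
      unfolding connected_shape_def
    proof (intro ballI)
      fix x y assume "x \<in> ?B" "y \<in> ?B"
      then obtain i j where "i \<in> {1..n}" "x = cell D i" "j \<in> {1..n}" "y = cell D j"
        unfolding ribbon_def by blast
      then show "(x, y) \<in> ?R\<^sup>*" using conn by simp
    qed
  qed
  moreover have "\<nexists>r c. {(r, c), (r, Suc c), (Suc r, c), (Suc r, Suc c)} \<subseteq> ?B"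
  proof
    assume "\<exists>r c. {(r, c), (r, Suc c), (Suc r, c), (Suc r, Suc c)} \<subseteq> ?B"
    \<comment> \<open>The two diagonal cells of a square have equal content, hence would have equal
      index.\<close>
    then obtain r c where rc: "(r, c) \<in> ?B" "(Suc r, Suc c) \<in> ?B" by blast
    obtain i where "i \<in> {1..n}" "(r, c) = cell D i" using rc(1) unfolding ribbon_def by (rule imageE)
    moreover obtain j where "j \<in> {1..n}" "(Suc r, Suc c) = cell D j"
      using rc(2) unfolding ribbon_def by (rule imageE)
    ultimately have ij: "1 \<le> i" "cell D i = (r, c)" "1 \<le> j" "cell D j = (Suc r, Suc c)" by auto
    then have "i = j" using cell_content[OF D ij(1)] cell_content[OF D ij(3)] by simp
    then show False using ij by simp
  qed
  moreover have "0 \<in> fst ` ?B"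
  proof -
    have "{d \<in> D. n \<le> d} = {}" using D by auto
    then have "fst (cell D n) = 0" by (simp only: cell_def fst_conv card.empty)
    then show ?thesis using inB[of n] n by (metis imageI order_refl)
  qed
  moreover have "0 \<in> snd ` ?B"
  proof -
    have "snd (cell D 1) = 0" by (simp add: cell_def block_index_def)
    then show ?thesis using inB[of 1] n by (metis imageI order_refl)
  qed
  moreover have "card ?B = n" unfolding ribbon_def using card_image[OF inj_on_cell[OF D]] by simp
  moreover have "card (fst ` ?B) = card D + 1"
  proof -
    have "fst ` ?B = {..card D}"
    proof
      show "fst ` ?B \<subseteq> {..card D}" using finD by (auto simp: ribbon_def cell_def intro!: card_mono)
      show "{..card D} \<subseteq> fst ` ?B"
      proof
        fix r assume r: "r \<in> {..card D}"
        have "{d \<in> D. n \<le> d} = {}" "{d \<in> D. 1 \<le> d} = D" using D by auto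
        then have "fst (cell D n) = 0" "fst (cell D 1) = card D"
          by (simp_all only: cell_def fst_conv card.empty)
        then have "\<exists>k\<in>{1..n}. fst (cell D k) = r"
          using n r fst_step by (intro discrete_intermediate_decreasing) auto
        then obtain k where "k \<in> {1..n}" "fst (cell D k) = r" by blast
        then show "r \<in> fst ` ?B" using inB[of k] by force
      qed
    qed
    then show ?thesis by simp
  qed
  ultimately show ?thesis unfolding border_shapes_def by blast
qed

text \<open>With equal cardinalities the contents start at the same value, so a common cell has the
  same index in both ribbons; the set is then read off from the column steps.\<close>

lemma ribbon_inj:
  assumes D: "D \<subseteq> {1..<n}" and D': "D' \<subseteq> {1..<n}" and c: "card D = card D'" and eq: "ribbon n D = ribbon n D'"
  shows "D = D'"
proof -
  have cell_eq: "cell D j = cell D' j" if j: "j \<in> {1..n}" for j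
  proof -
    have "cell D j \<in> ribbon n D'" using j eq by (auto simp: ribbon_def)
    then obtain i where i: "i \<in> {1..n}" "cell D j = cell D' i" by (auto simp: ribbon_def)
    then have "j = i" using j by (intro cell_eq_imp_index_eq[OF D D' c]) auto
    then show ?thesis using i by simp
  qed
  have "d \<in> D \<longleftrightarrow> d \<in> D'" for d
  proof (cases "d \<in> {1..<n}")
    case True
    then have "cell D d = cell D' d" "cell D (Suc d) = cell D' (Suc d)" using cell_eq by auto
    then show ?thesis using snd_cell_Suc[of d D] snd_cell_Suc[of d D'] True
      by (auto split: if_splits)
  next
    case False
    then show ?thesis using D D' by blast
  qed
  then show ?thesis by blast
qed

text \<open>Two cells of equal content would, by convexity, span a square, so contents are distinct;
  connectedness makes them an interval. Listing the cells by content gives a path of steps up or to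
  the right, and touching row 0 and column 0 fixes its position.\<close>

lemma border_shape_is_ribbon:
  assumes n: "n \<ge> 1" and B: "B \<in> border_shapes n (i + 1)"
  obtains D where "D \<subseteq> {1..<n}" "card D = i" "B = ribbon n D"
proof -
  have skew: "skew_shape B" and conn: "connected_shape B"
    and sq: "\<nexists>r c. {(r, c), (r, Suc c), (Suc r, c), (Suc r, Suc c)} \<subseteq> B"
    and z: "0 \<in> fst ` B" "0 \<in> snd ` B" and cB: "card B = n" "card (fst ` B) = i + 1"
    using B unfolding border_shapes_def by blast+
  have finB: "finite B" and conv: "\<And>x z r c. x \<in> B \<Longrightarrow> z \<in> B \<Longrightarrow> fst x \<le> r \<Longrightarrow> r \<le> fst z \<Longrightarrow>
      snd x \<le> c \<Longrightarrow> c \<le> snd z \<Longrightarrow> (r, c) \<in> B"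
    using skew unfolding skew_shape_iff by blast+
  define ct where "ct x = int (snd x) - int (fst x)" for x :: "nat \<times> nat"
  have no_diag: "fst y \<le> fst x" if xy: "x \<in> B" "y \<in> B" "ct x = ct y" for x y
  proof (rule ccontr)
    assume "\<not> fst y \<le> fst x"
    then have f: "Suc (fst x) \<le> fst y" by simp
    then have s: "Suc (snd x) \<le> snd y" using xy(3) by (simp add: ct_def)
    have "{(fst x, snd x), (fst x, Suc (snd x)), (Suc (fst x), snd x), (Suc (fst x), Suc (snd x))} \<subseteq> B"
      using conv[OF xy(1,2)] f s xy(1) by simp
    then show False using sq by blast
  qed
  have inj: "inj_on ct B"
  proof (rule inj_onI)
    fix x y assume xy: "x \<in> B" "y \<in> B" "ct x = ct y"
    then have "fst x = fst y" using no_diag[of x y] no_diag[of y x] by simp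
    then show "x = y" using xy(3) by (simp add: ct_def prod_eq_iff)
  qed
  let ?R = "{(a, b). a \<in> B \<and> b \<in> B \<and> adjacent a b}"
  \<comment> \<open>Adjacent cells differ by one in content, so a path from content at most
    \<open>t\<close> to a larger one has a step from \<open>t\<close> to
    \<open>t + 1\<close>.\<close>
  have cross: "\<exists>u\<in>B. \<exists>v\<in>B. adjacent u v \<and> ct u = t \<and> ct v = t + 1"
    if "x \<in> B" "y \<in> B" "ct x \<le> t" "t < ct y" for x y t
  proof -
    have "(x, y) \<in> ?R\<^sup>*" using conn that unfolding connected_shape_def by blast
    then have "ct y \<le> t \<or> (\<exists>u\<in>B. \<exists>v\<in>B. adjacent u v \<and> ct u = t \<and> ct v = t + 1)"
    proof induction
      case base
      then show ?case using that by simp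
    next
      case (step y z)
      show ?case
      proof (cases "ct y \<le> t \<and> t < ct z")
        case True
        have "adjacent y z" "y \<in> B" "z \<in> B" using step by auto
        moreover have "ct z \<le> ct y + 1" using \<open>adjacent y z\<close> by (auto simp: adjacent_def ct_def)
        ultimately show ?thesis using True by (intro disjI2 bexI[of _ y] bexI[of _ z]) auto
      next
        case False
        then show ?thesis using step.IH by auto
      qed
    qed
    then show ?thesis using that by auto
  qed
  have neB: "B \<noteq> {}" using z by auto
  define m where "m = Min (ct ` B)"
  define M where "M = Max (ct ` B)"
  have mB: "m \<in> ct ` B" "M \<in> ct ` B" unfolding m_def M_def using finB neB by auto
  have mM: "m \<le> ct x" "ct x \<le> M" if "x \<in> B" for x unfolding m_def M_def using that finB by auto
  have img: "ct ` B = {m..M}"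
  proof
    show "ct ` B \<subseteq> {m..M}" using mM by auto
    show "{m..M} \<subseteq> ct ` B"
    proof
      fix t assume t: "t \<in> {m..M}"
      show "t \<in> ct ` B"
      proof (cases "t = M")
        case False
        obtain x y where "x \<in> B" "ct x = m" "y \<in> B" "ct y = M" using mB by auto
        then obtain u where "u \<in> B" "ct u = t" using cross[of x y t] t False by auto
        then show ?thesis by auto
      qed (use mB in simp)
    qed
  qed
  have "card (ct ` B) = n" using card_image[OF inj] cB by simp
  then have M: "M = m + int n - 1" using img n by simp
  define x where "x j = inv_into B ct (m + int j - 1)" for j
  have x: "x j \<in> B" "ct (x j) = m + int j - 1" if "j \<in> {1..n}" for j
  proof -
    have "m + int j - 1 \<in> ct ` B" unfolding img M using that by auto
    then show "x j \<in> B" "ct (x j) = m + int j - 1"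
      unfolding x_def by (rule inv_into_into, rule f_inv_into_f)
  qed
  have Bx: "B = x ` {1..n}"
  proof
    show "B \<subseteq> x ` {1..n}"
    proof
      fix b assume b: "b \<in> B"
      define j where "j = nat (ct b - m + 1)"
      have j: "j \<in> {1..n}" "ct b = m + int j - 1" using mM[OF b] M by (auto simp: j_def)
      then have "b = x j" using inj_onD[OF inj, of b "x j"] x b by simp
      then show "b \<in> x ` {1..n}" using j by blast
    qed
    show "x ` {1..n} \<subseteq> B" using x by auto
  qed
  define D where "D = {j \<in> {1..<n}. snd (x (Suc j)) = snd (x j)}"
  have x_step: "(j \<in> D \<and> snd (x (Suc j)) = snd (x j) \<and> fst (x j) = Suc (fst (x (Suc j)))) \<or>
     (j \<notin> D \<and> snd (x (Suc j)) = Suc (snd (x j)) \<and> fst (x j) = fst (x (Suc j)))"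
    if j: "j \<in> {1..<n}" for j
  proof -
    have j': "j \<in> {1..n}" "Suc j \<in> {1..n}" using j by auto
    obtain u v where uv: "u \<in> B" "v \<in> B" "adjacent u v" "ct u = m + int j - 1" "ct v = m + int j - 1 + 1"
      using cross[of "x j" "x (Suc j)" "m + int j - 1"] x[OF j'(1)] x[OF j'(2)] by auto
    have "u = x j" "v = x (Suc j)"
      using inj_onD[OF inj, of u "x j"] inj_onD[OF inj, of v "x (Suc j)"] uv x[OF j'(1)] x[OF j'(2)] by auto
    then have "adjacent (x j) (x (Suc j))" "ct (x (Suc j)) = ct (x j) + 1" using uv by simp_all
    then have "(snd (x (Suc j)) = snd (x j) \<and> fst (x j) = Suc (fst (x (Suc j)))) \<or>
        (snd (x (Suc j)) = Suc (snd (x j)) \<and> fst (x j) = fst (x (Suc j)))"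
      unfolding adjacent_def ct_def by linarith
    moreover have "j \<in> D \<longleftrightarrow> snd (x (Suc j)) = snd (x j)" using j by (simp add: D_def)
    ultimately show ?thesis by auto
  qed
  have sub: "D \<subseteq> {1..<n}" by (auto simp: D_def)
  have finD: "finite D" using sub finite_subset by blast
  \<comment> \<open>Columns are smallest at the first cell and rows at the last, so these are the
    cells that meet column 0 and row 0.\<close>
  have snd_le: "snd (x 1) \<le> snd (x j)" if "1 \<le> j" "j \<le> n" for j
    using that
  proof (induction j rule: dec_induct)
    case (step j)
    then show ?case using x_step[of j] by auto
  qed simp
  have snd1: "snd (x 1) = 0"
  proof -
    obtain j where "j \<in> {1..n}" "snd (x j) = 0" using z(2) unfolding Bx by auto
    then show ?thesis using snd_le[of j] by auto
  qed
  have fst_le: "fst (x n) \<le> fst (x j)" if "j \<le> n" "1 \<le> j" for j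
    using that
  proof (induction j rule: inc_induct)
    case (step j)
    then show ?case using x_step[of j] by auto
  qed simp
  have fstn: "fst (x n) = 0"
  proof -
    obtain j where "j \<in> {1..n}" "fst (x j) = 0" using z(1) unfolding Bx by auto
    then show ?thesis using fst_le[of j] by auto
  qed
  have snd_eq: "snd (x j) = snd (cell D j)" if "1 \<le> j" "j \<le> n" for j
    using that
  proof (induction j rule: dec_induct)
    case base
    then show ?case using snd1 by (simp add: cell_def block_index_def)
  next
    case (step j)
    then show ?case using x_step[of j] snd_cell_Suc[of j D] by auto
  qed
  have fst_eq: "fst (x j) = fst (cell D j)" if "j \<le> n" "1 \<le> j" for j
    using that
  proof (induction j rule: inc_induct)
    case base
    have "{d \<in> D. n \<le> d} = {}" using sub by auto
    then show ?case using fstn by (simp only: cell_def fst_conv card.empty)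
  next
    case (step j)
    then show ?case using x_step[of j] fst_cell_Suc[OF finD, of j] by auto
  qed
  have "x j = cell D j" if "j \<in> {1..n}" for j
    using that snd_eq[of j] fst_eq[of j] by (simp add: prod_eq_iff)
  then have "B = ribbon n D" unfolding Bx ribbon_def by (intro image_cong) auto
  moreover have "card D = i"
    using ribbon_in_border_shapes[OF n sub] cB(2) calculation by (simp add: border_shapes_def)
  ultimately show ?thesis using that sub by blast
qed

section \<open>Skew Specht modules of ribbons\<close>

definition word_tabloid :: "nat \<Rightarrow> nat set \<Rightarrow> (nat \<Rightarrow> nat) \<Rightarrow> tabloid" where
  "word_tabloid n D w = (\<lambda>r. w ` {j \<in> {1..n}. fst (cell D j) = r})"

text \<open>The column group acts here on the positions of the word, on the right of
  \<open>w\<close>, instead of on its entries; columns of the ribbon are the blocks of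
  \<open>D\<close>.\<close>

definition word_polytabloid :: "nat \<Rightarrow> nat set \<Rightarrow> (nat \<Rightarrow> nat) \<Rightarrow> tabloid \<Rightarrow> complex" where
  "word_polytabloid n D w T =
     (\<Sum>q\<in>young n D. of_int (sign q) * (if T = word_tabloid n D (w \<circ> q) then 1 else 0))"

lemma young_iff_columns:
  "young n D = {q. q permutes {1..n} \<and>
     (\<forall>c. q ` {j \<in> {1..n}. block_index D j = c} = {j \<in> {1..n}. block_index D j = c})}"
proof (intro set_eqI iffI)
  fix q assume q: "q \<in> young n D"
  then have qp: "q permutes {1..n}" by (simp add: young_def)
  have "q ` {j \<in> {1..n}. block_index D j = c} = {j \<in> {1..n}. block_index D j = c}" for c
  proof (rule card_subset_eq)
    show "q ` {j \<in> {1..n}. block_index D j = c} \<subseteq> {j \<in> {1..n}. block_index D j = c}"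
      using q permutes_in_image[OF qp] by (auto simp: young_def)
    show "card (q ` {j \<in> {1..n}. block_index D j = c}) = card {j \<in> {1..n}. block_index D j = c}"
      by (rule card_image[OF permutes_inj_on[OF qp]])
  qed simp
  then show "q \<in> {q. q permutes {1..n} \<and>
     (\<forall>c. q ` {j \<in> {1..n}. block_index D j = c} = {j \<in> {1..n}. block_index D j = c})}"
    using qp by blast
next
  fix q assume q: "q \<in> {q. q permutes {1..n} \<and>
     (\<forall>c. q ` {j \<in> {1..n}. block_index D j = c} = {j \<in> {1..n}. block_index D j = c})}"
  then have qp: "q permutes {1..n}" by simp
  have "block_index D (q j) = block_index D j" for j
  proof (cases "j \<in> {1..n}")
    case True
    then have "q j \<in> q ` {i \<in> {1..n}. block_index D i = block_index D j}" by blast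
    then have "q j \<in> {i \<in> {1..n}. block_index D i = block_index D j}" using q by blast
    then show ?thesis by simp
  next
    case False
    then show ?thesis using qp by (simp add: permutes_def)
  qed
  then show "q \<in> young n D" using qp by (simp add: young_def)
qed

text \<open>The row counts the upward steps still to come, the block index for the complement those
  already made; together they are \<open>card D\<close>.\<close>

lemma row_eq_iff:
  assumes D: "D \<subseteq> {1..<n}" and ij: "i \<in> {1..n}" "j \<in> {1..n}"
  shows "fst (cell D i) = fst (cell D j) \<longleftrightarrow> block_index ({1..<n} - D) i = block_index ({1..<n} - D) j"
proof -
  have finD: "finite D" using D finite_subset by blast
  have "fst (cell D k) + block_index ({1..<n} - D) k = card D" if k: "k \<in> {1..n}" for k
  proof -
    have "{1..<k} - ({1..<n} - D) = {d \<in> D. d < k}" using D k by auto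
    moreover have "card {d \<in> D. k \<le> d} + card {d \<in> D. d < k} = card ({d \<in> D. k \<le> d} \<union> {d \<in> D. d < k})"
      using finD by (intro card_Un_disjoint[symmetric]) auto
    moreover have "{d \<in> D. k \<le> d} \<union> {d \<in> D. d < k} = D" by auto
    ultimately show ?thesis by (simp add: cell_def block_index_def)
  qed
  from this[OF ij(1)] this[OF ij(2)] show ?thesis by linarith
qed

lemma word_tabloid_eq_iff:
  assumes D: "D \<subseteq> {1..<n}" and u: "u \<in> perms n" and v: "v \<in> perms n"
  shows "word_tabloid n D u = word_tabloid n D v \<longleftrightarrow> inv u \<circ> v \<in> young n ({1..<n} - D)"
proof -
  let ?R = "\<lambda>r. {j \<in> {1..n}. fst (cell D j) = r}"
  have up: "u permutes {1..n}" and vp: "v permutes {1..n}" using u v by auto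
  have qp: "inv u \<circ> v permutes {1..n}" using vp permutes_inv[OF up] by (rule permutes_compose)
  have "word_tabloid n D u = word_tabloid n D v \<longleftrightarrow> (\<forall>r. u ` ?R r = v ` ?R r)"
    by (simp only: word_tabloid_def fun_eq_iff)
  also have "\<dots> \<longleftrightarrow> (\<forall>r. (inv u \<circ> v) ` ?R r = ?R r)"
  proof -
    have "u ` A = v ` A \<longleftrightarrow> (inv u \<circ> v) ` A = A" for A
    proof
      assume "u ` A = v ` A"
      then have "inv u ` v ` A = inv u ` u ` A" by simp
      also have "\<dots> = A" unfolding image_comp permutes_inv_o(2)[OF up] by simp
      finally show "(inv u \<circ> v) ` A = A" by (simp add: image_comp)
    next
      assume "(inv u \<circ> v) ` A = A"
      then have "u ` A = u ` (inv u \<circ> v) ` A" by simp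
      also have "\<dots> = v ` A" unfolding image_comp comp_assoc[symmetric] permutes_inv_o(1)[OF up] by simp
      finally show "u ` A = v ` A" .
    qed
    then show ?thesis by simp
  qed
  also have "\<dots> \<longleftrightarrow> (\<forall>j\<in>{1..n}. fst (cell D ((inv u \<circ> v) j)) = fst (cell D j))"
  proof
    assume *: "\<forall>r. (inv u \<circ> v) ` ?R r = ?R r"
    show "\<forall>j\<in>{1..n}. fst (cell D ((inv u \<circ> v) j)) = fst (cell D j)"
    proof
      fix j assume "j \<in> {1..n}"
      then have "(inv u \<circ> v) j \<in> (inv u \<circ> v) ` ?R (fst (cell D j))" by blast
      then show "fst (cell D ((inv u \<circ> v) j)) = fst (cell D j)" using * by blast
    qed
  next
    assume *: "\<forall>j\<in>{1..n}. fst (cell D ((inv u \<circ> v) j)) = fst (cell D j)"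
    show "\<forall>r. (inv u \<circ> v) ` ?R r = ?R r"
    proof
      fix r
      show "(inv u \<circ> v) ` ?R r = ?R r"
      proof (rule card_subset_eq)
        show "(inv u \<circ> v) ` ?R r \<subseteq> ?R r" using * permutes_in_image[OF qp] by auto
        show "card ((inv u \<circ> v) ` ?R r) = card (?R r)" by (rule card_image[OF permutes_inj_on[OF qp]])
      qed simp
    qed
  qed
  also have "\<dots> \<longleftrightarrow> (\<forall>j\<in>{1..n}. block_index ({1..<n} - D) ((inv u \<circ> v) j) = block_index ({1..<n} - D) j)"
    using row_eq_iff[OF D] permutes_in_image[OF qp] by blast
  also have "\<dots> \<longleftrightarrow> inv u \<circ> v \<in> young n ({1..<n} - D)"
  proof -
    have "(inv u \<circ> v) j = j" if "j \<notin> {1..n}" for j using qp that by (auto simp: permutes_def)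
    then show ?thesis using qp unfolding young_def mem_Collect_eq by metis
  qed
  finally show ?thesis .
qed

text \<open>The words \<open>u\<close> and \<open>w \<circ> q\<close> give the same tabloid exactly
  if \<open>u \<circ> r = w \<circ> q\<close> for an element \<open>r\<close> of the row group,
  which is then unique. Reindexing by \<open>inv q\<close> moves \<open>q\<close> to the other side
  without changing the sign.\<close>

lemma word_polytabloid_at_tabloid:
  assumes D: "D \<subseteq> {1..<n}" and u: "u \<in> perms n" and w: "w \<in> perms n"
  shows "word_polytabloid n D w (word_tabloid n D u) =
    rsum (young n ({1..<n} - D)) (ksum (young n D) (delta w)) u"
proof -
  let ?Y = "young n ({1..<n} - D)"
  have up: "u permutes {1..n}" using u by simp
  have "word_polytabloid n D w (word_tabloid n D u) =
    (\<Sum>q\<in>young n D. of_int (sign q) * (\<Sum>r\<in>?Y. if u \<circ> r = w \<circ> q then 1 else 0))"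
    unfolding word_polytabloid_def
  proof (intro sum.cong refl arg_cong2[of _ _ _ _ "(*)"])
    fix q assume "q \<in> young n D"
    then have wq: "w \<circ> q \<in> perms n" using w by (auto simp: young_def intro: permutes_compose)
    have "r = inv u \<circ> (w \<circ> q) \<longleftrightarrow> u \<circ> r = w \<circ> q" for r
    proof
      assume "r = inv u \<circ> (w \<circ> q)"
      then have "u \<circ> r = (u \<circ> inv u) \<circ> (w \<circ> q)" by (simp only: comp_assoc)
      then show "u \<circ> r = w \<circ> q" by (simp only: permutes_inv_o[OF up] id_comp)
    next
      assume "u \<circ> r = w \<circ> q"
      then have "inv u \<circ> (w \<circ> q) = inv u \<circ> u \<circ> r" by (simp only: comp_assoc)
      then show "r = inv u \<circ> (w \<circ> q)" by (simp only: permutes_inv_o[OF up] id_comp)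
    qed
    then have "(\<Sum>r\<in>?Y. if u \<circ> r = w \<circ> q then 1 else 0) = (\<Sum>r\<in>?Y. if r = inv u \<circ> (w \<circ> q) then 1 else (0::complex))"
      by simp
    also have "\<dots> = (if inv u \<circ> (w \<circ> q) \<in> ?Y then 1 else 0)"
      by (simp add: finite_young)
    finally show "(if word_tabloid n D u = word_tabloid n D (w \<circ> q) then 1 else 0) =
      (\<Sum>r\<in>?Y. if u \<circ> r = w \<circ> q then 1 else (0::complex))"
      unfolding word_tabloid_eq_iff[OF D u wq] by simp
  qed
  also have "\<dots> = (\<Sum>r\<in>?Y. \<Sum>q\<in>young n D. of_int (sign q) * (if u \<circ> r = w \<circ> q then 1 else 0))"
    unfolding sum_distrib_left by (rule sum.swap)
  also have "\<dots> = (\<Sum>r\<in>?Y. \<Sum>q\<in>young n D. of_int (sign (inv q)) * (if u \<circ> r = w \<circ> inv q then 1 else 0))"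
    by (intro sum.cong refl sum.reindex_bij_betw[OF bij_betw_inv_young, symmetric])
  also have "\<dots> = (\<Sum>r\<in>?Y. \<Sum>q\<in>young n D. of_int (sign q) * delta w (u \<circ> r \<circ> q))"
  proof (intro sum.cong refl arg_cong2[of _ _ _ _ "(*)"])
    fix r q assume q: "q \<in> young n D"
    then have qp: "q permutes {1..n}" by (simp add: young_def)
    then have "permutation q" by (rule permutes_imp_permutation[rotated]) simp
    then show "complex_of_int (sign (inv q)) = of_int (sign q)" by (simp add: sign_inverse)
    have "u \<circ> r = w \<circ> inv q \<longleftrightarrow> u \<circ> r \<circ> q = w"
    proof
      assume "u \<circ> r = w \<circ> inv q"
      then have "u \<circ> r \<circ> q = w \<circ> (inv q \<circ> q)" by (simp only: comp_assoc)
      then show "u \<circ> r \<circ> q = w" by (simp only: permutes_inv_o[OF qp] comp_id)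
    next
      assume "u \<circ> r \<circ> q = w"
      then have "w \<circ> inv q = u \<circ> r \<circ> q \<circ> inv q" by (simp only:)
      also have "\<dots> = u \<circ> r \<circ> (q \<circ> inv q)" by (simp only: comp_assoc)
      finally have "w \<circ> inv q = u \<circ> r \<circ> (q \<circ> inv q)" .
      then show "u \<circ> r = w \<circ> inv q" by (simp only: permutes_inv_o[OF qp] comp_id)
    qed
    then show "(if u \<circ> r = w \<circ> inv q then 1 else 0) = delta w (u \<circ> r \<circ> q)" by (simp add: delta_def)
  qed
  finally show ?thesis by (simp add: rsum_def ksum_def)
qed

lemma word_polytabloid_support:
  assumes "w \<in> perms n" "T \<notin> word_tabloid n D ` perms n"
  shows "word_polytabloid n D w T = 0"
  unfolding word_polytabloid_def
proof (intro sum.neutral ballI)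
  fix q assume "q \<in> young n D"
  then have "w \<circ> q \<in> perms n" using assms by (auto simp: young_def intro: permutes_compose)
  then have "T \<noteq> word_tabloid n D (w \<circ> q)" using assms(2) by blast
  then show "of_int (sign q) * (if T = word_tabloid n D (w \<circ> q) then 1 else 0) = (0::complex)" by simp
qed

lemma word_tabloid_translate:
  "(\<lambda>r. p ` word_tabloid n D w r) = word_tabloid n D (p \<circ> w)"
  by (simp add: word_tabloid_def image_comp)

lemma word_polytabloid_translate:
  assumes p: "p permutes {1..n}"
  shows "word_polytabloid n D w (\<lambda>r. inv p ` T r) = word_polytabloid n D (p \<circ> w) T"
proof -
  have "(\<lambda>r. inv p ` T r) = word_tabloid n D (w \<circ> q) \<longleftrightarrow> T = word_tabloid n D (p \<circ> w \<circ> q)" for q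
  proof
    assume "(\<lambda>r. inv p ` T r) = word_tabloid n D (w \<circ> q)"
    from arg_cong[OF this, of "\<lambda>S r. p ` S r"]
    have "(\<lambda>r. p ` inv p ` T r) = (\<lambda>r. p ` word_tabloid n D (w \<circ> q) r)" .
    then have "(\<lambda>r. T r) = word_tabloid n D (p \<circ> (w \<circ> q))"
      unfolding word_tabloid_translate image_comp permutes_inv_o(1)[OF p] by simp
    then show "T = word_tabloid n D (p \<circ> w \<circ> q)" by (simp add: comp_assoc)
  next
    assume "T = word_tabloid n D (p \<circ> w \<circ> q)"
    then have "(\<lambda>r. inv p ` T r) = word_tabloid n D (inv p \<circ> (p \<circ> w \<circ> q))"
      by (simp only: word_tabloid_translate)
    also have "inv p \<circ> (p \<circ> w \<circ> q) = (inv p \<circ> p) \<circ> w \<circ> q" by (simp only: comp_assoc)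
    finally show "(\<lambda>r. inv p ` T r) = word_tabloid n D (w \<circ> q)"
      by (simp only: permutes_inv_o(2)[OF p] id_comp)
  qed
  then show ?thesis by (simp add: word_polytabloid_def)
qed

text \<open>Conjugation by \<open>w\<close> carries the column group on positions to the column
  stabilizer on entries and preserves signs. The tableau is compared with \<open>w\<close> only on
  the ribbon, because its values elsewhere are arbitrary.\<close>

lemma polytabloid_ribbon:
  assumes D: "D \<subseteq> {1..<n}" and w: "w \<in> perms n" and t: "\<And>j. j \<in> {1..n} \<Longrightarrow> t (cell D j) = w j"
  shows "polytabloid n (ribbon n D) t = word_polytabloid n D w"
proof
  fix T
  have wp: "w permutes {1..n}" using w by simp
  have col: "t ` {b \<in> ribbon n D. snd b = c} = w ` {j \<in> {1..n}. block_index D j = c}" for c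
  proof -
    have "{b \<in> ribbon n D. snd b = c} = cell D ` {j \<in> {1..n}. block_index D j = c}"
      unfolding ribbon_def by (auto simp: cell_def)
    then have "t ` {b \<in> ribbon n D. snd b = c} = (\<lambda>j. t (cell D j)) ` {j \<in> {1..n}. block_index D j = c}"
      by (simp add: image_image)
    also have "\<dots> = w ` {j \<in> {1..n}. block_index D j = c}"
      by (rule image_cong) (use t in auto)
    finally show ?thesis .
  qed
  have tab: "tabloid_of (ribbon n D) (q \<circ> t) = word_tabloid n D (q \<circ> w)" for q
  proof
    fix r
    have "{b \<in> ribbon n D. fst b = r} = cell D ` {j \<in> {1..n}. fst (cell D j) = r}"
      unfolding ribbon_def by auto
    then have "(q \<circ> t) ` {b \<in> ribbon n D. fst b = r} = (\<lambda>j. q (t (cell D j))) ` {j \<in> {1..n}. fst (cell D j) = r}"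
      by (simp add: image_image)
    also have "\<dots> = (q \<circ> w) ` {j \<in> {1..n}. fst (cell D j) = r}"
      by (rule image_cong) (use t in auto)
    finally show "tabloid_of (ribbon n D) (q \<circ> t) r = word_tabloid n D (q \<circ> w) r"
      by (simp add: tabloid_of_def word_tabloid_def)
  qed
  let ?g = "\<lambda>q. w \<circ> q \<circ> inv w"
  have stab: "column_stabilizer n (ribbon n D) t =
     {q. q permutes {1..n} \<and> (\<forall>c. q ` w ` {j \<in> {1..n}. block_index D j = c} = w ` {j \<in> {1..n}. block_index D j = c})}"
    by (simp add: column_stabilizer_def col)
  have gp: "?g q permutes {1..n}" if "q permutes {1..n}" for q
    using that wp permutes_inv[OF wp] by (intro permutes_compose)
  have gp': "inv w \<circ> q \<circ> w permutes {1..n}" if "q permutes {1..n}" for q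
    using that wp permutes_inv[OF wp] by (intro permutes_compose)
  have bij: "bij_betw ?g (young n D) (column_stabilizer n (ribbon n D) t)"
  proof (rule bij_betw_byWitness[where f' = "\<lambda>q. inv w \<circ> q \<circ> w"])
    have "inv w \<circ> (w \<circ> q \<circ> inv w) \<circ> w = (inv w \<circ> w) \<circ> q \<circ> (inv w \<circ> w)" for q by (simp only: comp_assoc)
    then show "\<forall>q\<in>young n D. inv w \<circ> (w \<circ> q \<circ> inv w) \<circ> w = q"
      by (simp only: permutes_inv_o[OF wp] id_comp comp_id) blast
    have "w \<circ> (inv w \<circ> q \<circ> w) \<circ> inv w = (w \<circ> inv w) \<circ> q \<circ> (w \<circ> inv w)" for q by (simp only: comp_assoc)
    then show "\<forall>q\<in>column_stabilizer n (ribbon n D) t. w \<circ> (inv w \<circ> q \<circ> w) \<circ> inv w = q"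
      by (simp only: permutes_inv_o[OF wp] id_comp comp_id) blast
    show "?g ` young n D \<subseteq> column_stabilizer n (ribbon n D) t"
    proof (rule image_subsetI)
      fix q assume q: "q \<in> young n D"
      then have qp: "q permutes {1..n}" by (simp add: young_def)
      have "?g q ` w ` {j \<in> {1..n}. block_index D j = c} = w ` {j \<in> {1..n}. block_index D j = c}" for c
      proof -
        have "?g q \<circ> w = w \<circ> q" by (simp only: comp_assoc permutes_inv_o[OF wp] comp_id)
        then have "?g q ` w ` {j \<in> {1..n}. block_index D j = c} = w ` q ` {j \<in> {1..n}. block_index D j = c}"
          by (simp only: image_comp)
        then show ?thesis using q unfolding young_iff_columns by simp
      qed
      then show "?g q \<in> column_stabilizer n (ribbon n D) t" unfolding stab using gp[OF qp] by blast
    qed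
    show "(\<lambda>q. inv w \<circ> q \<circ> w) ` column_stabilizer n (ribbon n D) t \<subseteq> young n D"
    proof (rule image_subsetI)
      fix q assume q: "q \<in> column_stabilizer n (ribbon n D) t"
      then have qp: "q permutes {1..n}" by (simp add: stab)
      have "(inv w \<circ> q \<circ> w) ` {j \<in> {1..n}. block_index D j = c} = {j \<in> {1..n}. block_index D j = c}" for c
      proof -
        have "(inv w \<circ> q \<circ> w) ` {j \<in> {1..n}. block_index D j = c} =
          inv w ` q ` w ` {j \<in> {1..n}. block_index D j = c}" by (simp only: image_comp comp_assoc)
        also have "\<dots> = inv w ` w ` {j \<in> {1..n}. block_index D j = c}" using q unfolding stab by simp
        also have "\<dots> = {j \<in> {1..n}. block_index D j = c}"
          unfolding image_comp permutes_inv_o(2)[OF wp] by simp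
        finally show ?thesis .
      qed
      then show "inv w \<circ> q \<circ> w \<in> young n D" unfolding young_iff_columns using gp'[OF qp] by blast
    qed
  qed
  have sgn: "sign (?g q) = sign q" if "q permutes {1..n}" for q
  proof -
    have "permutation w" using wp by (rule permutes_imp_permutation[rotated]) simp
    then have "sign (inv w) = sign w" by (rule sign_inverse)
    moreover have "sign (?g q) = sign w * sign q * sign (inv w)"
      unfolding sign_perm_comp[OF permutes_compose[OF that wp] permutes_inv[OF wp]] sign_perm_comp[OF wp that] ..
    ultimately show ?thesis by (simp add: mult.commute mult.left_commute sign_def)
  qed
  have "polytabloid n (ribbon n D) t T = (\<Sum>q\<in>column_stabilizer n (ribbon n D) t.
     of_int (sign q) * (if T = word_tabloid n D (q \<circ> w) then 1 else 0))"
    by (simp add: polytabloid_def tab)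
  also have "\<dots> = (\<Sum>q\<in>young n D. of_int (sign (?g q)) * (if T = word_tabloid n D (?g q \<circ> w) then 1 else 0))"
    by (rule sum.reindex_bij_betw[OF bij, symmetric])
  also have "\<dots> = word_polytabloid n D w T"
    unfolding word_polytabloid_def
  proof (rule sum.cong[OF refl])
    fix q assume "q \<in> young n D"
    then have "q permutes {1..n}" by (simp add: young_def)
    note s = sgn[OF this]
    have "?g q \<circ> w = w \<circ> q" by (simp only: comp_assoc permutes_inv_o[OF wp] comp_id)
    then show "of_int (sign (?g q)) * (if T = word_tabloid n D (?g q \<circ> w) then 1 else 0) =
      of_int (sign q) * (if T = word_tabloid n D (w \<circ> q) then 1 else (0::complex))" by (simp only: s)
  qed
  finally show "polytabloid n (ribbon n D) t T = word_polytabloid n D w T" .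
qed

lemma specht_module_ribbon:
  assumes D: "D \<subseteq> {1..<n}"
  shows "specht_module n (ribbon n D) = cfun.span (word_polytabloid n D ` perms n)"
proof -
  have cb: "bij_betw (cell D) {1..n} (ribbon n D)"
    using inj_on_cell[OF D] by (simp add: bij_betw_def ribbon_def)
  have "polytabloid n (ribbon n D) ` tableaux n (ribbon n D) = word_polytabloid n D ` perms n"
  proof
    show "polytabloid n (ribbon n D) ` tableaux n (ribbon n D) \<subseteq> word_polytabloid n D ` perms n"
    proof (rule image_subsetI)
      fix t assume "t \<in> tableaux n (ribbon n D)"
      then have "bij_betw t (ribbon n D) {1..n}" by (simp add: tableaux_def)
      then have tb: "bij_betw (t \<circ> cell D) {1..n} {1..n}" using cb bij_betw_trans by blast
      define w where "w j = (if j \<in> {1..n} then t (cell D j) else j)" for j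
      have "bij_betw w {1..n} {1..n}"
        using tb by (subst bij_betw_cong[of _ w "t \<circ> cell D"]) (auto simp: w_def)
      then have w: "w \<in> perms n" by (auto intro!: bij_imp_permutes simp: w_def)
      have "polytabloid n (ribbon n D) t = word_polytabloid n D w"
        using polytabloid_ribbon[OF D w, of t] by (simp add: w_def)
      then show "polytabloid n (ribbon n D) t \<in> word_polytabloid n D ` perms n" using w by blast
    qed
    show "word_polytabloid n D ` perms n \<subseteq> polytabloid n (ribbon n D) ` tableaux n (ribbon n D)"
    proof (rule image_subsetI)
      fix w assume w: "w \<in> perms n"
      then have wp: "w permutes {1..n}" by simp
      define t where "t = w \<circ> inv_into {1..n} (cell D)"
      have "bij_betw t (ribbon n D) {1..n}"
        unfolding t_def using bij_betw_trans[OF bij_betw_inv_into[OF cb] permutes_imp_bij[OF wp]] .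
      then have "t \<in> tableaux n (ribbon n D)" by (simp add: tableaux_def)
      moreover have "t (cell D j) = w j" if "j \<in> {1..n}" for j
        using bij_betw_inv_into_left[OF cb that] by (simp add: t_def)
      then have "polytabloid n (ribbon n D) t = word_polytabloid n D w" by (rule polytabloid_ribbon[OF D w])
      ultimately show "word_polytabloid n D w \<in> polytabloid n (ribbon n D) ` tableaux n (ribbon n D)"
        by (metis imageI)
    qed
  qed
  then show ?thesis by (simp add: specht_module_def)
qed

section \<open>From functions on tabloids to functions on words, and the Foulkes character\<close>

definition pull_back :: "nat \<Rightarrow> nat set \<Rightarrow> (tabloid \<Rightarrow> complex) \<Rightarrow> (nat \<Rightarrow> nat) \<Rightarrow> complex" where
  "pull_back n D F u = (if u \<in> perms n then F (word_tabloid n D u) else 0)"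

lemma pull_back_in_word_functions: "pull_back n D F \<in> word_functions n"
  by (simp add: pull_back_def word_functions_def)

lemma pull_back_polytabloid:
  assumes "D \<subseteq> {1..<n}" "w \<in> perms n"
  shows "in_component n D (pull_back n D (word_polytabloid n D w))"
  unfolding in_component_def pull_back_def using word_polytabloid_at_tabloid[OF assms(1) _ assms(2)] by auto

lemma pull_back_descent_vector:
  assumes w: "w \<in> perms n" and u: "u \<in> perms n"
  shows "word_polytabloid n (des n w) w (word_tabloid n (des n w) u) = descent_vector n w u"
  using word_polytabloid_at_tabloid[OF des_subset u w] by (simp add: descent_vector_def)

lemma span_word_polytabloids:
  assumes "F \<in> cfun.span (word_polytabloid n D ` perms n)"
  shows "\<exists>c. F = (\<lambda>T. \<Sum>w\<in>perms n. c w * word_polytabloid n D w T)"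
  using assms
proof (induction rule: cfun.span_induct_alt)
  case base
  show ?case by (rule exI[of _ "\<lambda>_. 0"]) (simp add: fun_eq_iff)
next
  case (step a x y)
  obtain v where v: "v \<in> perms n" "x = word_polytabloid n D v" using step(1) by blast
  obtain c where c: "y = (\<lambda>T. \<Sum>w\<in>perms n. c w * word_polytabloid n D w T)" using step(2) by blast
  show ?case
  proof (rule exI[of _ "\<lambda>w. (if w = v then a else 0) + c w"], rule ext)
    fix T
    have "(\<Sum>w\<in>perms n. ((if w = v then a else 0) + c w) * word_polytabloid n D w T) =
      (\<Sum>w\<in>perms n. if w = v then a * word_polytabloid n D v T else 0) + y T"
      unfolding c sum.distrib[symmetric] by (intro sum.cong) (auto simp: distrib_right)
    then show "((\<lambda>T. a * x T) + y) T = (\<Sum>w\<in>perms n. ((if w = v then a else 0) + c w) * word_polytabloid n D w T)"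
      using v finite_perms[of n] by simp
  qed
qed

text \<open>The pull-back lies in the component of \<open>D\<close>, so only coordinates at words
  with descent set \<open>D\<close> survive. No information is lost, since polytabloids vanish off
  the tabloids of words.\<close>

lemma specht_expand:
  assumes D: "D \<subseteq> {1..<n}" and F: "F \<in> specht_module n (ribbon n D)"
  shows "F T = (\<Sum>w | w \<in> perms n \<and> des n w = D. coord n w (pull_back n D F) * word_polytabloid n D w T)"
proof -
  obtain c where c: "F = (\<lambda>T. \<Sum>w\<in>perms n. c w * word_polytabloid n D w T)"
    using F span_word_polytabloids unfolding specht_module_ribbon[OF D] by blast
  show ?thesis
  proof (cases "T \<in> word_tabloid n D ` perms n")
    case False
    then have "F T = 0"
      unfolding c using word_polytabloid_support by (intro sum.neutral) auto
    moreover have "(\<Sum>w | w \<in> perms n \<and> des n w = D. coord n w (pull_back n D F) * word_polytabloid n D w T) = 0"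
      using False word_polytabloid_support by (intro sum.neutral) auto
    ultimately show ?thesis by simp
  next
    case True
    then obtain u where u: "u \<in> perms n" "T = word_tabloid n D u" by blast
    have comp: "in_component n D (pull_back n D F)"
    proof -
      have "pull_back n D F = (\<lambda>u. \<Sum>w\<in>perms n. c w * pull_back n D (word_polytabloid n D w) u)"
        by (rule ext) (simp add: pull_back_def c)
      then show ?thesis using in_component_linear[of "perms n" n D, OF pull_back_polytabloid[OF D]] by simp
    qed
    have "F T = pull_back n D F u" using u by (simp add: pull_back_def)
    also have "\<dots> = (\<Sum>w\<in>perms n. coord n w (pull_back n D F) * descent_vector n w u)"
      using fun_cong[OF coord_expand[OF pull_back_in_word_functions]] .
    also have "\<dots> = (\<Sum>w | w \<in> perms n \<and> des n w = D. coord n w (pull_back n D F) * descent_vector n w u)"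
      using finite_perms coord_in_component[OF pull_back_in_word_functions comp D]
      by (intro sum.mono_neutral_right) auto
    also have "\<dots> = (\<Sum>w | w \<in> perms n \<and> des n w = D. coord n w (pull_back n D F) * word_polytabloid n D w T)"
      using pull_back_descent_vector u by (intro sum.cong refl) auto
    finally show ?thesis .
  qed
qed

lemma pull_back_linear:
  "pull_back n D (\<lambda>T. \<Sum>j\<in>J. c j * g j T) = (\<lambda>u. \<Sum>j\<in>J. c j * pull_back n D (g j) u)"
  by (rule ext) (simp add: pull_back_def)

lemma specht_module_subspace: "cfun.subspace (specht_module n B)"
  unfolding specht_module_def by (rule cfun.subspace_span)

lemma foulkes_module_subspace: "cfun.subspace (foulkes_module n i)"
  unfolding cfun.subspace_def
proof (intro conjI ballI allI)
  note sub = specht_module_subspace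
  show "0 \<in> foulkes_module n i"
    using cfun.subspace_0[OF sub] by (simp add: foulkes_module_def zero_fun_def)
  show "F + G \<in> foulkes_module n i" if "F \<in> foulkes_module n i" "G \<in> foulkes_module n i" for F G
    using that cfun.subspace_add[OF sub] by (simp add: foulkes_module_def plus_fun_def fun_eq_iff)
  show "(\<lambda>x. c * F x) \<in> foulkes_module n i" if "F \<in> foulkes_module n i" for c F
    using that cfun.subspace_scale[OF sub] by (simp add: foulkes_module_def fun_eq_iff)
qed

lemma specht_translate:
  assumes D: "D \<subseteq> {1..<n}" and p: "p permutes {1..n}" and F: "F \<in> specht_module n (ribbon n D)"
  shows "(\<lambda>T. F (\<lambda>r. inv p ` T r)) \<in> specht_module n (ribbon n D)"
proof -
  obtain c where c: "F = (\<lambda>T. \<Sum>w\<in>perms n. c w * word_polytabloid n D w T)"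
    using F span_word_polytabloids unfolding specht_module_ribbon[OF D] by blast
  have "(\<lambda>T. F (\<lambda>r. inv p ` T r)) = (\<lambda>T. \<Sum>w\<in>perms n. c w * word_polytabloid n D (p \<circ> w) T)"
    unfolding c by (simp only: word_polytabloid_translate[OF p])
  also have "\<dots> \<in> specht_module n (ribbon n D)"
  proof (rule cfun_subspace_sum[OF specht_module_subspace])
    fix w assume "w \<in> perms n"
    then have "p \<circ> w \<in> perms n" using p by (auto intro: permutes_compose)
    then show "word_polytabloid n D (p \<circ> w) \<in> specht_module n (ribbon n D)"
      unfolding specht_module_ribbon[OF D] by (intro cfun.span_base imageI)
  qed
  finally show ?thesis .
qed

text \<open>The border shapes with \<open>i + 1\<close> rows are the ribbons with \<open>i\<close>
  upward steps, and each has the polytabloids of the words with that descent set as a spanning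
  family. Pulling back commutes with the action on entries, so the diagonal coefficients are those
  of left translation on descent vectors.\<close>

lemma foulkes_char_eq:
  assumes n: "n \<ge> 1" and p: "p permutes {1..n}"
  shows "foulkes_char n i p = (\<Sum>w | w \<in> perms n \<and> card (des n w) = i. descent_trace n p w)"
proof -
  define I where "I = {w. w \<in> perms n \<and> card (des n w) = i}"
  define e where "e w = (\<lambda>(B, T). if B = ribbon n (des n w) then word_polytabloid n (des n w) w T else 0)"
    for w
  define l where "l w F = coord n w (pull_back n (des n w) (\<lambda>T. F (ribbon n (des n w), T)))"
    for w and F :: "(nat \<times> nat) set \<times> tabloid \<Rightarrow> complex"
  have I: "finite I" unfolding I_def using finite_perms by simp
  have ribbon_mem: "ribbon n (des n w) \<in> border_shapes n (i + 1)" if "w \<in> I" for w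
    using ribbon_in_border_shapes[OF n des_subset, of w] that by (simp add: I_def)
  have poly_mem: "word_polytabloid n D w \<in> specht_module n (ribbon n D)" if "D \<subseteq> {1..<n}" "w \<in> perms n" for D w
    unfolding specht_module_ribbon[OF that(1)] using that(2) by (intro cfun.span_base imageI)
  have "trace_on (foulkes_module n i) (foulkes_action p) = (\<Sum>w\<in>I. l w (foulkes_action p (e w)))"
  proof (rule trace_on_frame[OF foulkes_module_subspace I])
    fix w assume w: "w \<in> I"
    show "e w \<in> foulkes_module n i"
      unfolding foulkes_module_def
    proof (intro CollectI allI conjI impI)
      fix B
      show "(\<lambda>T. e w (B, T)) \<in> specht_module n B"
      proof (cases "B = ribbon n (des n w)")
        case True
        then show ?thesis using poly_mem[OF des_subset, of w w] w by (simp add: e_def I_def)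
      next
        case False
        then show ?thesis using cfun.subspace_0[OF specht_module_subspace] by (simp add: e_def zero_fun_def)
      qed
      assume "B \<notin> border_shapes n (i + 1)"
      then have "B \<noteq> ribbon n (des n w)" using ribbon_mem[OF w] by metis
      then show "(\<lambda>T. e w (B, T)) = (\<lambda>T. 0)" by (simp add: e_def)
    qed
  next
    fix F assume F: "F \<in> foulkes_module n i"
    show "F = (\<lambda>x. \<Sum>w\<in>I. l w F * e w x)"
    proof
      fix x :: "(nat \<times> nat) set \<times> tabloid"
      obtain B T where x: "x = (B, T)" by (cases x)
      show "F x = (\<Sum>w\<in>I. l w F * e w x)"
      proof (cases "B \<in> border_shapes n (i + 1)")
        case False
        then have "F (B, T) = 0" using F by (auto simp: foulkes_module_def fun_eq_iff)
        moreover have "e w (B, T) = 0" if "w \<in> I" for w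
          using ribbon_mem[OF that] False by (auto simp: e_def)
        ultimately show ?thesis using x by simp
      next
        case True
        obtain D where D: "D \<subseteq> {1..<n}" "card D = i" "B = ribbon n D"
          using border_shape_is_ribbon[OF n True] .
        have sp: "(\<lambda>T. F (B, T)) \<in> specht_module n (ribbon n D)"
          using F True D by (auto simp: foulkes_module_def)
        have eq: "B = ribbon n (des n w) \<longleftrightarrow> des n w = D" if "w \<in> I" for w
          using ribbon_inj[OF D(1) des_subset, of w] that D by (auto simp: I_def)
        have "(\<Sum>w\<in>I. l w F * e w x) = (\<Sum>w\<in>I. if des n w = D then
            coord n w (pull_back n D (\<lambda>T. F (B, T))) * word_polytabloid n D w T else 0)"
        proof (rule sum.cong[OF refl])
          fix w assume "w \<in> I"
          note eq' = eq[OF this, unfolded D(3)]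
          show "l w F * e w x = (if des n w = D then
            coord n w (pull_back n D (\<lambda>T. F (B, T))) * word_polytabloid n D w T else 0)"
            by (cases "des n w = D") (simp_all add: x e_def l_def eq' D(3))
        qed
        also have "\<dots> = (\<Sum>w\<in>{w \<in> I. des n w = D}. coord n w (pull_back n D (\<lambda>T. F (B, T))) * word_polytabloid n D w T)"
          by (rule sum.inter_filter[OF I, symmetric])
        also have "{w \<in> I. des n w = D} = {w. w \<in> perms n \<and> des n w = D}"
          using D(2) by (auto simp: I_def)
        finally show ?thesis using specht_expand[OF D(1) sp, of T] x by simp
      qed
    qed
    show "foulkes_action p F \<in> foulkes_module n i"
      unfolding foulkes_module_def
    proof (intro CollectI allI conjI impI)
      fix B assume B: "B \<in> border_shapes n (i + 1)"
      obtain D where D: "D \<subseteq> {1..<n}" "card D = i" "B = ribbon n D"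
        using border_shape_is_ribbon[OF n B] .
      have "(\<lambda>T. F (B, T)) \<in> specht_module n (ribbon n D)"
        using F B D by (auto simp: foulkes_module_def)
      from specht_translate[OF D(1) p this] show "(\<lambda>T. foulkes_action p F (B, T)) \<in> specht_module n B"
        by (simp add: foulkes_action_def D(3))
    next
      fix B assume "B \<notin> border_shapes n (i + 1)"
      then have "F (B, T) = 0" for T using F by (auto simp: foulkes_module_def fun_eq_iff)
      then show "(\<lambda>T. foulkes_action p F (B, T)) = (\<lambda>T. 0)" by (simp add: foulkes_action_def)
    qed
  next
    fix J :: "((nat \<times> nat) set \<times> tabloid \<Rightarrow> complex) set" and c g
    show "foulkes_action p (\<lambda>x. \<Sum>j\<in>J. c j * g j x) = (\<lambda>x. \<Sum>j\<in>J. c j * foulkes_action p (g j) x)"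
      by (rule ext) (simp add: foulkes_action_def case_prod_unfold)
    fix w
    show "l w (\<lambda>x. \<Sum>j\<in>J. c j * g j x) = (\<Sum>j\<in>J. c j * l w (g j))"
      unfolding l_def pull_back_linear by (rule coord_linear) (rule pull_back_in_word_functions)
  qed
  also have "\<dots> = (\<Sum>w\<in>I. descent_trace n p w)"
  proof (rule sum.cong[OF refl])
    fix w assume "w \<in> I"
    then have w: "w \<in> perms n" by (simp add: I_def)
    have "pull_back n (des n w) (\<lambda>T. foulkes_action p (e w) (ribbon n (des n w), T)) =
      (\<lambda>u. descent_vector n w (inv p \<circ> u))"
    proof
      fix u
      show "pull_back n (des n w) (\<lambda>T. foulkes_action p (e w) (ribbon n (des n w), T)) u =
        descent_vector n w (inv p \<circ> u)"
      proof (cases "u \<in> perms n")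
        case True
        then have "inv p \<circ> u \<in> perms n" using permutes_inv[OF p] by (auto intro: permutes_compose)
        from pull_back_descent_vector[OF w this] show ?thesis
          using True by (simp add: pull_back_def foulkes_action_def e_def word_tabloid_translate)
      next
        case False
        have "(\<lambda>u. descent_vector n w (inv p \<circ> u)) \<in> word_functions n"
          by (rule word_functions_translate[OF p descent_vector_in_word_functions[OF w]])
        then show ?thesis using False by (simp add: word_functions_def pull_back_def)
      qed
    qed
    then show "l w (foulkes_action p (e w)) = descent_trace n p w"
      by (simp add: l_def descent_trace_def)
  qed
  finally show ?thesis by (simp add: foulkes_char_def I_def)
qed

text \<open>The words are grouped by their number of descents; with more than \<open>k\<close>
  descents the upper entry of the binomial coefficient falls below \<open>n\<close>.\<close>

lemma cyc_power_eq_sum_foulkes: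
  assumes k: "k < n" and p: "p permutes {1..n}"
  shows "cyc_power n (k + 1) p = (\<Sum>i\<le>k. of_nat ((n + (k - i)) choose n) * foulkes_char n i p)"
proof -
  have n: "n \<ge> 1" using k by simp
  let ?f = "\<lambda>w. of_nat ((n + k - card (des n w)) choose n) * descent_trace n p w"
  have "cyc_power n (k + 1) p = (\<Sum>w\<in>perms n. ?f w)"
    by (rule cyc_power_eq_sum_descent_trace[OF n p])
  also have "\<dots> = (\<Sum>w | w \<in> perms n \<and> card (des n w) \<le> k. ?f w)"
  proof (rule sum.mono_neutral_right[OF finite_perms])
    show "\<forall>w\<in>perms n - {w. w \<in> perms n \<and> card (des n w) \<le> k}. ?f w = 0"
    proof
      fix w assume w: "w \<in> perms n - {w. w \<in> perms n \<and> card (des n w) \<le> k}"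
      then have "k < card (des n w)" by auto
      then have "n + k - card (des n w) < n" using n by linarith
      then show "?f w = 0" by (simp add: binomial_eq_0)
    qed
  qed auto
  also have "\<dots> = (\<Sum>i\<le>k. \<Sum>w | w \<in> {w. w \<in> perms n \<and> card (des n w) \<le> k} \<and> card (des n w) = i. ?f w)"
    by (rule sum.group[symmetric]) (use finite_perms in auto)
  also have "\<dots> = (\<Sum>i\<le>k. of_nat ((n + (k - i)) choose n) * foulkes_char n i p)"
  proof (rule sum.cong[OF refl])
    fix i assume i: "i \<in> {..k}"
    \<comment> \<open>For \<open>i \<le> k\<close> the truncated differences
      \<open>n + k - i\<close> and \<open>n + (k - i)\<close> agree.\<close>
    have "(\<Sum>w | w \<in> {w. w \<in> perms n \<and> card (des n w) \<le> k} \<and> card (des n w) = i. ?f w) =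
      (\<Sum>w | w \<in> perms n \<and> card (des n w) = i. of_nat ((n + (k - i)) choose n) * descent_trace n p w)"
      by (rule sum.cong) (use i in auto)
    then show "(\<Sum>w | w \<in> {w. w \<in> perms n \<and> card (des n w) \<le> k} \<and> card (des n w) = i. ?f w) =
      of_nat ((n + (k - i)) choose n) * foulkes_char n i p"
      unfolding foulkes_char_eq[OF n p] by (simp add: sum_distrib_left)
  qed
  finally show ?thesis .
qed

theorem theorem2p4:
  fixes n :: nat
  assumes "n \<ge> 1"
  shows "\<forall>i<n. \<forall>p. p permutes {1..n} \<longrightarrow>
           foulkes_char n i p = gram_schmidt (cyc_inner n) (\<lambda>j. cyc_power n (j + 1)) i p"
  using gram_schmidt_cyc_power[OF assms cyc_power_eq_sum_foulkes, symmetric] by blast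

end
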